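(* Let $\Omega\subset \mathrm{P}(V)$ be a rank-one divisible convex set. Then $\Lambda^{\mathrm{prox}}_\Omega=\partial\Omega$.
   Context: $V$ is a real vector space of finite dimension $d+1$ with $d\ge 1$, and $\mathrm{P}(V)$ is its projective space. A subset of $\mathrm{P}(V)$ is properly convex if it is convex and bounded in some affine chart. For a (non-empty) properly convex open set $\Omega\subset \mathrm{P}(V)$, $\overline\Omega$ is its closure in $\mathrm{P}(V)$, $\partial\Omega=\overline\Omega\smallsetminus\Omega$ is its boundary, and for $\xi,\eta\in\overline\Omega$, $[\xi,\eta]$ denotes the closed projective segment between $\xi$ and $\eta$ contained in $\overline\Omega$. $\mathrm{Aut}(\Omega)\subset \mathrm{PGL}(V)$ is the closed subgroup of elements preserving $\Omega$. A properly convex open set $\Omega$ is divisible (one says "$\Omega$ is a divisible convex set") if there is a discrete subgroup $\Gamma\subset\mathrm{PGL}(V)$ that preserves $\Omega$ and acts cocompactly on it. A divisible convex set $\Omega$ is rank-one if there is a point $\xi\in\partial\Omega$ which is strongly extremal, meaning that $[\xi,\eta]\cap\Omega\neq\emptyset$ for every $\eta\in\partial\Omega\smallsetminus\{\xi\}$. An element $g\in\mathrm{PGL}(V)$ is proximal if it has an attracting fixed point in $\mathrm{P}(V)$; equivalently, a lift of $g$ to $\mathrm{GL}(V)$ has a simple eigenvalue whose modulus is strictly larger than that of all other (complex) eigenvalues, and the attracting fixed point is the corresponding eigenline. The proximal limit set $\Lambda^{\mathrm{prox}}_\Omega$ is the closure in $\mathrm{P}(V)$ of the set of attracting fixed points of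 proximal elements of $\mathrm{Aut}(\Omega)$. *)

theory Defs
  imports "HOL-Analysis.Analysis" "HOL-Algebra.Group"
begin

section \<open>The projective space \<open>P(V)\<close>\<close>

text \<open>\<open>V\<close> is the type \<^typ>\<open>'a::euclidean_space\<close>; its inner product and norm only serve to give
  the canonical topology of a finite-dimensional real vector space.\<close>

definition proj_rel :: "'a::euclidean_space \<Rightarrow> 'a \<Rightarrow> bool"
  where "proj_rel v w \<longleftrightarrow> v \<noteq> 0 \<and> w \<noteq> 0 \<and> (\<exists>c. c \<noteq> 0 \<and> w = c *\<^sub>R v)"

lemma part_equivp_proj_rel: "part_equivp (proj_rel :: 'a::euclidean_space \<Rightarrow> 'a \<Rightarrow> bool)"
proof (rule part_equivpI)
  obtain b :: 'a where "b \<in> Basis" using nonempty_Basis by blast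
  then have "b \<noteq> 0" by auto
  then show "\<exists>x::'a. proj_rel x x" unfolding proj_rel_def by (metis one_neq_zero scaleR_one)
  show "symp (proj_rel :: 'a \<Rightarrow> 'a \<Rightarrow> bool)"
  proof (rule sympI)
    fix v w :: 'a assume "proj_rel v w"
    then obtain c where c: "v \<noteq> 0" "w \<noteq> 0" "c \<noteq> 0" "w = c *\<^sub>R v" by (auto simp: proj_rel_def)
    then have "v = inverse c *\<^sub>R w" by simp
    then show "proj_rel w v" using c unfolding proj_rel_def by (metis inverse_nonzero_iff_nonzero)
  qed
  show "transp (proj_rel :: 'a \<Rightarrow> 'a \<Rightarrow> bool)"
  proof (rule transpI)
    fix u v w :: 'a assume "proj_rel u v" "proj_rel v w"
    then obtain c d where "u \<noteq> 0" "w \<noteq> 0" "c \<noteq> 0" "d \<noteq> 0" "v = c *\<^sub>R u" "w = d *\<^sub>R v"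
      by (auto simp: proj_rel_def)
    then show "proj_rel u w" unfolding proj_rel_def
      by (metis mult_eq_0_iff scaleR_scaleR)
  qed
qed

text \<open>For \<open>v \<noteq> 0\<close>, \<open>line v\<close> is the point \<open>\<real>v\<close> of \<open>P(V)\<close>. The value \<open>line 0\<close> is meaningless.\<close>

quotient_type (overloaded) 'a proj_space = "'a::euclidean_space" / partial: proj_rel
  morphisms rep_line line
  by (rule part_equivp_proj_rel)

lemma line_eq_iff:
  assumes "v \<noteq> 0" "w \<noteq> 0"
  shows "line v = line w \<longleftrightarrow> (\<exists>c. c \<noteq> 0 \<and> w = c *\<^sub>R v)"
proof -
  have "proj_rel v v" "proj_rel w w" using assms unfolding proj_rel_def
    by (metis one_neq_zero scaleR_one)+
  then show ?thesis
    using Quotient3_rel[OF Quotient3_proj_space, of v w] assms by (auto simp: proj_rel_def)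
qed

lemma line_exhaust: obtains v where "v \<noteq> 0" "x = line v"
proof -
  have "proj_rel (rep_line x) (rep_line x)" "line (rep_line x) = x"
    using Quotient3_proj_space Quotient3_abs_rep Quotient3_rep_reflp by metis+
  then show ?thesis using that[of "rep_line x"] by (auto simp: proj_rel_def)
qed

lemma line_scaleR: "v \<noteq> 0 \<Longrightarrow> c \<noteq> 0 \<Longrightarrow> line (c *\<^sub>R v) = line v"
  by (subst eq_commute, subst line_eq_iff) auto

text \<open>The topology is the quotient topology of \<open>V - {0}\<close>.\<close>

instantiation proj_space :: (euclidean_space) topological_space
begin

definition open_proj_space :: "'a proj_space set \<Rightarrow> bool"
  where "open_proj_space U \<longleftrightarrow> open {v. v \<noteq> 0 \<and> line v \<in> U}"

instance
proof
  have "{v::'a. v \<noteq> 0 \<and> line v \<in> UNIV} = - {0}" by auto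
  then show "open (UNIV :: 'a proj_space set)" unfolding open_proj_space_def
    by (simp add: open_Compl)
next
  fix S T :: "'a proj_space set" assume "open S" "open T"
  moreover have "{v. v \<noteq> 0 \<and> line v \<in> S \<inter> T}
      = {v. v \<noteq> 0 \<and> line v \<in> S} \<inter> {v. v \<noteq> 0 \<and> line v \<in> T}" by auto
  ultimately show "open (S \<inter> T)" unfolding open_proj_space_def by (simp only: open_Int)
next
  fix K :: "'a proj_space set set" assume "\<forall>S\<in>K. open S"
  moreover have "{v. v \<noteq> 0 \<and> line v \<in> \<Union>K} = (\<Union>S\<in>K. {v. v \<noteq> 0 \<and> line v \<in> S})" by auto
  ultimately show "open (\<Union>K)" unfolding open_proj_space_def by (simp only: open_UN)
qed

end

section \<open>The group \<open>PGL(V)\<close> and its action on \<open>P(V)\<close>\<close>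

definition pgl_rel :: "('a::euclidean_space \<Rightarrow>\<^sub>L 'a) \<Rightarrow> ('a \<Rightarrow>\<^sub>L 'a) \<Rightarrow> bool"
  where "pgl_rel A B \<longleftrightarrow> bij (blinfun_apply A) \<and> bij (blinfun_apply B) \<and> (\<exists>c. c \<noteq> 0 \<and> B = c *\<^sub>R A)"

lemma pgl_rel_refl: "bij (blinfun_apply A) \<Longrightarrow> pgl_rel A A"
  unfolding pgl_rel_def by (metis one_neq_zero scaleR_one)

lemma bij_id_blinfun: "bij (blinfun_apply id_blinfun)"
  by (simp add: bij_def inj_def surj_def)

lemma part_equivp_pgl_rel:
  "part_equivp (pgl_rel :: ('a::euclidean_space \<Rightarrow>\<^sub>L 'a) \<Rightarrow> ('a \<Rightarrow>\<^sub>L 'a) \<Rightarrow> bool)"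
proof (rule part_equivpI)
  show "\<exists>x::'a \<Rightarrow>\<^sub>L 'a. pgl_rel x x"
    using pgl_rel_refl[OF bij_id_blinfun] by blast
  show "symp (pgl_rel :: ('a \<Rightarrow>\<^sub>L 'a) \<Rightarrow> ('a \<Rightarrow>\<^sub>L 'a) \<Rightarrow> bool)"
  proof (rule sympI)
    fix A B :: "'a \<Rightarrow>\<^sub>L 'a" assume "pgl_rel A B"
    then obtain c where c: "bij (blinfun_apply A)" "bij (blinfun_apply B)" "c \<noteq> 0" "B = c *\<^sub>R A"
      by (auto simp: pgl_rel_def)
    then have "A = inverse c *\<^sub>R B" by simp
    then show "pgl_rel B A" using c unfolding pgl_rel_def by (metis inverse_nonzero_iff_nonzero)
  qed
  show "transp (pgl_rel :: ('a \<Rightarrow>\<^sub>L 'a) \<Rightarrow> ('a \<Rightarrow>\<^sub>L 'a) \<Rightarrow> bool)"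
  proof (rule transpI)
    fix A B C :: "'a \<Rightarrow>\<^sub>L 'a" assume "pgl_rel A B" "pgl_rel B C"
    then show "pgl_rel A C" unfolding pgl_rel_def
      by (metis mult_eq_0_iff scaleR_scaleR)
  qed
qed

text \<open>For invertible \<open>A\<close>, \<open>pgl_class A\<close> is the class of \<open>A\<close> in \<open>PGL(V) = GL(V)/\<real>\<^sup>*\<close>; it is
  meaningless for other \<open>A\<close>.\<close>

quotient_type (overloaded) 'a pgl = "'a::euclidean_space \<Rightarrow>\<^sub>L 'a" / partial: pgl_rel
  morphisms rep_pgl pgl_class
  by (rule part_equivp_pgl_rel)

lemma pgl_class_exhaust: obtains A where "bij (blinfun_apply A)" "g = pgl_class A"
proof -
  have "pgl_rel (rep_pgl g) (rep_pgl g)" "pgl_class (rep_pgl g) = g"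
    using Quotient3_pgl Quotient3_abs_rep Quotient3_rep_reflp by metis+
  then show ?thesis using that[of "rep_pgl g"] by (auto simp: pgl_rel_def)
qed

lemma linear_blinfun_apply: "linear (blinfun_apply A)"
  using blinfun.bounded_linear_right bounded_linear.linear by blast

lemma blinfun_inverse:
  fixes A :: "'a::euclidean_space \<Rightarrow>\<^sub>L 'a"
  assumes "bij (blinfun_apply A)"
  obtains B where "bij (blinfun_apply B)" "B o\<^sub>L A = id_blinfun"
proof -
  have "linear (inv_into UNIV (blinfun_apply A))"
    using assms bij_is_inj inj_linear_imp_inv_linear linear_blinfun_apply by blast
  then have bl: "bounded_linear (inv_into UNIV (blinfun_apply A))" by (rule linear_conv_bounded_linear[THEN iffD1])
  show ?thesis
  proof
    show "bij (blinfun_apply (Blinfun (inv_into UNIV (blinfun_apply A))))"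
      using assms by (simp add: bounded_linear_Blinfun_apply[OF bl] bij_imp_bij_inv)
    show "Blinfun (inv_into UNIV (blinfun_apply A)) o\<^sub>L A = id_blinfun"
      by (rule blinfun_eqI) (simp add: bounded_linear_Blinfun_apply[OF bl] assms bij_is_inj)
  qed
qed

text \<open>The topology is the quotient topology of \<open>GL(V)\<close>, which is open in \<open>End(V)\<close>.\<close>

lemma open_GL: "open {A :: 'a::euclidean_space \<Rightarrow>\<^sub>L 'a. bij (blinfun_apply A)}"
unfolding open_contains_ball
proof
  fix A :: "'a \<Rightarrow>\<^sub>L 'a" assume "A \<in> {A. bij (blinfun_apply A)}"
  then obtain B where B: "B o\<^sub>L A = id_blinfun" using blinfun_inverse by (metis mem_Collect_eq)
  define e where "e = inverse (norm B + 1)"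
  have e: "e > 0" by (simp add: e_def add_nonneg_pos)
  have "bij (blinfun_apply C)" if "dist A C < e" for C
  proof -
    have "x = 0" if "blinfun_apply C x = 0" for x
    proof (rule ccontr)
      assume "x \<noteq> 0"
      have "x = blinfun_apply (B o\<^sub>L A) x" by (simp add: B)
      also have "\<dots> = blinfun_apply B (blinfun_apply (A - C) x)"
        using that by (simp add: blinfun.diff_left)
      finally have "norm x = norm (blinfun_apply B (blinfun_apply (A - C) x))" by simp
      also have "\<dots> \<le> norm B * (norm (A - C) * norm x)"
        by (meson norm_blinfun order_trans mult_left_mono norm_ge_zero)
      also have "\<dots> \<le> norm B * (e * norm x)"
        using \<open>dist A C < e\<close> by (intro mult_left_mono mult_right_mono) (auto simp: dist_norm)
      also have "\<dots> < (norm B + 1) * (e * norm x)"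
        using e \<open>x \<noteq> 0\<close> by (simp add: algebra_simps)
      also have "\<dots> = norm x"
        using norm_ge_zero[of B] by (simp add: e_def field_simps add_nonneg_eq_0_iff)
      finally show False by simp
    qed
    then have "inj (blinfun_apply C)"
      by (simp add: linear_injective_0 linear_blinfun_apply)
    then show ?thesis
      by (simp add: bij_def linear_injective_imp_surjective linear_blinfun_apply)
  qed
  then show "\<exists>e>0. ball A e \<subseteq> {A. bij (blinfun_apply A)}"
    using e by auto
qed

instantiation pgl :: (euclidean_space) topological_space
begin

definition open_pgl :: "'a pgl set \<Rightarrow> bool"
  where "open_pgl U \<longleftrightarrow> open {A. bij (blinfun_apply A) \<and> pgl_class A \<in> U}"

instance
proof
  show "open (UNIV :: 'a pgl set)" unfolding open_pgl_def using open_GL by simp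
next
  fix S T :: "'a pgl set" assume "open S" "open T"
  moreover have "{A. bij (blinfun_apply A) \<and> pgl_class A \<in> S \<inter> T}
      = {A. bij (blinfun_apply A) \<and> pgl_class A \<in> S} \<inter> {A. bij (blinfun_apply A) \<and> pgl_class A \<in> T}"
    by auto
  ultimately show "open (S \<inter> T)" unfolding open_pgl_def by (simp only: open_Int)
next
  fix K :: "'a pgl set set" assume "\<forall>S\<in>K. open S"
  moreover have "{A. bij (blinfun_apply A) \<and> pgl_class A \<in> \<Union>K}
      = (\<Union>S\<in>K. {A. bij (blinfun_apply A) \<and> pgl_class A \<in> S})" by auto
  ultimately show "open (\<Union>K)" unfolding open_pgl_def by (simp only: open_UN)
qed

end

lemma bij_blinfun_compose:
  "bij (blinfun_apply A) \<Longrightarrow> bij (blinfun_apply B) \<Longrightarrow> bij (blinfun_apply (A o\<^sub>L B))"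
  using bij_comp[of "blinfun_apply B" "blinfun_apply A"]
  by (simp add: comp_def blinfun_apply_blinfun_compose[abs_def] blinfun_compose.rep_eq)

lift_definition pgl_one :: "'a::euclidean_space pgl" is id_blinfun
  by (rule pgl_rel_refl[OF bij_id_blinfun])

lift_definition pgl_mult :: "'a::euclidean_space pgl \<Rightarrow> 'a pgl \<Rightarrow> 'a pgl" is "(o\<^sub>L)"
proof -
  fix A A' B B' :: "'a \<Rightarrow>\<^sub>L 'a" assume "pgl_rel A A'" "pgl_rel B B'"
  then obtain c d where "bij (blinfun_apply A)" "bij (blinfun_apply A')" "bij (blinfun_apply B)"
      "bij (blinfun_apply B')" and cd: "c \<noteq> 0" "d \<noteq> 0" "A' = c *\<^sub>R A" "B' = d *\<^sub>R B"
    by (auto simp: pgl_rel_def)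
  moreover have "A' o\<^sub>L B' = (c * d) *\<^sub>R (A o\<^sub>L B)"
    unfolding cd by (rule blinfun_eqI) (simp add: blinfun.scaleR_left blinfun.scaleR_right)
  ultimately show "pgl_rel (A o\<^sub>L B) (A' o\<^sub>L B')"
    unfolding pgl_rel_def using bij_blinfun_compose by (metis mult_eq_0_iff)
qed

definition PGL :: "'a::euclidean_space pgl monoid"
  where "PGL = \<lparr>carrier = UNIV, mult = pgl_mult, one = pgl_one\<rparr>"

lemma group_PGL: "group (PGL :: 'a::euclidean_space pgl monoid)"
proof (rule groupI)
  fix x y z :: "'a pgl"
  show "x \<otimes>\<^bsub>PGL\<^esub> y \<in> carrier PGL" by (simp add: PGL_def)
  have "pgl_mult (pgl_mult x y) z = pgl_mult x (pgl_mult y z)"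
  proof transfer
    fix A B C :: "'a \<Rightarrow>\<^sub>L 'a"
    assume "pgl_rel A A" "pgl_rel B B" "pgl_rel C C"
    then have "bij (blinfun_apply ((A o\<^sub>L B) o\<^sub>L C))"
      by (auto simp: pgl_rel_def intro!: bij_blinfun_compose)
    moreover have "(A o\<^sub>L B) o\<^sub>L C = A o\<^sub>L (B o\<^sub>L C)" by (rule blinfun_eqI) simp
    ultimately show "pgl_rel ((A o\<^sub>L B) o\<^sub>L C) (A o\<^sub>L (B o\<^sub>L C))"
      using pgl_rel_refl by metis
  qed
  then show "x \<otimes>\<^bsub>PGL\<^esub> y \<otimes>\<^bsub>PGL\<^esub> z = x \<otimes>\<^bsub>PGL\<^esub> (y \<otimes>\<^bsub>PGL\<^esub> z)" by (simp add: PGL_def)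
  have "id_blinfun o\<^sub>L A = A" for A :: "'a \<Rightarrow>\<^sub>L 'a" by (rule blinfun_eqI) simp
  then have "pgl_mult pgl_one x = x" by transfer simp
  then show "\<one>\<^bsub>PGL\<^esub> \<otimes>\<^bsub>PGL\<^esub> x = x" by (simp add: PGL_def)
  have "\<exists>y. pgl_mult y x = pgl_one"
  proof transfer
    fix A :: "'a \<Rightarrow>\<^sub>L 'a" assume "pgl_rel A A"
    then obtain B where "bij (blinfun_apply B)" "B o\<^sub>L A = id_blinfun"
      using blinfun_inverse by (metis pgl_rel_def)
    then show "\<exists>B\<in>{B. pgl_rel B B}. pgl_rel (B o\<^sub>L A) id_blinfun"
      using pgl_rel_refl bij_id_blinfun by (metis mem_Collect_eq)
  qed
  then show "\<exists>y\<in>carrier PGL. y \<otimes>\<^bsub>PGL\<^esub> x = \<one>\<^bsub>PGL\<^esub>" by (simp add: PGL_def)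
qed (simp add: PGL_def)

lift_definition pgl_act :: "'a::euclidean_space pgl \<Rightarrow> 'a proj_space \<Rightarrow> 'a proj_space" is blinfun_apply
proof -
  fix A B :: "'a \<Rightarrow>\<^sub>L 'a" and v w :: 'a
  assume "pgl_rel A B" "proj_rel v w"
  then obtain c d where "bij (blinfun_apply A)" and cd: "c \<noteq> 0" "d \<noteq> 0" "B = c *\<^sub>R A" "w = d *\<^sub>R v" "v \<noteq> 0"
    by (auto simp: pgl_rel_def proj_rel_def)
  moreover from this have "blinfun_apply A v \<noteq> 0"
    by (metis bij_is_inj blinfun.zero_right injD)
  moreover have "blinfun_apply B w = (c * d) *\<^sub>R blinfun_apply A v"
    unfolding cd by (simp add: blinfun.scaleR_left blinfun.scaleR_right)
  ultimately show "proj_rel (blinfun_apply A v) (blinfun_apply B w)"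
    unfolding proj_rel_def by (metis mult_eq_0_iff scaleR_eq_0_iff)
qed

lemma pgl_act_line:
  "bij (blinfun_apply A) \<Longrightarrow> v \<noteq> 0 \<Longrightarrow> pgl_act (pgl_class A) (line v) = line (blinfun_apply A v)"
  by (rule pgl_act.abs_eq) (auto intro: pgl_rel_refl exI[of _ 1] simp: proj_rel_def)

section \<open>Convexity in \<open>P(V)\<close>\<close>

text \<open>A nonzero linear form \<open>f\<close> gives the affine chart \<open>P(V) - P(ker f)\<close>, identified with the affine
  hyperplane \<open>f = 1\<close> of \<open>V\<close>; \<open>chart_image f S\<close> is the part of \<open>S\<close> seen in that chart.\<close>

definition affine_chart :: "('a::euclidean_space \<Rightarrow> real) \<Rightarrow> 'a proj_space set"
  where "affine_chart f = {line v |v. f v \<noteq> 0}"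

definition chart_image :: "('a::euclidean_space \<Rightarrow> real) \<Rightarrow> 'a proj_space set \<Rightarrow> 'a set"
  where "chart_image f S = {v. f v = 1 \<and> line v \<in> S}"

definition properly_convex :: "'a::euclidean_space proj_space set \<Rightarrow> bool"
  where "properly_convex S \<longleftrightarrow>
    (\<exists>f. linear f \<and> f \<noteq> (\<lambda>_. 0) \<and> S \<subseteq> affine_chart f \<and>
         convex (chart_image f S) \<and> bounded (chart_image f S))"

text \<open>Two distinct points of \<open>P(V)\<close> are the endpoints of exactly two projective segments; a vector
  segment through \<open>0\<close> does not project to a projective segment. For \<open>\<xi> = \<eta>\<close> this gives \<open>{\<xi>}\<close>.\<close>

definition is_proj_segment ::
    "'a::euclidean_space proj_space \<Rightarrow> 'a proj_space \<Rightarrow> 'a proj_space set \<Rightarrow> bool"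
  where "is_proj_segment \<xi> \<eta> S \<longleftrightarrow>
    (\<exists>v w. 0 \<notin> closed_segment v w \<and> \<xi> = line v \<and> \<eta> = line w \<and> S = line ` closed_segment v w)"

text \<open>\<open>[\<xi>,\<eta>]\<close>; it is well defined for \<open>\<xi>, \<eta> \<in> closure \<Omega>\<close> when \<open>\<Omega>\<close> is properly convex, see
  \<open>proj_segment_unique\<close> below.\<close>

definition proj_segment ::
    "'a::euclidean_space proj_space set \<Rightarrow> 'a proj_space \<Rightarrow> 'a proj_space \<Rightarrow> 'a proj_space set"
  where "proj_segment \<Omega> \<xi> \<eta> = (THE S. is_proj_segment \<xi> \<eta> S \<and> S \<subseteq> closure \<Omega>)"

lemma line_scaleR_inverse: "v \<noteq> 0 \<Longrightarrow> f v \<noteq> 0 \<Longrightarrow> line (v /\<^sub>R f v) = line v"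
  by (simp add: line_scaleR)

lemma mem_affine_chart_iff:
  assumes "linear f" "v \<noteq> 0"
  shows "line v \<in> affine_chart f \<longleftrightarrow> f v \<noteq> 0"
proof
  assume "line v \<in> affine_chart f"
  then obtain w where w: "f w \<noteq> 0" "line v = line w" by (auto simp: affine_chart_def)
  then have "w \<noteq> 0" using assms(1) linear_0 by metis
  then obtain c where "w = c *\<^sub>R v" using w assms line_eq_iff by metis
  then show "f v \<noteq> 0" using w assms(1) by (auto simp: linear_cmul)
qed (auto simp: affine_chart_def)

lemma closure_subset_affine_chart:
  fixes f :: "'a::euclidean_space \<Rightarrow> real"
  assumes f: "linear f" and S: "S \<subseteq> affine_chart f" "bounded (chart_image f S)"
  shows "closure S \<subseteq> affine_chart f"
proof -
  obtain B where B: "\<And>v. v \<in> chart_image f S \<Longrightarrow> norm v \<le> B"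
    using S(2) by (auto simp: bounded_iff)
  define T where "T = {line v |v. v \<noteq> 0 \<and> norm v \<le> B * \<bar>f v\<bar>}"
  have T: "line v \<in> T \<longleftrightarrow> norm v \<le> B * \<bar>f v\<bar>" if v0: "v \<noteq> 0" for v
  proof
    assume "line v \<in> T"
    then obtain w where w: "w \<noteq> 0" "norm w \<le> B * \<bar>f w\<bar>" "line v = line w" by (auto simp: T_def)
    then obtain c where "c \<noteq> 0" "w = c *\<^sub>R v" using v0 line_eq_iff by metis
    then have "\<bar>c\<bar> * norm v \<le> \<bar>c\<bar> * (B * \<bar>f v\<bar>)" using w(2) f
      by (simp add: linear_cmul abs_mult mult.left_commute)
    then show "norm v \<le> B * \<bar>f v\<bar>" using \<open>c \<noteq> 0\<close> by simp
  qed (use v0 in \<open>auto simp: T_def\<close>)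
  have "continuous_on UNIV f" using f by (simp add: linear_continuous_on linear_conv_bounded_linear)
  then have "open {v. B * \<bar>f v\<bar> < norm v}"
    by (rule open_Collect_less[OF continuous_on_mult_left[OF continuous_on_rabs]
          continuous_on_norm[OF continuous_on_id]])
  then have "open ({v. B * \<bar>f v\<bar> < norm v} \<inter> - {0})" by (rule open_Int) (simp add: open_Compl)
  moreover have "{v. v \<noteq> 0 \<and> line v \<in> - T} = {v. B * \<bar>f v\<bar> < norm v} \<inter> - {0}" using T by auto
  ultimately have "closed T" by (simp add: closed_def open_proj_space_def)
  moreover have "S \<subseteq> T"
  proof
    fix x assume "x \<in> S"
    obtain v where v: "v \<noteq> 0" "x = line v" by (rule line_exhaust)
    then have fv: "f v \<noteq> 0" using \<open>x \<in> S\<close> S(1) mem_affine_chart_iff[OF f] by blast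
    have "v /\<^sub>R f v \<in> chart_image f S"
      using \<open>x \<in> S\<close> f v fv by (simp add: chart_image_def linear_cmul line_scaleR_inverse)
    then have "norm (v /\<^sub>R f v) \<le> B" by (rule B)
    then have "norm v / \<bar>f v\<bar> \<le> B" by (simp add: divide_inverse mult.commute)
    then have "norm v \<le> B * \<bar>f v\<bar>" using fv by (simp add: pos_divide_le_eq)
    then show "x \<in> T" using v T by blast
  qed
  ultimately have "closure S \<subseteq> T" by (rule closure_minimal[rotated])
  also have "T \<subseteq> affine_chart f" by (auto simp: T_def affine_chart_def)
  finally show ?thesis .
qed

lemma chart_image_closure:
  fixes f :: "'a::euclidean_space \<Rightarrow> real"
  assumes f: "linear f"
  shows "chart_image f (closure S) = closure (chart_image f S)"
proof -
  have cont: "continuous_on UNIV f" using f by (simp add: linear_continuous_on linear_conv_bounded_linear)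
  have f0: "v \<noteq> 0" if "f v \<noteq> 0" for v using that f linear_0 by metis
  show ?thesis
  proof
    show "closure (chart_image f S) \<subseteq> chart_image f (closure S)"
    proof
      fix v assume v: "v \<in> closure (chart_image f S)"
      have "closed {v. f v = 1}" by (rule closed_Collect_eq[OF cont continuous_on_const])
      then have "closure (chart_image f S) \<subseteq> {v. f v = 1}"
        by (intro closure_minimal) (auto simp: chart_image_def)
      then have fv: "f v = 1" using v by auto
      moreover have "line v \<in> closure S"
      proof (rule ccontr)
        assume "line v \<notin> closure S"
        then have "v \<in> {v. v \<noteq> 0 \<and> line v \<in> - closure S}" using fv f0 by simp
        moreover have "open {v::'a. v \<noteq> 0 \<and> line v \<in> - closure S}"
          by (metis open_proj_space_def open_Compl closed_closure)
        ultimately obtain u where "u \<in> chart_image f S" "line u \<in> - closure S"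
          using v open_Int_closure_eq_empty[of "{v. v \<noteq> 0 \<and> line v \<in> - closure S}" "chart_image f S"]
          by blast
        then show False using closure_subset by (auto simp: chart_image_def)
      qed
      ultimately show "v \<in> chart_image f (closure S)" by (simp add: chart_image_def)
    qed
    show "chart_image f (closure S) \<subseteq> closure (chart_image f S)"
    proof
      fix v assume "v \<in> chart_image f (closure S)"
      then have v: "f v = 1" "line v \<in> closure S" by (auto simp: chart_image_def)
      show "v \<in> closure (chart_image f S)"
        unfolding closure_iff_nhds_not_empty
      proof safe
        fix A V assume V: "V \<subseteq> A" "open V" "v \<in> V" "chart_image f S \<inter> A = {}"
        have nz: "open {u. f u \<noteq> 0}" by (rule open_Collect_neq[OF cont continuous_on_const])
        have "continuous_on {u. f u \<noteq> 0} (\<lambda>u. u /\<^sub>R f u)"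
          by (rule continuous_on_scaleR[OF continuous_on_inverse[OF continuous_on_subset[OF cont subset_UNIV]]
                continuous_on_id]) simp
        then have op: "open ({u. f u \<noteq> 0} \<inter> (\<lambda>u. u /\<^sub>R f u) -` V)"
          by (rule continuous_open_preimage[OF _ nz V(2)])
        define U where "U = line ` ({u. f u \<noteq> 0} \<inter> (\<lambda>u. u /\<^sub>R f u) -` V)"
        have "{u. u \<noteq> 0 \<and> line u \<in> U} = {u. f u \<noteq> 0} \<inter> (\<lambda>u. u /\<^sub>R f u) -` V"
        proof (intro subset_antisym subsetI)
          fix u assume "u \<in> {u. u \<noteq> 0 \<and> line u \<in> U}"
          then obtain w where w: "u \<noteq> 0" "f w \<noteq> 0" "inverse (f w) *\<^sub>R w \<in> V" "line u = line w"
            by (auto simp: U_def)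
          then obtain c where c: "c \<noteq> 0" "w = c *\<^sub>R u" using f0 line_eq_iff by metis
          moreover have "inverse (f w) * c = inverse (f u)"
            using c f by (simp add: linear_cmul)
          ultimately show "u \<in> {u. f u \<noteq> 0} \<inter> (\<lambda>u. u /\<^sub>R f u) -` V"  using w f
            by (metis (mono_tags, lifting) IntI linear_cmul mem_Collect_eq mult_eq_0_iff
                real_scaleR_def scaleR_scaleR vimageI)
        qed (use f0 in \<open>auto simp: U_def\<close>)
        then have "open U" using op by (simp add: open_proj_space_def)
        moreover have "line v \<in> U" using v V unfolding U_def by (intro imageI) auto
        ultimately obtain y where "y \<in> S" "y \<in> U"
          using v(2) open_Int_closure_eq_empty[of U S] by auto
        then obtain u where u: "f u \<noteq> 0" "u /\<^sub>R f u \<in> V" "line u \<in> S" by (auto simp: U_def)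
        then have "u /\<^sub>R f u \<in> chart_image f S"
          using f f0[OF u(1)] by (simp add: chart_image_def linear_cmul line_scaleR)
        then show False using u V by auto
      qed
    qed
  qed
qed

lemma line_image_closed_segment_subset:
  fixes v w :: "'a::euclidean_space"
  assumes pos: "\<alpha> / \<beta> > 0" and "0 \<notin> closed_segment v w"
  shows "line ` closed_segment v w \<subseteq> line ` closed_segment (\<alpha> *\<^sub>R v) (\<beta> *\<^sub>R w)"
proof
  fix x assume "x \<in> line ` closed_segment v w"
  then obtain t where t: "0 \<le> t" "t \<le> 1" and x: "x = line ((1 - t) *\<^sub>R v + t *\<^sub>R w)"
    by (auto simp: closed_segment_def)
  define u where "u = (1 - t) *\<^sub>R v + t *\<^sub>R w"
  have "u \<in> closed_segment v w" using t by (auto simp: u_def closed_segment_def)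
  then have u0: "u \<noteq> 0" using assms(2) by metis
  have nz: "\<alpha> \<noteq> 0" "\<beta> \<noteq> 0" using pos by auto
  define k where "k = (1 - t) + t * (\<alpha> / \<beta>)"
  have k: "k > 0"
  proof (cases "t = 0")
    case False
    then have "t * (\<alpha> / \<beta>) > 0" using t pos by (intro mult_pos_pos) auto
    then show ?thesis using t by (simp add: k_def)
  qed (simp add: k_def)
  define s where "s = t * (\<alpha> / \<beta>) / k"
  have s1: "1 - s = (1 - t) / k"
  proof -
    have "1 - s = (k - t * (\<alpha> / \<beta>)) / k" using k by (simp add: s_def diff_divide_distrib)
    then show ?thesis by (simp add: k_def)
  qed
  have s: "0 \<le> s" "s \<le> 1"
  proof -
    show "0 \<le> s" unfolding s_def by (rule divide_nonneg_pos[OF mult_nonneg_nonneg[OF t(1) less_imp_le[OF pos]] k])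
    have "0 \<le> 1 - s" using t k by (simp add: s1)
    then show "s \<le> 1" by simp
  qed
  have "(1 - s) *\<^sub>R (\<alpha> *\<^sub>R v) + s *\<^sub>R (\<beta> *\<^sub>R w) = (\<alpha> / k) *\<^sub>R u"
    unfolding s1 using nz by (simp add: u_def s_def scaleR_add_right mult.commute)
  then have "(\<alpha> / k) *\<^sub>R u \<in> closed_segment (\<alpha> *\<^sub>R v) (\<beta> *\<^sub>R w)"
    using s unfolding closed_segment_def by (metis (mono_tags, lifting) mem_Collect_eq)
  moreover have "line ((\<alpha> / k) *\<^sub>R u) = x"
    using u0 nz k by (simp add: x u_def[symmetric] line_scaleR)
  ultimately show "x \<in> line ` closed_segment (\<alpha> *\<^sub>R v) (\<beta> *\<^sub>R w)" by blast
qed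

lemma proj_segment_unique:
  fixes \<Omega> :: "'a::euclidean_space proj_space set"
  assumes "properly_convex \<Omega>" "\<xi> \<in> closure \<Omega>" "\<eta> \<in> closure \<Omega>"
  shows "\<exists>!S. is_proj_segment \<xi> \<eta> S \<and> S \<subseteq> closure \<Omega>"
proof -
  obtain f where f: "linear f" and sub: "\<Omega> \<subseteq> affine_chart f"
    and cv: "convex (chart_image f \<Omega>)" and bd: "bounded (chart_image f \<Omega>)"
    using assms(1) by (auto simp: properly_convex_def)
  have f0: "v \<noteq> 0" if "f v \<noteq> 0" for v using that f linear_0 by metis
  have chart: "f v \<noteq> 0" if "v \<noteq> 0" "line v \<in> closure \<Omega>" for v
    using that closure_subset_affine_chart[OF f sub bd] mem_affine_chart_iff[OF f] by blast
  have rep: "\<exists>v. f v = 1 \<and> x = line v" if "x \<in> closure \<Omega>" for x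
  proof -
    obtain v where v: "v \<noteq> 0" "x = line v" by (rule line_exhaust)
    then have "f v \<noteq> 0" using chart that by blast
    then show ?thesis using v f
      by (intro exI[of _ "v /\<^sub>R f v"]) (simp add: linear_cmul line_scaleR_inverse)
  qed
  obtain a b where a: "f a = 1" "\<xi> = line a" and b: "f b = 1" "\<eta> = line b"
    using rep assms(2,3) by metis
  have seg1: "f u = 1" if "u \<in> closed_segment a b" for u
    using that f a b by (auto simp: closed_segment_def linear_add linear_cmul)
  have ab0: "0 \<notin> closed_segment a b" using seg1 linear_0[OF f] by (metis zero_neq_one)
  show ?thesis
  proof (rule ex1I[of _ "line ` closed_segment a b"], intro conjI)
    show "is_proj_segment \<xi> \<eta> (line ` closed_segment a b)"
      using a b ab0 by (auto simp: is_proj_segment_def)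
    have "convex (chart_image f (closure \<Omega>))"
      unfolding chart_image_closure[OF f] using cv by (rule convex_closure)
    moreover have "a \<in> chart_image f (closure \<Omega>)" "b \<in> chart_image f (closure \<Omega>)"
      using a b assms(2,3) by (auto simp: chart_image_def)
    ultimately have "closed_segment a b \<subseteq> chart_image f (closure \<Omega>)"
      by (simp add: closed_segment_subset)
    then show "line ` closed_segment a b \<subseteq> closure \<Omega>" by (auto simp: chart_image_def)
  next
    fix S assume "is_proj_segment \<xi> \<eta> S \<and> S \<subseteq> closure \<Omega>"
    then obtain v w where vw: "0 \<notin> closed_segment v w" "\<xi> = line v" "\<eta> = line w"
      and S: "S = line ` closed_segment v w" "line ` closed_segment v w \<subseteq> closure \<Omega>"
      by (auto simp: is_proj_segment_def)
    have nz: "f u \<noteq> 0" if "u \<in> closed_segment v w" for u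
      using that vw S chart by (metis image_subset_iff)
    have v0: "v \<noteq> 0" "w \<noteq> 0" "f v \<noteq> 0" "f w \<noteq> 0" using nz f0 by auto
    have pos: "f v * f w > 0"
    proof (rule ccontr)
      assume "\<not> f v * f w > 0"
      then have neg: "f v * f w < 0" using v0 by (simp add: not_less order_less_le)
      define t where "t = f v / (f v - f w)"
      have d: "f v - f w \<noteq> 0" using neg not_square_less_zero[of "f w"] by auto
      have "0 \<le> t" "t \<le> 1" using neg d by (auto simp: t_def divide_simps mult_less_0_iff)
      then have "(1 - t) *\<^sub>R v + t *\<^sub>R w \<in> closed_segment v w" by (auto simp: closed_segment_def)
      then have "f ((1 - t) *\<^sub>R v + t *\<^sub>R w) \<noteq> 0" by (rule nz)
      moreover have "f ((1 - t) *\<^sub>R v + t *\<^sub>R w) = 0"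
        using f d by (simp add: linear_add linear_cmul t_def) (simp add: field_simps)
      ultimately show False by simp
    qed
    have norm: "u /\<^sub>R f u = c" if uc: "u \<noteq> 0" "f u \<noteq> 0" "f c = 1" "line u = line c" for u c
    proof -
      obtain k where "k \<noteq> 0" "c = k *\<^sub>R u" using uc f0 line_eq_iff by (metis one_neq_zero)
      then show ?thesis using uc f by (simp add: linear_cmul field_simps)
    qed
    have ab: "v /\<^sub>R f v = a" "w /\<^sub>R f w = b" using norm v0 a b vw by metis+
    have vw_ab: "v = f v *\<^sub>R a" "w = f w *\<^sub>R b" using v0 by (auto simp: ab[symmetric])
    have "S \<subseteq> line ` closed_segment a b"
      using line_image_closed_segment_subset[of "inverse (f v)" "inverse (f w)" v w] pos vw(1)
      by (simp add: S(1) ab zero_less_divide_iff zero_less_mult_iff)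
    moreover have "line ` closed_segment a b \<subseteq> S"
      using line_image_closed_segment_subset[of "f v" "f w" a b] pos ab0
      by (simp add: S(1) vw_ab[symmetric] zero_less_divide_iff zero_less_mult_iff)
    ultimately show "S = line ` closed_segment a b" by blast
  qed
qed

section \<open>Divisible and rank-one convex sets\<close>

definition Aut :: "'a::euclidean_space proj_space set \<Rightarrow> 'a pgl set"
  where "Aut \<Omega> = {g. pgl_act g ` \<Omega> = \<Omega>}"

definition acts_cocompactly :: "'a::euclidean_space pgl set \<Rightarrow> 'a proj_space set \<Rightarrow> bool"
  where "acts_cocompactly \<Gamma> \<Omega> \<longleftrightarrow> (\<exists>K. compact K \<and> K \<subseteq> \<Omega> \<and> \<Omega> = (\<Union>g\<in>\<Gamma>. pgl_act g ` K))"

definition divisible :: "'a::euclidean_space proj_space set \<Rightarrow> bool"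
  where "divisible \<Omega> \<longleftrightarrow> \<Omega> \<noteq> {} \<and> open \<Omega> \<and> properly_convex \<Omega> \<and>
    (\<exists>\<Gamma>. subgroup \<Gamma> PGL \<and> discrete \<Gamma> \<and> \<Gamma> \<subseteq> Aut \<Omega> \<and> acts_cocompactly \<Gamma> \<Omega>)"

definition strongly_extremal :: "'a::euclidean_space proj_space set \<Rightarrow> 'a proj_space \<Rightarrow> bool"
  where "strongly_extremal \<Omega> \<xi> \<longleftrightarrow> \<xi> \<in> closure \<Omega> - \<Omega> \<and>
    (\<forall>\<eta> \<in> (closure \<Omega> - \<Omega>) - {\<xi>}. proj_segment \<Omega> \<xi> \<eta> \<inter> \<Omega> \<noteq> {})"

definition rank_one_divisible :: "'a::euclidean_space proj_space set \<Rightarrow> bool"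
  where "rank_one_divisible \<Omega> \<longleftrightarrow> divisible \<Omega> \<and> (\<exists>\<xi>. strongly_extremal \<Omega> \<xi>)"

section \<open>Proximal elements and the proximal limit set\<close>

text \<open>Uniformity of the convergence on a neighbourhood is essential: a parabolic element of
  \<open>PGL(\<real>\<^sup>2)\<close> has a fixed point to which every orbit converges, but which is not attracting.\<close>

definition attracting_fixpoint :: "'a::euclidean_space pgl \<Rightarrow> 'a proj_space \<Rightarrow> bool"
  where "attracting_fixpoint g x \<longleftrightarrow> pgl_act g x = x \<and>
    (\<exists>U. open U \<and> x \<in> U \<and>
      (\<forall>W. open W \<and> x \<in> W \<longrightarrow> (\<forall>\<^sub>F n in sequentially. (pgl_act g ^^ n) ` U \<subseteq> W)))"

definition proximal :: "'a::euclidean_space pgl \<Rightarrow> bool"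
  where "proximal g \<longleftrightarrow> (\<exists>x. attracting_fixpoint g x)"

definition prox_limit_set :: "'a::euclidean_space proj_space set \<Rightarrow> 'a proj_space set"
  where "prox_limit_set \<Omega> = closure {x. \<exists>g \<in> Aut \<Omega>. proximal g \<and> attracting_fixpoint g x}"

end

theory Submission
  imports Defs
begin

text \<open>
  Let \<open>C\<close> be the open convex cone over \<open>\<Omega>\<close> in an affine chart \<open>f \<noteq> 0\<close> that bounds \<open>\<Omega>\<close>. Elements of
  \<open>Aut \<Omega>\<close> lift to linear automorphisms of \<open>C\<close>, and the cocompact action provides a compact \<open>K \<subseteq> C\<close>
  such that every vector of \<open>C\<close> is \<open>A k\<close> for an automorphism \<open>A\<close> of \<open>C\<close> and some \<open>k \<in> K\<close>.

  \<^emph>\<open>The limit set lies in the boundary.\<close> If \<open>\<real>e\<close> is attracting for an automorphism \<open>A\<close> with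
  \<open>A e = \<mu> e\<close>, then for each \<open>v\<close> the vectors \<open>A\<^sup>n v / \<mu>\<^sup>n\<close> accumulate at a multiple of \<open>e\<close>. For
  \<open>v \<in> C\<close> this puts \<open>e\<close> or \<open>- e\<close> in the closure of \<open>C\<close>. If \<open>e\<close> were in \<open>C\<close>, two points \<open>e + u\<close>, \<open>e - u\<close>
  outside \<open>C\<close> would be carried to \<open>(1 + a) e\<close> and \<open>(1 - a) e\<close>, again outside \<open>C\<close>, although one of the
  two factors is positive.

  \<^emph>\<open>Radial limits.\<close> For a boundary vector \<open>e\<close> and \<open>c \<in> C\<close> write \<open>e + c / n = A\<^sub>n k\<^sub>n\<close> with \<open>k\<^sub>n \<in> K\<close>. The
  \<open>A\<^sub>n\<close> stay bounded, and a limit \<open>S\<close> of them maps \<open>C\<close> onto the open face of \<open>e\<close> (\<open>radial_limit\<close>).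

  \<^emph>\<open>Extreme points are limits of attracting fixed points.\<close> If \<open>e\<close> spans an extreme ray, \<open>S\<close> has rank
  one with image \<open>\<real>e\<close>, and \<open>S (A\<^sub>s\<^sup>-\<^sup>1 e) \<noteq> 0\<close> for some \<open>s\<close>. So \<open>A\<^sub>n A\<^sub>s\<^sup>-\<^sup>1\<close> converges to a rank one map
  that fixes \<open>\<real>e\<close>, and for large \<open>n\<close> it contracts a neighbourhood of \<open>\<real>e\<close>.

  \<^emph>\<open>Extreme points are dense in the boundary.\<close> This is where a strongly extremal point \<open>\<xi>\<close> enters. If
  the extreme rays miss a neighbourhood of a boundary vector, the radial limit there is a \<^emph>\<open>gapped\<close> map:
  a linear map \<open>T\<close> from the closed cone to itself for which some \<open>c \<in> T C\<close> has a ball around it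
  that contains no image of an extreme vector. If \<open>T e = c\<close> and \<open>S\<close> is a radial limit at \<open>e\<close>, then \<open>T S\<close> is gapped
  with the same ball, since automorphisms permute the extreme rays. Fix a gapped map of least rank,
  and among the gapped maps with the same ball and the same range choose \<open>T\<close> with \<open>T C\<close> minimal.
  After one composition with a radial limit at a boundary vector, \<open>T \<xi>\<close> lies in \<open>T C\<close>
  (\<open>visible_in_open_face\<close>). As \<open>\<xi>\<close> is strongly extremal, a linear form \<open>a\<close> vanishes at \<open>\<xi>\<close> and is
  positive on the rest of the slice of the closed cone over \<open>\<real>(T \<xi>)\<close>. Let \<open>e\<close> minimize \<open>a\<close> on
  the fibre \<open>T v = c\<close>. If the open face of \<open>e\<close> contained a vector \<open>y\<close> with \<open>T y = T \<xi>\<close>, then \<open>e - s y + s \<xi>\<close>,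
  for small \<open>s > 0\<close>, would lie in the same fibre with a smaller value of \<open>a\<close>. So \<open>T \<xi>\<close> is not in the
  image of \<open>C\<close> under \<open>T S\<close>, where \<open>S\<close> is the radial limit at \<open>e\<close>, which contradicts minimality.
\<close>

section \<open>Attracting fixed points of projective maps\<close>

lemma pgl_act_iterate_line:
  assumes A: "bij (blinfun_apply A)" and v: "v \<noteq> 0"
  shows "(blinfun_apply A ^^ n) v \<noteq> 0 \<and>
    (pgl_act (pgl_class A) ^^ n) (line v) = line ((blinfun_apply A ^^ n) v)"
proof (induction n)
  case (Suc n)
  then have "blinfun_apply A ((blinfun_apply A ^^ n) v) \<noteq> 0"
    using A by (metis bij_is_inj blinfun.zero_right injD)
  then show ?case using Suc pgl_act_line[OF A] by simp
qed (use v in simp)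

lemma open_line_preimage:
  fixes U :: "'a::euclidean_space proj_space set"
  shows "open U \<Longrightarrow> open {v. v \<noteq> 0 \<and> line v \<in> U}"
  by (simp add: open_proj_space_def)

lemma open_line_image:
  assumes S: "open S" "0 \<notin> S" and sc: "\<And>v t. v \<in> S \<Longrightarrow> t \<noteq> 0 \<Longrightarrow> t *\<^sub>R v \<in> S"
  shows "open (line ` S)" and "\<And>v. v \<noteq> 0 \<Longrightarrow> line v \<in> line ` S \<longleftrightarrow> v \<in> S"
proof -
  show *: "line v \<in> line ` S \<longleftrightarrow> v \<in> S" if v: "v \<noteq> 0" for v
  proof
    assume "line v \<in> line ` S"
    then obtain w where w: "w \<in> S" "line v = line w" by blast
    then have "w \<noteq> 0" using S(2) by blast
    then obtain c where "c \<noteq> 0" "v = c *\<^sub>R w" using line_eq_iff v w(2) by metis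
    then show "v \<in> S" using sc w(1) by blast
  qed blast
  have "{v. v \<noteq> 0 \<and> line v \<in> line ` S} = S" using * S(2) by blast
  then show "open (line ` S)" using S(1) by (simp add: open_proj_space_def)
qed

text \<open>In the chart \<open>g = 1\<close> the rank one map \<open>P\<close> is constant with value \<open>x\<close>, so a map close to \<open>P\<close> acts
  on a small ball around \<open>x\<close> as a contraction, and Banach's theorem gives a fixed point that
  attracts the whole ball.\<close>

lemma attracting_fixpoint_near_rank_one:
  fixes B :: "nat \<Rightarrow> 'a::euclidean_space \<Rightarrow>\<^sub>L 'a"
  assumes B: "B \<longlonglongrightarrow> P" "\<And>n. bij (blinfun_apply (B n))"
    and P: "\<And>v. blinfun_apply P v = (\<kappa> * (g \<bullet> v)) *\<^sub>R x" and gx: "g \<bullet> x = 1" and k: "\<kappa> \<noteq> 0"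
    and W: "open W" "line x \<in> W"
  shows "\<exists>n. \<exists>y\<in>W. attracting_fixpoint (pgl_class (B n)) y"
proof -
  have x0: "x \<noteq> 0" using gx by auto
  obtain r0 where r0: "0 < r0" "ball x r0 \<subseteq> {v. v \<noteq> 0 \<and> line v \<in> W}"
    using open_line_preimage[OF W(1)] x0 W(2) by (metis (mono_tags, lifting) mem_Collect_eq open_contains_ball)
  define r where "r = r0 / 2"
  have r: "0 < r" "r < r0" using r0 by (auto simp: r_def)
  define N where "N = norm x + r"
  define Q where "Q = 1 + norm g * norm x"
  define D where "D = {v. g \<bullet> v = 1 \<and> norm (v - x) \<le> r}"
  have N: "0 < N" using r by (simp add: N_def add_nonneg_pos)
  have Q: "0 < Q" by (simp add: Q_def add_pos_nonneg)
  have DN: "norm v \<le> N" if "v \<in> D" for v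
    using that norm_triangle_sub[of v x] by (simp add: D_def N_def)
  define \<rho> where "\<rho> w = w - (g \<bullet> w) *\<^sub>R x" for w
  have rho: "norm (\<rho> w) \<le> Q * norm w" for w
  proof -
    have "norm (\<rho> w) \<le> norm w + norm ((g \<bullet> w) *\<^sub>R x)" unfolding \<rho>_def by (rule norm_triangle_ineq4)
    also have "\<dots> \<le> norm w + (norm g * norm w) * norm x"
      using Cauchy_Schwarz_ineq2[of g w] by (simp add: mult_right_mono)
    finally show ?thesis by (simp add: Q_def algebra_simps)
  qed
  define K where "K = \<bar>\<kappa>\<bar>"
  have K: "0 < K" using k by (simp add: K_def)
  \<comment> \<open>The three bounds keep \<open>g (B v)\<close> away from \<open>0\<close>, map the ball into the ball of half the
    radius, and give the Lipschitz constant \<open>1/2\<close>.\<close>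
  define \<delta> where "\<delta> = min (K / (2 * (norm g * N + 1))) (min (K * r / (4 * Q * N)) (K / (8 * Q)))"
  have gN: "0 < norm g * N + 1" using N by (simp add: add_nonneg_pos)
  have \<delta>: "0 < \<delta>" using K r Q N gN by (simp add: \<delta>_def)
  obtain n where n: "norm (B n - P) < \<delta>"
    using B(1) \<delta> by (metis LIMSEQ_iff order_refl)
  define R where "R = B n - P"
  define d where "d = norm R"
  have d0: "0 \<le> d" by (simp add: d_def)
  have d1: "norm g * (d * N) \<le> K / 2"
  proof -
    have "d \<le> K / (2 * (norm g * N + 1))" using n by (simp add: d_def R_def \<delta>_def)
    then have "d * (2 * (norm g * N + 1)) \<le> K" using gN by (simp add: pos_le_divide_eq)
    then show ?thesis using d0 by (simp add: algebra_simps)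
  qed
  have d2: "Q * (d * N) \<le> K * r / 4"
  proof -
    have "d \<le> K * r / (4 * Q * N)" using n by (simp add: d_def R_def \<delta>_def)
    then have "d * (4 * Q * N) \<le> K * r" using Q N by (simp add: pos_le_divide_eq)
    then show ?thesis by (simp add: algebra_simps)
  qed
  have d3: "Q * d \<le> K / 8"
  proof -
    have "d \<le> K / (8 * Q)" using n by (simp add: d_def R_def \<delta>_def)
    then have "d * (8 * Q) \<le> K" using Q by (simp add: pos_le_divide_eq)
    then show ?thesis by (simp add: algebra_simps)
  qed
  have BP: "B n v = (\<kappa> * (g \<bullet> v)) *\<^sub>R x + R v" for v by (simp add: R_def blinfun.diff_left P)
  have Rn: "norm (R v) \<le> d * norm v" for v unfolding d_def by (rule norm_blinfun)
  have gB: "g \<bullet> B n v = \<kappa> * (g \<bullet> v) + g \<bullet> R v" for v by (simp add: BP inner_add_right gx)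
  have gBD: "K / 2 \<le> \<bar>g \<bullet> B n v\<bar>" if v: "v \<in> D" for v
  proof -
    have "\<bar>g \<bullet> R v\<bar> \<le> norm g * norm (R v)" by (rule Cauchy_Schwarz_ineq2)
    also have "\<dots> \<le> norm g * (d * N)"
      using Rn[of v] mult_left_mono[OF DN[OF v] d0] by (intro mult_left_mono) auto
    also have "\<dots> \<le> K / 2" by (rule d1)
    finally have "\<bar>g \<bullet> R v\<bar> \<le> K / 2" .
    moreover have "g \<bullet> B n v = \<kappa> + g \<bullet> R v" using v by (simp add: gB D_def)
    ultimately show ?thesis unfolding K_def by linarith
  qed
  define \<Phi> where "\<Phi> v = (1 / (g \<bullet> B n v)) *\<^sub>R B n v" for v
  have \<Phi>: "\<Phi> v = x + (1 / (g \<bullet> B n v)) *\<^sub>R \<rho> (R v)" if v: "v \<in> D" for v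
  proof -
    have nz: "g \<bullet> B n v \<noteq> 0" using gBD[OF v] K by auto
    have "B n v = (g \<bullet> B n v) *\<^sub>R x + \<rho> (R v)" unfolding \<rho>_def gB BP using gx by (simp add: algebra_simps)
    then have "\<Phi> v = (1 / (g \<bullet> B n v)) *\<^sub>R ((g \<bullet> B n v) *\<^sub>R x + \<rho> (R v))" unfolding \<Phi>_def by simp
    then show ?thesis using nz by (simp add: scaleR_add_right)
  qed
  have inv: "1 / \<bar>g \<bullet> B n v\<bar> \<le> 2 / K" if v: "v \<in> D" for v
    using gBD[OF v] K by (simp add: divide_simps)
  have rR: "norm (\<rho> (R v)) \<le> Q * (d * norm v)" for v
    using rho[of "R v"] mult_left_mono[OF Rn[of v] less_imp_le[OF Q]] by linarith
  have \<Phi>D: "\<Phi> v \<in> D" "norm (\<Phi> v - x) \<le> r / 2" if v: "v \<in> D" for v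
  proof -
    have "norm (\<Phi> v - x) = 1 / \<bar>g \<bullet> B n v\<bar> * norm (\<rho> (R v))" by (simp add: \<Phi>[OF v])
    also have "\<dots> \<le> 2 / K * (Q * (d * N))"
    proof (rule mult_mono[OF inv[OF v]])
      show "norm (\<rho> (R v)) \<le> Q * (d * N)"
        using rR[of v] mult_left_mono[OF mult_left_mono[OF DN[OF v] d0] less_imp_le[OF Q]] by linarith
    qed (use K in auto)
    also have "\<dots> \<le> 2 / K * (K * r / 4)" using d2 K by (intro mult_left_mono) auto
    also have "\<dots> = r / 2" using K by simp
    finally show le: "norm (\<Phi> v - x) \<le> r / 2" .
    have "g \<bullet> \<Phi> v = 1" using gBD[OF v] K by (auto simp: \<Phi>_def)
    then show "\<Phi> v \<in> D" using le r by (simp add: D_def)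
  qed
  have lip: "norm (\<Phi> v - \<Phi> w) \<le> 1/2 * norm (v - w)" if v: "v \<in> D" and w: "w \<in> D" for v w
  proof -
    let ?a = "g \<bullet> B n v" and ?b = "g \<bullet> B n w"
    have nz: "?a \<noteq> 0" "?b \<noteq> 0" using gBD[OF v] gBD[OF w] K by auto
    have "\<rho> (R (v - w)) = \<rho> (R v) - \<rho> (R w)"
      by (simp add: \<rho>_def blinfun.diff_right inner_diff_right algebra_simps)
    then have "\<Phi> v - \<Phi> w = (1 / ?a) *\<^sub>R \<rho> (R (v - w)) + (1 / ?a - 1 / ?b) *\<^sub>R \<rho> (R w)"
      by (simp only: \<Phi>[OF v] \<Phi>[OF w] scaleR_diff_right scaleR_diff_left add_diff_eq diff_add_eq) simp
    also have "1 / ?a - 1 / ?b = (1 / ?a) * (1 / ?b) * (?b - ?a)" using nz by (simp add: field_simps)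
    finally have "norm (\<Phi> v - \<Phi> w) \<le> 1 / \<bar>?a\<bar> * norm (\<rho> (R (v - w))) +
        1 / \<bar>?a\<bar> * (1 / \<bar>?b\<bar>) * \<bar>?b - ?a\<bar> * norm (\<rho> (R w))"
      by (metis (no_types, lifting) abs_1 abs_divide abs_mult norm_scaleR norm_triangle_ineq)
    also have "\<dots> \<le> 2 / K * (K / 8 * norm (v - w)) + 2 / K * (2 / K) * (K / 8 * norm (v - w)) * (K / 2)"
    proof (rule add_mono)
      have "norm (\<rho> (R (v - w))) \<le> K / 8 * norm (v - w)"
        using rR[of "v - w"] mult_right_mono[OF d3 norm_ge_zero[of "v - w"]] by (simp add: mult.assoc)
      then show "1 / \<bar>?a\<bar> * norm (\<rho> (R (v - w))) \<le> 2 / K * (K / 8 * norm (v - w))"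
        using K by (intro mult_mono[OF inv[OF v]]) auto
      have prod: "\<bar>?b - ?a\<bar> * norm (\<rho> (R w)) \<le> (K / 8 * norm (v - w)) * (K / 2)"
      proof -
        have "?b - ?a = - (g \<bullet> R (v - w))"
          using v w by (simp add: gB D_def blinfun.diff_right inner_diff_right)
        then have "\<bar>?b - ?a\<bar> \<le> norm g * norm (R (v - w))" using Cauchy_Schwarz_ineq2[of g "R (v - w)"] by simp
        also have "\<dots> \<le> norm g * (d * norm (v - w))" by (intro mult_left_mono Rn) auto
        finally have 1: "\<bar>?b - ?a\<bar> \<le> norm g * (d * norm (v - w))" .
        have 2: "norm (\<rho> (R w)) \<le> Q * (d * N)"
          using rR[of w] mult_left_mono[OF mult_left_mono[OF DN[OF w] d0] less_imp_le[OF Q]] by linarith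
        have "\<bar>?b - ?a\<bar> * norm (\<rho> (R w)) \<le> (norm g * (d * norm (v - w))) * (Q * (d * N))"
          using 1 2 d0 by (intro mult_mono) auto
        also have "\<dots> = (Q * d * norm (v - w)) * (norm g * (d * N))" by (simp add: algebra_simps)
        also have "\<dots> \<le> (K / 8 * norm (v - w)) * (K / 2)"
          using d1 d3 d0 Q N K by (intro mult_mono mult_right_mono) auto
        finally show ?thesis .
      qed
      have "1 / \<bar>?a\<bar> * (1 / \<bar>?b\<bar>) \<le> 2 / K * (2 / K)"
        using K by (intro mult_mono inv v w) auto
      then have "1 / \<bar>?a\<bar> * (1 / \<bar>?b\<bar>) * (\<bar>?b - ?a\<bar> * norm (\<rho> (R w))) \<le>
          2 / K * (2 / K) * ((K / 8 * norm (v - w)) * (K / 2))"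
        by (rule mult_mono[OF _ prod]) (use K in auto)
      then show "1 / \<bar>?a\<bar> * (1 / \<bar>?b\<bar>) * \<bar>?b - ?a\<bar> * norm (\<rho> (R w)) \<le>
          2 / K * (2 / K) * (K / 8 * norm (v - w)) * (K / 2)"
        by (simp only: mult.assoc)
    qed
    also have "\<dots> = 1/2 * norm (v - w)" using K by simp
    finally show ?thesis .
  qed
  have "closed D"
  proof -
    have "D = {v. g \<bullet> v = 1} \<inter> cball x r" by (auto simp: D_def dist_norm norm_minus_commute)
    then show ?thesis by (simp add: closed_hyperplane closed_Int)
  qed
  then have "complete D" by (simp add: complete_eq_closed)
  moreover have xD: "x \<in> D" using r gx by (simp add: D_def)
  ultimately obtain v0 where v0: "v0 \<in> D" "\<Phi> v0 = v0"
    using Banach_fix[of D "1/2" \<Phi>] \<Phi>D lip by (auto simp: dist_norm)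
  have Dnz: "v \<noteq> 0" if "v \<in> D" for v using that by (auto simp: D_def)
  have act: "pgl_act (pgl_class (B n)) (line v) = line (\<Phi> v)" if v: "v \<in> D" for v
  proof -
    have "g \<bullet> B n v \<noteq> 0" using gBD[OF v] K by auto
    then have "B n v \<noteq> 0" "1 / (g \<bullet> B n v) \<noteq> 0" by auto
    from line_scaleR[OF this] show ?thesis
      using pgl_act_line[OF B(2) Dnz[OF v]] by (simp only: \<Phi>_def)
  qed
  have iter: "(\<Phi> ^^ m) v \<in> D \<and> (pgl_act (pgl_class (B n)) ^^ m) (line v) = line ((\<Phi> ^^ m) v) \<and>
      norm ((\<Phi> ^^ m) v - v0) \<le> (1/2) ^ m * norm (v - v0)" if v: "v \<in> D" for v m
  proof (induction m)
    case (Suc m)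
    have "norm (\<Phi> ((\<Phi> ^^ m) v) - v0) \<le> 1/2 * norm ((\<Phi> ^^ m) v - v0)"
      using lip[of "(\<Phi> ^^ m) v" v0] Suc v0 by simp
    then show ?case using Suc \<Phi>D act by auto
  qed (use v in simp)
  define S where "S = {v. g \<bullet> v \<noteq> 0} \<inter> (\<lambda>v. (1 / (g \<bullet> v)) *\<^sub>R v) -` ball x r"
  have S: "open S" unfolding S_def
    by (rule continuous_open_preimage)
      (auto intro!: continuous_intros open_Collect_neq)
  have S0: "0 \<notin> S" by (simp add: S_def)
  have Ssc: "t *\<^sub>R v \<in> S" if "v \<in> S" "t \<noteq> 0" for v t using that by (simp add: S_def)
  have UD: "\<exists>w\<in>D. line v = line w" if v: "v \<in> S" for v
  proof
    have gv: "g \<bullet> v \<noteq> 0" using v by (simp add: S_def)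
    then show "(1 / (g \<bullet> v)) *\<^sub>R v \<in> D" using v by (simp add: S_def D_def dist_norm norm_minus_commute less_imp_le)
    have "v \<noteq> 0" using gv by auto
    then show "line v = line ((1 / (g \<bullet> v)) *\<^sub>R v)" using line_scaleR[of v "1 / (g \<bullet> v)"] gv by simp
  qed
  have "attracting_fixpoint (pgl_class (B n)) (line v0)"
    unfolding attracting_fixpoint_def
  proof (intro conjI exI[of _ "line ` S"] allI impI)
    show "pgl_act (pgl_class (B n)) (line v0) = line v0" using act v0 by simp
    show "open (line ` S)" by (rule open_line_image(1)[OF S S0 Ssc])
    have "norm (v0 - x) \<le> r / 2" using \<Phi>D(2)[OF v0(1)] v0(2) by simp
    then have "v0 \<in> S" using v0(1) r by (simp add: S_def D_def dist_norm norm_minus_commute)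
    then show "line v0 \<in> line ` S" by blast
    fix W' assume W': "open W' \<and> line v0 \<in> W'"
    obtain e where e: "0 < e" "ball v0 e \<subseteq> {v. v \<noteq> 0 \<and> line v \<in> W'}"
      using open_line_preimage[of W'] W' Dnz[OF v0(1)]
      by (metis (mono_tags, lifting) mem_Collect_eq open_contains_ball)
    have "(\<lambda>m. (1/2) ^ m * (2 * r)) \<longlonglongrightarrow> 0 * (2 * r)"
      by (intro tendsto_intros LIMSEQ_power_zero) simp
    then have "\<forall>\<^sub>F m in sequentially. (1/2) ^ m * (2 * r) < e"
      using e(1) by (intro order_tendstoD) auto
    then show "\<forall>\<^sub>F m in sequentially. (pgl_act (pgl_class (B n)) ^^ m) ` line ` S \<subseteq> W'"
    proof (rule eventually_mono)
      fix m assume m: "(1/2) ^ m * (2 * r) < e"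
      show "(pgl_act (pgl_class (B n)) ^^ m) ` line ` S \<subseteq> W'"
      proof clarify
        fix v assume "v \<in> S"
        then obtain w where w: "w \<in> D" "line v = line w" using UD by blast
        have "norm (w - v0) \<le> norm (w - x) + norm (v0 - x)"
          using norm_triangle_ineq4[of "w - x" "v0 - x"] by simp
        also have "\<dots> \<le> 2 * r" using w(1) v0(1) by (simp add: D_def)
        finally have "(1/2) ^ m * norm (w - v0) \<le> (1/2) ^ m * (2 * r)" by (intro mult_left_mono) auto
        then have "norm ((\<Phi> ^^ m) w - v0) < e" using iter[OF w(1), of m] m by linarith
        then have "line ((\<Phi> ^^ m) w) \<in> W'" using e(2) by (auto simp: dist_norm norm_minus_commute)
        then show "(pgl_act (pgl_class (B n)) ^^ m) (line v) \<in> W'" using iter[OF w(1), of m] w(2) by simp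
      qed
    qed
  qed
  moreover have "line v0 \<in> W"
  proof -
    have "v0 \<in> ball x r0" using v0(1) r by (simp add: D_def dist_norm norm_minus_commute)
    then show ?thesis using r0(2) by blast
  qed
  ultimately show ?thesis by blast
qed

lemma linear_blinfun_iterate:
  fixes A :: "'a::euclidean_space \<Rightarrow>\<^sub>L 'a"
  shows "linear (blinfun_apply A ^^ n)"
proof (induction n)
  case 0
  show ?case by (rule linearI) auto
next
  case (Suc n)
  then show ?case using linear_compose[OF Suc linear_blinfun_apply[of A]] by (simp add: o_def)
qed

text \<open>Split \<open>A\<^sup>n v / \<mu>\<^sup>n\<close> into a component \<open>\<alpha>\<close> along \<open>e\<close> and a component \<open>\<beta>\<close> orthogonal to \<open>e\<close>. That
  the iterates map a neighbourhood of \<open>\<real>e\<close> into every thin cone around \<open>\<real>e\<close> means, for small \<open>u\<close>,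
  that \<open>\<beta>(u)\<close> is small compared with \<open>1 + \<alpha>(u)\<close>; in particular \<open>1 + \<alpha>(u) \<noteq> 0\<close>. Applied to all
  multiples of \<open>u\<close> this forces \<open>\<bar>\<alpha>\<bar> < 1\<close>, hence \<open>\<beta> \<longlonglongrightarrow> 0\<close>. The scalars \<open>\<alpha>\<close> are merely
  bounded, whence the passage to subsequences.\<close>

lemma attracting_iterates:
  fixes A :: "'a::euclidean_space \<Rightarrow>\<^sub>L 'a"
  assumes A: "bij (blinfun_apply A)" and e: "e \<noteq> 0"
    and att: "attracting_fixpoint (pgl_class A) (line e)"
  obtains \<mu> where "\<mu> \<noteq> 0" "\<And>n. (blinfun_apply A ^^ n) e = \<mu> ^ n *\<^sub>R e"
    "\<And>v. \<exists>r a. strict_mono r \<and> (\<lambda>n. (1 / \<mu> ^ r n) *\<^sub>R (blinfun_apply A ^^ r n) v) \<longlonglongrightarrow> a *\<^sub>R e"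
proof -
  have inj: "blinfun_apply A v \<noteq> 0" if "v \<noteq> 0" for v
    using A that by (metis bij_is_inj blinfun.zero_right injD)
  have "line (A e) = line e" using att pgl_act_line[OF A e] by (simp add: attracting_fixpoint_def)
  then obtain \<mu> where l: "\<mu> \<noteq> 0" "A e = \<mu> *\<^sub>R e" using line_eq_iff[OF e inj[OF e]] by auto
  note lin = linear_blinfun_iterate[where A = A]
  have Ae: "(blinfun_apply A ^^ n) e = \<mu> ^ n *\<^sub>R e" for n
    by (induction n) (auto simp: l blinfun.scaleR_right)
  define s where "s n v = (1 / \<mu> ^ n) *\<^sub>R (blinfun_apply A ^^ n) v" for n v
  have s_lin: "linear (s n)" for n unfolding s_def using linear_compose_scale_right[OF lin] by simp
  have se: "s n e = e" for n using l by (simp add: s_def Ae)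
  have s0: "s n v \<noteq> 0" if "v \<noteq> 0" for n v
    using pgl_act_iterate_line[OF A that, of n] l by (simp add: s_def)
  define E where "E = e \<bullet> e"
  have E: "0 < E" using e by (simp add: E_def)
  define \<alpha> where "\<alpha> v = (v \<bullet> e) / E" for v
  have \<alpha>_add: "\<alpha> (v + w) = \<alpha> v + \<alpha> w" and \<alpha>_scale: "\<alpha> (t *\<^sub>R v) = t * \<alpha> v" and \<alpha>e: "\<alpha> e = 1" for v w t
    using E by (auto simp: \<alpha>_def inner_add_left add_divide_distrib E_def)
  define \<beta> where "\<beta> v = v - \<alpha> v *\<^sub>R e" for v
  have \<beta>_add_e: "\<beta> (e + v) = \<beta> v" for v by (simp add: \<beta>_def \<alpha>_add \<alpha>e algebra_simps)
  have \<beta>_scale: "\<beta> (t *\<^sub>R v) = t *\<^sub>R \<beta> v" for t v by (simp add: \<beta>_def \<alpha>_scale algebra_simps)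
  obtain U where U: "open U" "line e \<in> U"
    "\<And>W. open W \<Longrightarrow> line e \<in> W \<Longrightarrow> \<forall>\<^sub>F n in sequentially. (pgl_act (pgl_class A) ^^ n) ` U \<subseteq> W"
    using att unfolding attracting_fixpoint_def by blast
  obtain \<epsilon> where \<epsilon>: "0 < \<epsilon>" "ball e \<epsilon> \<subseteq> {v. v \<noteq> 0 \<and> line v \<in> U}"
    using open_line_preimage[OF U(1)] U(2) e
    by (metis (mono_tags, lifting) mem_Collect_eq open_contains_ball)
  have small: "\<forall>\<^sub>F n in sequentially. \<forall>u. norm u < \<epsilon> \<longrightarrow> norm (\<beta> (s n u)) < \<kappa> * \<bar>1 + \<alpha> (s n u)\<bar>"
    if \<kappa>: "0 < \<kappa>" for \<kappa>
  proof -
    define S where "S = {v. norm (\<beta> v) < \<kappa> * \<bar>\<alpha> v\<bar>}"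
    have S: "open S" unfolding S_def \<beta>_def \<alpha>_def using E
      by (intro open_Collect_less continuous_intros) auto
    have S0: "0 \<notin> S" by (simp add: S_def \<beta>_def \<alpha>_def)
    have Ssc: "t *\<^sub>R v \<in> S" if "v \<in> S" "t \<noteq> 0" for v t
      using that by (simp add: S_def \<beta>_scale \<alpha>_scale abs_mult mult.left_commute)
    have "e \<in> S" using \<kappa> by (simp add: S_def \<alpha>e \<beta>_def)
    then have "\<forall>\<^sub>F n in sequentially. (pgl_act (pgl_class A) ^^ n) ` U \<subseteq> line ` S"
      using U(3)[OF open_line_image(1)[OF S S0 Ssc]] by blast
    then show ?thesis
    proof (rule eventually_mono, intro allI impI)
      fix n u assume n: "(pgl_act (pgl_class A) ^^ n) ` U \<subseteq> line ` S" and u: "norm (u::'a) < \<epsilon>"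
      have "e + u \<in> ball e \<epsilon>" using u by (simp add: dist_norm)
      then have "e + u \<in> {v. v \<noteq> 0 \<and> line v \<in> U}" using \<epsilon>(2) by blast
      then have eu: "e + u \<noteq> 0" "line (e + u) \<in> U" by simp_all
      have "line ((blinfun_apply A ^^ n) (e + u)) \<in> line ` S"
        using n eu(2) pgl_act_iterate_line[OF A eu(1), of n] by (metis image_eqI subsetD)
      then have "(blinfun_apply A ^^ n) (e + u) \<in> S"
        using open_line_image(2)[OF S S0 Ssc] pgl_act_iterate_line[OF A eu(1), of n] by blast
      then have "s n (e + u) \<in> S" unfolding s_def using l by (intro Ssc) auto
      then have "e + s n u \<in> S" using linear_add[OF s_lin] se by simp
      then show "norm (\<beta> (s n u)) < \<kappa> * \<bar>1 + \<alpha> (s n u)\<bar>"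
        by (simp add: S_def \<beta>_add_e \<alpha>_add \<alpha>e)
    qed
  qed
  have \<alpha>_bound: "\<bar>\<alpha> (s n u)\<bar> < 1"
    if n: "\<forall>u. norm u < \<epsilon> \<longrightarrow> norm (\<beta> (s n u)) < \<kappa> * \<bar>1 + \<alpha> (s n u)\<bar>" and u: "norm u < \<epsilon>" for n \<kappa> u
  proof (rule ccontr)
    assume "\<not> \<bar>\<alpha> (s n u)\<bar> < 1"
    then have a: "1 \<le> \<bar>\<alpha> (s n u)\<bar>" by simp
    define t where "t = - 1 / \<alpha> (s n u)"
    have "\<bar>t\<bar> \<le> 1" using a by (simp add: t_def divide_simps)
    then have "norm (t *\<^sub>R u) \<le> norm u" by (simp add: mult_left_le_one_le)
    then have "norm (\<beta> (s n (t *\<^sub>R u))) < \<kappa> * \<bar>1 + \<alpha> (s n (t *\<^sub>R u))\<bar>" using n u by simp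
    moreover have "\<alpha> (s n (t *\<^sub>R u)) = - 1"
      unfolding linear_cmul[OF s_lin] \<alpha>_scale t_def using a by auto
    ultimately show False by simp
  qed
  have limit: "\<exists>r a. strict_mono r \<and> (\<lambda>n. s (r n) u) \<longlonglongrightarrow> a *\<^sub>R e" if u: "norm u < \<epsilon>" for u
  proof -
    have b0: "(\<lambda>n. \<beta> (s n u)) \<longlonglongrightarrow> 0"
    proof (rule tendstoI)
      fix \<kappa> :: real assume "0 < \<kappa>"
      then have "0 < \<kappa> / 2" by simp
      from small[OF this] show "\<forall>\<^sub>F n in sequentially. dist (\<beta> (s n u)) 0 < \<kappa>"
      proof (rule eventually_mono)
        fix n assume n: "\<forall>u. norm u < \<epsilon> \<longrightarrow> norm (\<beta> (s n u)) < \<kappa> / 2 * \<bar>1 + \<alpha> (s n u)\<bar>"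
        have "\<bar>1 + \<alpha> (s n u)\<bar> \<le> 2" using \<alpha>_bound[OF n u] by linarith
        then have "\<kappa> / 2 * \<bar>1 + \<alpha> (s n u)\<bar> \<le> \<kappa> / 2 * 2" using \<open>0 < \<kappa>\<close> by (intro mult_left_mono) auto
        moreover have "norm (\<beta> (s n u)) < \<kappa> / 2 * \<bar>1 + \<alpha> (s n u)\<bar>" using n u by blast
        ultimately show "dist (\<beta> (s n u)) 0 < \<kappa>" by simp
      qed
    qed
    obtain N where N: "\<And>n. N \<le> n \<Longrightarrow> \<bar>\<alpha> (s n u)\<bar> < 1"
      using small[of 1] \<alpha>_bound[OF _ u] unfolding eventually_sequentially by (metis zero_less_one)
    have "bounded (range (\<lambda>n. \<alpha> (s (n + N) u)))"
      unfolding bounded_iff using N by (intro exI[of _ 1]) (auto intro: less_imp_le)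
    then obtain a r where r: "strict_mono r" "((\<lambda>n. \<alpha> (s (n + N) u)) \<circ> r) \<longlonglongrightarrow> a"
      using bounded_imp_convergent_subsequence by blast
    define r' where "r' n = r n + N" for n
    have r': "strict_mono r'" using r(1) by (simp add: r'_def strict_mono_def)
    have "(\<lambda>n. \<alpha> (s (r' n) u) *\<^sub>R e + \<beta> (s (r' n) u)) \<longlonglongrightarrow> a *\<^sub>R e + 0"
      using r(2) LIMSEQ_subseq_LIMSEQ[OF b0 r']
      by (intro tendsto_intros) (auto simp: o_def r'_def)
    then have "(\<lambda>n. s (r' n) u) \<longlonglongrightarrow> a *\<^sub>R e" by (simp add: \<beta>_def)
    then show ?thesis using r' by blast
  qed
  have "\<exists>r a. strict_mono r \<and> (\<lambda>n. s (r n) v) \<longlonglongrightarrow> a *\<^sub>R e" for v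
  proof -
    obtain m where m: "0 < m" "norm v \<le> m" using that[of "norm v + 1"] by (auto simp: add_nonneg_pos)
    define t where "t = \<epsilon> / 2 / m"
    have t: "0 < t" using \<epsilon>(1) m by (simp add: t_def)
    have "t * norm v \<le> t * m" using t m by (intro mult_left_mono) auto
    also have "\<dots> = \<epsilon> / 2" using m by (simp add: t_def)
    finally have "norm (t *\<^sub>R v) < \<epsilon>" using t \<epsilon>(1) by simp
    then obtain r a where r: "strict_mono (r::nat\<Rightarrow>nat)" "(\<lambda>n. s (r n) (t *\<^sub>R v)) \<longlonglongrightarrow> a *\<^sub>R e"
      using limit by blast
    have "(\<lambda>n. (1/t) *\<^sub>R s (r n) (t *\<^sub>R v)) \<longlonglongrightarrow> (1/t) *\<^sub>R (a *\<^sub>R e)" by (intro tendsto_intros r)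
    moreover have "(1/t) *\<^sub>R s (r n) (t *\<^sub>R v) = s (r n) v" for n
      using t by (simp add: linear_cmul[OF s_lin])
    ultimately have "(\<lambda>n. s (r n) v) \<longlonglongrightarrow> (a / t) *\<^sub>R e" by simp
    then show ?thesis using r(1) by blast
  qed
  then show ?thesis using that[OF l(1) Ae] unfolding s_def by blast
qed

section \<open>Pointed convex cones and their automorphisms\<close>

locale pointed_cone =
  fixes C :: "'a::euclidean_space set" and f :: "'a \<Rightarrow> real"
  assumes open_C: "open C"
    and add_C: "\<And>c d. c \<in> C \<Longrightarrow> d \<in> C \<Longrightarrow> c + d \<in> C"
    and scale_C: "\<And>c t. c \<in> C \<Longrightarrow> 0 < t \<Longrightarrow> t *\<^sub>R c \<in> C"
    and C_nonempty: "C \<noteq> {}"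
    and linear_f: "linear f"
    and f_pos: "\<And>v. v \<in> closure C \<Longrightarrow> v \<noteq> 0 \<Longrightarrow> 0 < f v"
begin

lemma convex_C: "convex C"
  unfolding convex_alt
proof (intro ballI allI impI)
  fix x y u assume "x \<in> C" "y \<in> C" "0 \<le> (u::real) \<and> u \<le> 1"
  then show "(1 - u) *\<^sub>R x + u *\<^sub>R y \<in> C"
    using add_C[OF scale_C[of x "1 - u"] scale_C[of y u]] by (cases "u = 0"; cases "u = 1") auto
qed

lemma cl_limit:
  assumes "\<And>n. v n \<in> closure C" "v \<longlonglongrightarrow> w"
  shows "w \<in> closure C"
  using closed_sequentially[OF closed_closure] assms by blast

lemma not_C_limit:
  assumes "\<And>n. v n \<notin> C" "v \<longlonglongrightarrow> w"
  shows "w \<notin> C"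
  using closed_sequentially[of "- C" v w] open_C assms by (auto simp: closed_def)

lemma C_in_cl: "c \<in> C \<Longrightarrow> c \<in> closure C"
  using closure_subset by blast

lemma ball_in_C:
  assumes "c \<in> C"
  obtains \<epsilon> where "0 < \<epsilon>" "\<And>v. norm v \<le> \<epsilon> \<Longrightarrow> c + v \<in> C"
proof -
  obtain \<epsilon> where "0 < \<epsilon>" "cball c \<epsilon> \<subseteq> C" using assms open_C open_contains_cball by blast
  then show ?thesis using that[of \<epsilon>] by (force simp: dist_norm)
qed

lemma sub_small_C:
  assumes "c \<in> C"
  obtains t where "0 < t" "c - t *\<^sub>R v \<in> C"
proof -
  obtain \<epsilon> where e: "0 < \<epsilon>" "\<And>v. norm v \<le> \<epsilon> \<Longrightarrow> c + v \<in> C" using ball_in_C[OF assms] by blast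
  define t where "t = \<epsilon> / (norm v + 1)"
  have p: "norm v + 1 > 0" by (simp add: add_nonneg_pos)
  then have t: "0 < t" using e by (simp add: t_def)
  have "t * norm v \<le> \<epsilon>" using p e unfolding t_def by (simp add: field_simps)
  then have "c + (- (t *\<^sub>R v)) \<in> C" using t by (intro e(2)) simp
  then show ?thesis using that t by simp
qed

lemma add_C_cl:
  assumes c: "c \<in> C" and v: "v \<in> closure C"
  shows "c + v \<in> C"
proof -
  obtain \<epsilon> where e: "0 < \<epsilon>" "\<And>v. norm v \<le> \<epsilon> \<Longrightarrow> c + v \<in> C" using ball_in_C[OF c] by blast
  obtain w where w: "w \<in> C" "dist w v < \<epsilon>" using v e(1) closure_approachable by blast
  have "c + (v - w) \<in> C" using w e(2) by (simp add: dist_norm norm_minus_commute)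
  then have "(c + (v - w)) + w \<in> C" using w add_C by blast
  then show ?thesis by simp
qed

lemma zero_cl: "0 \<in> closure C"
proof -
  obtain c where c: "c \<in> C" using C_nonempty by blast
  have "(\<lambda>n. (1 / real (Suc n)) *\<^sub>R c) \<longlonglongrightarrow> 0 *\<^sub>R c"
    by (intro tendsto_scaleR tendsto_const LIMSEQ_Suc lim_1_over_n)
  moreover have "(1 / real (Suc n)) *\<^sub>R c \<in> closure C" for n
    by (rule C_in_cl, rule scale_C[OF c]) simp
  ultimately show ?thesis using cl_limit by (metis (no_types, lifting) scaleR_zero_left)
qed

lemma cl_scale:
  assumes v: "v \<in> closure C" and t: "0 \<le> t"
  shows "t *\<^sub>R v \<in> closure C"
proof (cases "t = 0")
  case False
  then have t: "0 < t" using t by simp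
  obtain x where x: "\<And>n. x n \<in> C" "x \<longlonglongrightarrow> v" using v closure_sequential by blast
  have "(\<lambda>n. t *\<^sub>R x n) \<longlonglongrightarrow> t *\<^sub>R v" by (intro tendsto_intros x)
  then show ?thesis using cl_limit[of "\<lambda>n. t *\<^sub>R x n"] C_in_cl scale_C[OF x(1) t] by blast
qed (simp add: zero_cl)

lemma cl_add:
  assumes v: "v \<in> closure C" and w: "w \<in> closure C"
  shows "v + w \<in> closure C"
proof -
  obtain x where x: "\<And>n. x n \<in> C" "x \<longlonglongrightarrow> v" using v closure_sequential by blast
  have "(\<lambda>n. x n + w) \<longlonglongrightarrow> v + w" by (intro tendsto_intros x)
  then show ?thesis using cl_limit[of "\<lambda>n. x n + w"] C_in_cl add_C_cl[OF x(1) w] by blast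
qed

lemma pointed:
  assumes "v \<in> closure C" "- v \<in> closure C"
  shows "v = 0"
  using f_pos[OF assms(1)] f_pos[OF assms(2)] linear_neg[OF linear_f, of v] by fastforce

lemma zero_not_C: "0 \<notin> C"
proof
  assume "0 \<in> C"
  then obtain \<epsilon> where e: "0 < \<epsilon>" "\<And>v. norm v \<le> \<epsilon> \<Longrightarrow> 0 + v \<in> C" using ball_in_C by blast
  obtain b :: 'a where "b \<in> Basis" using nonempty_Basis by blast
  then have "\<epsilon> *\<^sub>R b \<in> C" "- (\<epsilon> *\<^sub>R b) \<in> C" "\<epsilon> *\<^sub>R b \<noteq> 0" using e by auto
  then show False using pointed C_in_cl by blast
qed

lemma f_nonneg: "v \<in> closure C \<Longrightarrow> 0 \<le> f v"
  using f_pos[of v] linear_0[OF linear_f] by (cases "v = 0") auto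

lemma norm_bound:
  obtains M where "0 < M" "\<And>v. v \<in> closure C \<Longrightarrow> norm v \<le> M * f v"
proof -
  let ?S = "closure C \<inter> sphere 0 1"
  obtain c where c: "c \<in> C" using C_nonempty by blast
  have "c \<noteq> 0" using c zero_not_C by blast
  then have "(1 / norm c) *\<^sub>R c \<in> ?S" using C_in_cl[OF scale_C[OF c, of "1 / norm c"]] by simp
  then have ne: "?S \<noteq> {}" by blast
  have "compact ?S" by (intro closed_Int_compact) auto
  moreover have "continuous_on ?S f"
    using linear_continuous_on linear_f linear_conv_bounded_linear by blast
  ultimately obtain s where s: "s \<in> ?S" "\<And>x. x \<in> ?S \<Longrightarrow> f s \<le> f x"
    using continuous_attains_inf[of ?S f] ne by blast
  have fs: "0 < f s" using s(1) f_pos[of s] by (cases "s = 0") auto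
  have "norm v \<le> 1 / f s * f v" if v: "v \<in> closure C" for v
  proof (cases "v = 0")
    case False
    then have "(1 / norm v) *\<^sub>R v \<in> ?S" using cl_scale[OF v, of "1 / norm v"] by simp
    then have "f s \<le> f ((1 / norm v) *\<^sub>R v)" by (rule s(2))
    also have "\<dots> = f v / norm v" using linear_cmul[OF linear_f] by simp
    finally show ?thesis using False fs by (simp add: field_simps)
  qed (simp add: linear_0[OF linear_f])
  then show ?thesis using that[of "1 / f s"] fs by auto
qed

text \<open>Order intervals of a pointed closed cone are bounded. This is the source of all compactness
  below: it bounds a linear map that preserves the cone in terms of its value at one interior point.\<close>

lemma order_interval_bound:
  obtains M where "0 < M"
    "\<And>p u. p + u \<in> closure C \<Longrightarrow> p - u \<in> closure C \<Longrightarrow> norm u \<le> M * f p"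
proof -
  obtain M where M: "0 < M" "\<And>v. v \<in> closure C \<Longrightarrow> norm v \<le> M * f v" using norm_bound by blast
  have "norm u \<le> M * f p" if "p + u \<in> closure C" "p - u \<in> closure C" for p u
  proof -
    have "norm (2 *\<^sub>R u) = norm ((p + u) - (p - u))" by (simp add: scaleR_2)
    also have "\<dots> \<le> norm (p + u) + norm (p - u)" by (rule norm_triangle_ineq4)
    also have "\<dots> \<le> M * f (p + u) + M * f (p - u)" using M(2) that by (simp add: add_mono)
    also have "\<dots> = 2 * (M * f p)"
      by (simp add: linear_add[OF linear_f] linear_diff[OF linear_f] algebra_simps)
    finally show ?thesis by simp
  qed
  then show ?thesis using that[of M] M(1) by blast
qed

definition cone_aut :: "('a \<Rightarrow>\<^sub>L 'a) set"
  where "cone_aut = {A. bij (blinfun_apply A) \<and> blinfun_apply A ` C = C}"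

lemma aut_C: "A \<in> cone_aut \<Longrightarrow> blinfun_apply A v \<in> C \<longleftrightarrow> v \<in> C"
  unfolding cone_aut_def using bij_is_inj[THEN inj_image_mem_iff] by fastforce

lemma cl_map:
  assumes "\<And>c. c \<in> C \<Longrightarrow> blinfun_apply T c \<in> closure C" "v \<in> closure C"
  shows "blinfun_apply T v \<in> closure C"
proof -
  obtain x where x: "\<And>n. x n \<in> C" "x \<longlonglongrightarrow> v" using assms(2) closure_sequential by blast
  have "(\<lambda>n. T (x n)) \<longlonglongrightarrow> T v" by (intro tendsto_intros x)
  then show ?thesis using cl_limit[of "\<lambda>n. T (x n)"] assms(1) x(1) by blast
qed

lemma aut_cl: "A \<in> cone_aut \<Longrightarrow> v \<in> closure C \<Longrightarrow> blinfun_apply A v \<in> closure C"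
  using cl_map aut_C C_in_cl by blast

lemma aut_inverse:
  assumes "A \<in> cone_aut"
  obtains B where "B \<in> cone_aut" "\<And>v. blinfun_apply B (blinfun_apply A v) = v"
    "\<And>v. blinfun_apply A (blinfun_apply B v) = v"
proof -
  have bij: "bij (blinfun_apply A)" using assms by (simp add: cone_aut_def)
  obtain B where B: "bij (blinfun_apply B)" "B o\<^sub>L A = id_blinfun" using blinfun_inverse[OF bij] .
  have 1: "B (A v) = v" for v
    using arg_cong[OF B(2), of "\<lambda>X. blinfun_apply X v"] by simp
  have 2: "A (B v) = v" for v
  proof -
    obtain w where "v = A w" using bij bij_is_surj surjD by metis
    then show ?thesis using 1 by simp
  qed
  have mem: "B v \<in> C \<longleftrightarrow> v \<in> C" for v using aut_C[OF assms, of "B v"] 2 by simp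
  have "blinfun_apply B ` C = C"
  proof (intro subset_antisym subsetI)
    fix v assume "v \<in> C"
    then have "A v \<in> C" using aut_C[OF assms] by simp
    then show "v \<in> B ` C" using 1[of v] by (metis image_eqI)
  qed (use mem in auto)
  then have "B \<in> cone_aut" using B(1) by (simp add: cone_aut_def)
  then show ?thesis using that 1 2 by blast
qed

lemma aut_compose:
  assumes "A \<in> cone_aut" "B \<in> cone_aut"
  shows "A o\<^sub>L B \<in> cone_aut"
proof -
  have "blinfun_apply (A o\<^sub>L B) = blinfun_apply A \<circ> blinfun_apply B" by (auto simp: fun_eq_iff)
  moreover have "(blinfun_apply A \<circ> blinfun_apply B) ` C = C"
    unfolding image_comp[symmetric] using assms by (simp add: cone_aut_def)
  ultimately show ?thesis using assms unfolding cone_aut_def by (metis (mono_tags, lifting) bij_comp mem_Collect_eq)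
qed

lemma aut_scale:
  assumes A: "A \<in> cone_aut" and t: "0 < t"
  shows "t *\<^sub>R A \<in> cone_aut"
proof -
  obtain B where B: "B \<in> cone_aut" "\<And>v. B (A v) = v" "\<And>v. A (B v) = v"
    using aut_inverse[OF A] by metis
  have l: "(1 / t) *\<^sub>R B ((t *\<^sub>R A) v) = v" "(t *\<^sub>R A) ((1 / t) *\<^sub>R B v) = v" for v
    using t by (simp_all add: blinfun.scaleR_left blinfun.scaleR_right B)
  have "bij (blinfun_apply (t *\<^sub>R A))" by (rule o_bij[of "\<lambda>v. (1 / t) *\<^sub>R B v"]) (auto simp: fun_eq_iff l)
  moreover have "(t *\<^sub>R A) ` C = C"
  proof (intro subset_antisym subsetI)
    fix v assume "v \<in> (t *\<^sub>R A) ` C"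
    then show "v \<in> C" using aut_C[OF A] scale_C[OF _ t] by (auto simp: blinfun.scaleR_left)
  next
    fix v assume v: "v \<in> C"
    then have "(1 / t) *\<^sub>R B v \<in> C" using aut_C[OF B(1)] t by (intro scale_C) auto
    then show "v \<in> (t *\<^sub>R A) ` C" using l(2)[of v] by (metis image_eqI)
  qed
  ultimately show ?thesis by (simp add: cone_aut_def)
qed

definition extreme :: "'a \<Rightarrow> bool"
  where "extreme x \<longleftrightarrow> x \<in> closure C \<and> x \<noteq> 0 \<and>
    (\<forall>a\<in>closure C. \<forall>b\<in>closure C. a + b = x \<longrightarrow> (\<exists>s. a = s *\<^sub>R x))"

lemma extreme_aut:
  assumes x: "extreme x" and A: "A \<in> cone_aut"
  shows "extreme (blinfun_apply A x)"
proof -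
  obtain B where B: "B \<in> cone_aut" "\<And>v. B (A v) = v" "\<And>v. A (B v) = v"
    using aut_inverse[OF A] by blast
  have "\<exists>s. a = s *\<^sub>R A x" if ab: "a \<in> closure C" "b \<in> closure C" "a + b = A x" for a b
  proof -
    have "B a + B b = x" using ab(3) B(2) by (metis blinfun.add_right)
    moreover have "B a \<in> closure C" "B b \<in> closure C" using aut_cl B(1) ab by auto
    ultimately obtain s where "B a = s *\<^sub>R x" using x unfolding extreme_def by blast
    then have "A (B a) = s *\<^sub>R A x" by (simp add: blinfun.scaleR_right)
    then show ?thesis using B(3) by auto
  qed
  moreover have "A x \<noteq> 0" using x B(2)[of x] unfolding extreme_def by (metis blinfun.zero_right)
  ultimately show ?thesis using x A aut_cl unfolding extreme_def by blast
qed

lemma extreme_scale: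
  assumes x: "extreme x" and t: "0 < t"
  shows "extreme (t *\<^sub>R x)"
proof -
  have "\<exists>s. a = s *\<^sub>R t *\<^sub>R x" if ab: "a \<in> closure C" "b \<in> closure C" "a + b = t *\<^sub>R x" for a b
  proof -
    have "(1/t) *\<^sub>R a + (1/t) *\<^sub>R b = x" using ab(3) t by (metis divideR_right less_numeral_extra(3) scaleR_add_right inverse_eq_divide)
    moreover have "(1/t) *\<^sub>R a \<in> closure C" "(1/t) *\<^sub>R b \<in> closure C" using cl_scale ab t by auto
    ultimately obtain s where "(1/t) *\<^sub>R a = s *\<^sub>R x" using x unfolding extreme_def by blast
    then have "a = s *\<^sub>R t *\<^sub>R x" using t by (metis (no_types, lifting) divideR_right inverse_eq_divide less_numeral_extra(3) mult.commute scaleR_scaleR)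
    then show ?thesis by blast
  qed
  then show ?thesis using x t cl_scale unfolding extreme_def by auto
qed

lemma extreme_cl: "extreme x \<Longrightarrow> x \<in> closure C" and extreme_nz: "extreme x \<Longrightarrow> x \<noteq> 0"
  by (auto simp: extreme_def)

lemma extreme_below:
  assumes x: "extreme x" and y: "y \<in> closure C" "x - s *\<^sub>R y \<in> closure C" "0 < s"
  shows "\<exists>r\<ge>0. y = r *\<^sub>R x"
proof -
  have "s *\<^sub>R y \<in> closure C" using cl_scale y by simp
  then obtain r where r: "s *\<^sub>R y = r *\<^sub>R x" using x y unfolding extreme_def by (metis add_diff_cancel_left' diff_add_cancel)
  then have yr: "y = (r / s) *\<^sub>R x" using y(3) by (metis divideR_right less_numeral_extra(3) scaleR_scaleR divide_inverse mult.commute)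
  have "r / s \<ge> 0"
  proof (rule ccontr)
    assume "\<not> r / s \<ge> 0"
    then have "- y = (-(r/s)) *\<^sub>R x" "0 \<le> -(r/s)" using yr by auto
    then have "- y \<in> closure C" using cl_scale extreme_cl[OF x] by metis
    then have "y = 0" using pointed y by blast
    then show False using yr \<open>\<not> r / s \<ge> 0\<close> extreme_nz[OF x] by auto
  qed
  then show ?thesis using yr by blast
qed

text \<open>The relative interior of the smallest face of the closed cone that contains \<open>e\<close>, in terms of the
  order defined by the cone: \<open>y\<close> and \<open>e\<close> are each bounded by a multiple of the other.\<close>

definition open_face :: "'a \<Rightarrow> 'a set"
  where "open_face e = {y \<in> closure C. (\<exists>s>0. e - s *\<^sub>R y \<in> closure C) \<and> (\<exists>t>0. y - t *\<^sub>R e \<in> closure C)}"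

lemma open_face_self: "e \<in> closure C \<Longrightarrow> e \<in> open_face e"
  unfolding open_face_def using zero_cl by (auto intro!: exI[of _ 1])

lemma open_face_cl: "y \<in> open_face e \<Longrightarrow> y \<in> closure C"
  by (simp add: open_face_def)

lemma aut_iterate: "A \<in> cone_aut \<Longrightarrow> (blinfun_apply A ^^ n) v \<in> C \<longleftrightarrow> v \<in> C"
  by (induction n) (auto simp: aut_C)

text \<open>The normalized iterates of a vector of \<open>C\<close> stay in \<open>\<plusminus>C\<close> and accumulate at some \<open>a e\<close>. If \<open>a = 0\<close>, the
  start vector is moved in the direction of \<open>e\<close>, which changes \<open>a\<close> by the same amount.\<close>

lemma attracting_fixpoint_closure:
  assumes A: "A \<in> cone_aut" and e: "e \<noteq> 0" and att: "attracting_fixpoint (pgl_class A) (line e)"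
  shows "e \<in> closure C \<or> - e \<in> closure C"
proof -
  have bij: "bij (blinfun_apply A)" using A by (simp add: cone_aut_def)
  obtain \<mu> where l: "\<mu> \<noteq> 0" "\<And>n. (blinfun_apply A ^^ n) e = \<mu> ^ n *\<^sub>R e"
    "\<And>v. \<exists>r a. strict_mono r \<and> (\<lambda>n. (1 / \<mu> ^ r n) *\<^sub>R (blinfun_apply A ^^ r n) v) \<longlonglongrightarrow> a *\<^sub>R e"
    using attracting_iterates[OF bij e att] by blast
  note lin = linear_blinfun_iterate[where A = A]
  define CC where "CC = closure C \<union> uminus ` closure C"
  have "closed CC" unfolding CC_def by (intro closed_Un closed_closure closed_negations)
  have inCC: "(1 / \<mu> ^ n) *\<^sub>R (blinfun_apply A ^^ n) c \<in> CC" if c: "c \<in> C" for n c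
  proof -
    have y: "(blinfun_apply A ^^ n) c \<in> C" using aut_iterate[OF A] c by blast
    have nz: "\<mu> ^ n \<noteq> 0" using l(1) by simp
    show ?thesis
    proof (cases "0 < \<mu> ^ n")
      case True
      then have "0 < 1 / \<mu> ^ n" by simp
      from C_in_cl[OF scale_C[OF y this]] show ?thesis by (simp add: CC_def)
    next
      case False
      then have "\<mu> ^ n < 0" using nz by linarith
      then have "0 < - 1 / \<mu> ^ n" by (intro divide_neg_neg) auto
      from C_in_cl[OF scale_C[OF y this]]
      have "- ((- 1 / \<mu> ^ n) *\<^sub>R (blinfun_apply A ^^ n) c) \<in> CC" unfolding CC_def by blast
      then show ?thesis by simp
    qed
  qed
  obtain c where c: "c \<in> C" using C_nonempty by blast
  obtain r a where r: "strict_mono (r::nat\<Rightarrow>nat)" "(\<lambda>n. (1 / \<mu> ^ r n) *\<^sub>R (blinfun_apply A ^^ r n) c) \<longlonglongrightarrow> a *\<^sub>R e"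
    using l(3) by blast
  obtain t0 where t0: "0 < t0" "c - t0 *\<^sub>R (- e) \<in> C" using sub_small_C[OF c] by blast
  \<comment> \<open>Replacing \<open>c\<close> by \<open>c + t e\<close> replaces \<open>a\<close> by \<open>a + t\<close>.\<close>
  define t where "t = (if a = 0 then t0 else 0)"
  have ct: "c + t *\<^sub>R e \<in> C" using c t0 by (simp add: t_def)
  have at: "a + t \<noteq> 0" using t0 by (simp add: t_def)
  have "(1 / \<mu> ^ n) *\<^sub>R (blinfun_apply A ^^ n) (c + t *\<^sub>R e) = (1 / \<mu> ^ n) *\<^sub>R (blinfun_apply A ^^ n) c + t *\<^sub>R e" for n
    using l(1) by (simp add: linear_add[OF lin] linear_cmul[OF lin] l(2) scaleR_add_right)
  then have "(\<lambda>n. (1 / \<mu> ^ r n) *\<^sub>R (blinfun_apply A ^^ r n) (c + t *\<^sub>R e)) \<longlonglongrightarrow> a *\<^sub>R e + t *\<^sub>R e"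
    using tendsto_add[OF r(2) tendsto_const[of "t *\<^sub>R e"]] by simp
  from closed_sequentially[OF \<open>closed CC\<close> _ this] inCC[OF ct]
  have "a *\<^sub>R e + t *\<^sub>R e \<in> CC" by blast
  then have "(a + t) *\<^sub>R e \<in> CC" by (simp add: scaleR_add_left)
  then have "(a + t) *\<^sub>R e \<in> closure C \<or> - ((a + t) *\<^sub>R e) \<in> closure C"
    unfolding CC_def by (metis Un_iff imageE add.inverse_inverse)
  then have "\<exists>b. b \<noteq> 0 \<and> b *\<^sub>R e \<in> closure C" using at by (metis neg_equal_0_iff_equal scaleR_minus_left)
  then obtain b where b: "b \<noteq> 0" "b *\<^sub>R e \<in> closure C" by blast
  then show ?thesis
    using cl_scale[OF b(2), of "1 / \<bar>b\<bar>"] by (cases "0 < b") auto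
qed

text \<open>In dimension at least two there is a direction \<open>u\<close> with \<open>f u = 0\<close>, and far out on it both \<open>e + u\<close>
  and \<open>e - u\<close> are outside \<open>C\<close>. Their normalized iterates stay outside and accumulate at \<open>(1 + a) e\<close>
  and \<open>(1 - a) e\<close>; these factors cannot both be nonpositive.\<close>

lemma attracting_fixpoint_not_interior:
  assumes A: "A \<in> cone_aut" and e: "e \<in> C" and dim: "2 \<le> DIM('a)"
  shows "\<not> attracting_fixpoint (pgl_class A) (line e)"
proof
  assume att: "attracting_fixpoint (pgl_class A) (line e)"
  have e0: "e \<noteq> 0" using e zero_not_C by blast
  have bij: "bij (blinfun_apply A)" using A by (simp add: cone_aut_def)
  obtain \<mu> where l: "\<mu> \<noteq> 0" "\<And>n. (blinfun_apply A ^^ n) e = \<mu> ^ n *\<^sub>R e"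
    "\<And>v. \<exists>r a. strict_mono r \<and> (\<lambda>n. (1 / \<mu> ^ r n) *\<^sub>R (blinfun_apply A ^^ r n) v) \<longlonglongrightarrow> a *\<^sub>R e"
    using attracting_iterates[OF bij e0 att] by blast
  note lin = linear_blinfun_iterate[where A = A]
  have fe: "0 < f e" using f_pos[OF C_in_cl[OF e] e0] .
  have "\<mu> *\<^sub>R e \<in> C" using aut_C[OF A, of e] e l(2)[of 1] by simp
  then have "0 \<le> \<mu> * f e" using f_nonneg[OF C_in_cl] linear_cmul[OF linear_f] by fastforce
  then have l_pos: "0 < \<mu>" using fe l(1) by (simp add: zero_le_mult_iff)
  have "\<not> inj f"
  proof
    assume "inj f"
    then have "dim (range f) = DIM('a)" using dim_image_eq[OF linear_f, of UNIV] by simp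
    then show False using dim dim_subset_UNIV[of "range f"] by simp
  qed
  then obtain u0 where u0: "u0 \<noteq> 0" "f u0 = 0" using linear_injective_0[OF linear_f] by blast
  obtain M where M: "0 < M" "\<And>v. v \<in> closure C \<Longrightarrow> norm v \<le> M * f v" using norm_bound by blast
  \<comment> \<open>Long enough for \<open>e \<plusminus> u\<close> to violate the bound \<open>norm v \<le> M * f v\<close>, as \<open>f (e \<plusminus> u) = f e\<close>.\<close>
  define \<tau> where "\<tau> = (M * f e + norm e + 1) / norm u0"
  define u where "u = \<tau> *\<^sub>R u0"
  have "0 < M * f e + norm e + 1" using M(1) fe by (simp add: add_pos_nonneg add_nonneg_pos)
  then have nu: "norm u = M * f e + norm e + 1" using u0(1) by (simp add: u_def \<tau>_def)
  have fu: "f u = 0" using u0 by (simp add: u_def linear_cmul[OF linear_f])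
  have out: "e + s *\<^sub>R u \<notin> C" if s: "\<bar>s\<bar> = 1" for s
  proof
    assume "e + s *\<^sub>R u \<in> C"
    then have "norm (e + s *\<^sub>R u) \<le> M * f (e + s *\<^sub>R u)" using M(2) C_in_cl by blast
    then have "norm (e + s *\<^sub>R u) \<le> M * f e"
      by (simp add: linear_add[OF linear_f] linear_cmul[OF linear_f] fu)
    moreover have "norm (s *\<^sub>R u) \<le> norm (e + s *\<^sub>R u) + norm e"
      using norm_triangle_ineq4[of "e + s *\<^sub>R u" e] by simp
    ultimately show False using nu s by simp
  qed
  obtain r a where r: "strict_mono (r::nat\<Rightarrow>nat)" "(\<lambda>n. (1 / \<mu> ^ r n) *\<^sub>R (blinfun_apply A ^^ r n) u) \<longlonglongrightarrow> a *\<^sub>R e"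
    using l(3) by blast
  have lim_out: "(1 + s * a) *\<^sub>R e \<notin> C" if s: "\<bar>s\<bar> = 1" for s
  proof (rule not_C_limit)
    have eq: "(1 / \<mu> ^ n) *\<^sub>R (blinfun_apply A ^^ n) (e + s *\<^sub>R u) = e + s *\<^sub>R ((1 / \<mu> ^ n) *\<^sub>R (blinfun_apply A ^^ n) u)" for n
      using l(1) by (simp add: linear_add[OF lin] linear_cmul[OF lin] l(2) scaleR_add_right)
    have "(\<lambda>n. e + s *\<^sub>R ((1 / \<mu> ^ r n) *\<^sub>R (blinfun_apply A ^^ r n) u)) \<longlonglongrightarrow> e + s *\<^sub>R (a *\<^sub>R e)"
      by (intro tendsto_intros r)
    then show "(\<lambda>n. (1 / \<mu> ^ r n) *\<^sub>R (blinfun_apply A ^^ r n) (e + s *\<^sub>R u)) \<longlonglongrightarrow> (1 + s * a) *\<^sub>R e"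
      by (simp add: eq scaleR_add_left)
    show "(1 / \<mu> ^ r n) *\<^sub>R (blinfun_apply A ^^ r n) (e + s *\<^sub>R u) \<notin> C" for n
    proof
      assume "(1 / \<mu> ^ r n) *\<^sub>R (blinfun_apply A ^^ r n) (e + s *\<^sub>R u) \<in> C"
      then have "\<mu> ^ r n *\<^sub>R ((1 / \<mu> ^ r n) *\<^sub>R (blinfun_apply A ^^ r n) (e + s *\<^sub>R u)) \<in> C"
        by (rule scale_C) (use l_pos in simp)
      then have "(blinfun_apply A ^^ r n) (e + s *\<^sub>R u) \<in> C" using l(1) by simp
      then show False using aut_iterate[OF A] out[OF s] by blast
    qed
  qed
  have "\<not> 0 < 1 + s * a" if "\<bar>s\<bar> = 1" for s using lim_out[OF that] scale_C[OF e] by blast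
  from this[of 1] this[of "-1"] show False by simp
qed

end

section \<open>Radial limits of automorphisms\<close>

text \<open>The compact set can be chosen to reach every vector of the cone, and not only every ray, because
  homotheties with positive factor are automorphisms of the cone.\<close>

locale cocompact_cone = pointed_cone +
  fixes K :: "'a set"
  assumes compact_K: "compact K"
    and K_C: "K \<subseteq> C"
    and cocompact: "\<And>c. c \<in> C \<Longrightarrow> \<exists>A\<in>cone_aut. \<exists>k\<in>K. c = blinfun_apply A k"
begin

text \<open>The points \<open>k \<plusminus> v\<close> lie in \<open>C\<close> for all \<open>v\<close> in a ball whose radius is the distance from \<open>K\<close> to the
  complement of \<open>C\<close>; so \<open>T v\<close> lies in the order interval given by \<open>T k\<close>.\<close>

lemma norm_bound_via_K:
  obtains R where "0 < R"
    "\<And>T k v. (\<And>c. c \<in> C \<Longrightarrow> blinfun_apply T c \<in> closure C) \<Longrightarrow> k \<in> K \<Longrightarrow>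
       norm (blinfun_apply T v) \<le> R * f (blinfun_apply T k) * norm v"
proof -
  have "\<exists>d>0. \<forall>x\<in>K. \<forall>y\<in>- C. d \<le> dist x y"
    using separate_compact_closed[of K "- C"] compact_K K_C open_C by (auto simp: closed_def)
  then obtain d where d: "0 < d" "\<And>x y. x \<in> K \<Longrightarrow> y \<notin> C \<Longrightarrow> d \<le> dist x y" by auto
  obtain M where M: "0 < M"
    "\<And>p u. p + u \<in> closure C \<Longrightarrow> p - u \<in> closure C \<Longrightarrow> norm u \<le> M * f p"
    using order_interval_bound by blast
  have "norm (T v) \<le> (2 * M / d) * f (T k) * norm v"
    if T: "\<And>c. c \<in> C \<Longrightarrow> blinfun_apply T c \<in> closure C" and k: "k \<in> K"
    for T :: "'a \<Rightarrow>\<^sub>L 'a" and k v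
  proof (cases "v = 0")
    case False
    define a where "a = d / 2 / norm v"
    have a: "0 < a" using d False by (simp add: a_def)
    define u where "u = a *\<^sub>R v"
    have nu: "norm u < d" using d False by (simp add: u_def a_def)
    have "k + u \<in> C" "k - u \<in> C"
      using d(2)[OF k, of "k + u"] d(2)[OF k, of "k - u"] nu by (auto simp: dist_norm)
    then have "T k + T u \<in> closure C" "T k - T u \<in> closure C"
      using T by (metis blinfun.add_right, metis blinfun.diff_right)
    then have "norm (T u) \<le> M * f (T k)" by (rule M(2))
    then have "a * norm (T v) \<le> M * f (T k)" using a by (simp add: u_def blinfun.scaleR_right)
    then show ?thesis using a d False by (simp add: a_def field_simps)
  qed simp
  moreover have "0 < 2 * M / d" using M d by simp
  ultimately show ?thesis using that by blast
qed

lemma convergent_subsequence: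
  fixes k :: "nat \<Rightarrow> 'a"
  assumes T: "\<And>n c. c \<in> C \<Longrightarrow> blinfun_apply (T n) c \<in> closure C"
    and k: "\<And>n. k n \<in> K" and F: "\<And>n. f (blinfun_apply (T n) (k n)) \<le> F"
  obtains r T' q where "strict_mono r" "(T \<circ> r) \<longlonglongrightarrow> T'" "(k \<circ> r) \<longlonglongrightarrow> q" "q \<in> K"
proof -
  obtain R where R: "0 < R"
    "\<And>T k v. (\<And>c. c \<in> C \<Longrightarrow> blinfun_apply T c \<in> closure C) \<Longrightarrow> k \<in> K \<Longrightarrow>
       norm (blinfun_apply T v) \<le> R * f (blinfun_apply T k) * norm v"
    using norm_bound_via_K by blast
  have F0: "0 \<le> F" using F[of 0] f_nonneg[OF T[of "k 0" 0]] k K_C by fastforce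
  have "norm (T n) \<le> R * F" for n
  proof (rule norm_blinfun_bound)
    fix v
    have "norm (T n v) \<le> R * f (T n (k n)) * norm v" using R(2)[OF T k] by blast
    also have "\<dots> \<le> R * F * norm v" using F R(1) by (intro mult_right_mono mult_left_mono) auto
    finally show "norm (T n v) \<le> R * F * norm v" .
  qed (use R F0 in auto)
  then have "bounded (range T)" by (auto simp: bounded_iff)
  then obtain r1 T' where r1: "strict_mono r1" "(T \<circ> r1) \<longlonglongrightarrow> T'"
    using bounded_imp_convergent_subsequence by blast
  obtain r2 q where r2: "q \<in> K" "strict_mono r2" "((k \<circ> r1) \<circ> r2) \<longlonglongrightarrow> q"
    using compact_K k unfolding compact_def by (metis comp_apply)
  show ?thesis
  proof
    show "strict_mono (r1 \<circ> r2)" using r1 r2 by (simp add: strict_mono_o)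
    show "(T \<circ> (r1 \<circ> r2)) \<longlonglongrightarrow> T'" using LIMSEQ_subseq_LIMSEQ[OF r1(2) r2(2)] by (simp add: o_assoc)
    show "(k \<circ> (r1 \<circ> r2)) \<longlonglongrightarrow> q" using r2 by (simp add: o_assoc)
  qed (rule r2)
qed

text \<open>That \<open>w'\<close> is approached by preimages of \<open>w\<close> under the automorphisms, and not merely mapped to \<open>w\<close>
  by their limit, keeps it out of \<open>C\<close> when \<open>w\<close> is not in \<open>C\<close>.\<close>

definition pulled_back :: "(nat \<Rightarrow> 'a \<Rightarrow>\<^sub>L 'a) \<Rightarrow> ('a \<Rightarrow>\<^sub>L 'a) \<Rightarrow> 'a \<Rightarrow> 'a \<Rightarrow> bool"
  where "pulled_back A T w w' \<longleftrightarrow> w' \<in> closure C \<and> blinfun_apply T w' = w \<and>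
    (\<exists>u r. strict_mono r \<and> (\<forall>n. blinfun_apply (A (r n)) (u n) = w) \<and> u \<longlonglongrightarrow> w')"

text \<open>The approximants \<open>e + c / n = A\<^sub>n k\<^sub>n\<close> are bounded, hence so are the \<open>A\<^sub>n\<close>. As \<open>T q = e\<close> for
  the limit \<open>q \<in> C\<close> of the \<open>k\<^sub>n\<close> and every vector of \<open>C\<close> is comparable to \<open>q\<close>, the image of \<open>C\<close> is
  contained in the open face of \<open>e\<close>.
  Conversely, if \<open>w\<close> is bounded by a multiple of \<open>e\<close>, then \<open>A\<^sub>n\<^sup>-\<^sup>1 w\<close> is bounded by a
  multiple of \<open>k\<^sub>n\<close>, so it has a limit point, which \<open>T\<close> maps to \<open>w\<close>. The kernel vector is the limit of
  \<open>A\<^sub>n\<^sup>-\<^sup>1 (c / n)\<close>; it is nonzero because \<open>A\<^sub>n\<^sup>-\<^sup>1 e\<close> stays outside \<open>C\<close> and \<open>q\<close> is in \<open>C\<close>.\<close>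

lemma radial_limit:
  assumes e: "e \<in> closure C"
  obtains A T where "\<And>n. A n \<in> cone_aut" "A \<longlonglongrightarrow> T" "blinfun_apply T ` C = open_face e"
    "\<And>w s. w \<in> closure C \<Longrightarrow> 0 < s \<Longrightarrow> e - s *\<^sub>R w \<in> closure C \<Longrightarrow> \<exists>w'. pulled_back A T w w'"
    "e \<notin> C \<Longrightarrow> \<exists>v\<in>closure C. v \<noteq> 0 \<and> blinfun_apply T v = 0"
proof -
  obtain c where c: "c \<in> C" using C_nonempty by blast
  define p0 where "p0 n = e + (1 / real (Suc n)) *\<^sub>R c" for n
  have t0: "(\<lambda>n. 1 / real (Suc n)) \<longlonglongrightarrow> 0" by (intro LIMSEQ_Suc lim_1_over_n)
  have p0C: "p0 n \<in> C" for n
    using add_C_cl[OF scale_C[OF c, of "1 / real (Suc n)"] e] by (simp add: p0_def add.commute)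
  have p0lim: "p0 \<longlonglongrightarrow> e"
    unfolding p0_def using tendsto_add[OF tendsto_const[of e] tendsto_scaleR[OF t0 tendsto_const[of c]]]
    by simp
  obtain A0 k0 where A0: "\<And>n. A0 n \<in> cone_aut" and k0: "\<And>n. k0 n \<in> K"
    and A0k0: "\<And>n. p0 n = blinfun_apply (A0 n) (k0 n)"
    using cocompact[OF p0C] by metis
  have "f (blinfun_apply (A0 n) (k0 n)) \<le> f e + f c" for n
  proof -
    have "(1 / real (Suc n)) * f c \<le> 1 * f c"
      using f_nonneg[OF C_in_cl[OF c]] by (intro mult_right_mono) auto
    then show ?thesis
      unfolding A0k0[symmetric] p0_def
      by (simp add: linear_add[OF linear_f] linear_cmul[OF linear_f])
  qed
  then obtain r T q where r: "strict_mono r" and AT: "(A0 \<circ> r) \<longlonglongrightarrow> T" and kq: "(k0 \<circ> r) \<longlonglongrightarrow> q"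
    and qK: "q \<in> K"
    using convergent_subsequence[of A0 k0] aut_C[OF A0] C_in_cl k0 by metis
  define A k t where "A = A0 \<circ> r" and "k = k0 \<circ> r" and "t n = 1 / real (Suc (r n))" for n
  have A: "A n \<in> cone_aut" for n using A0 by (simp add: A_def)
  have t: "0 < t n" for n by (simp add: t_def)
  have Ak: "A n (k n) = e + t n *\<^sub>R c" for n
    using A0k0 by (simp add: A_def k_def t_def p0_def)
  have AT: "A \<longlonglongrightarrow> T" and kq: "k \<longlonglongrightarrow> q" using AT kq by (auto simp: A_def k_def)
  have qC: "q \<in> C" using qK K_C by blast
  have Tcl: "T v \<in> closure C" if "v \<in> closure C" for v
    using cl_limit[of "\<lambda>n. A n v"] aut_cl[OF A that] blinfun.tendsto[OF AT tendsto_const] by blast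
  have Tq: "T q = e"
  proof -
    have "(\<lambda>n. A n (k n)) \<longlonglongrightarrow> T q" by (rule blinfun.tendsto[OF AT kq])
    moreover have "(\<lambda>n. A n (k n)) \<longlonglongrightarrow> e"
      using LIMSEQ_subseq_LIMSEQ[OF p0lim r] A0k0 by (simp add: A_def k_def o_def)
    ultimately show ?thesis by (rule LIMSEQ_unique)
  qed
  obtain M where M: "0 < M" "\<And>v. v \<in> closure C \<Longrightarrow> norm v \<le> M * f v" using norm_bound by blast
  have "compact (f ` K)"
    using compact_K linear_f linear_continuous_on linear_conv_bounded_linear
    by (blast intro: compact_continuous_image)
  then obtain F where "\<forall>y\<in>f ` K. norm y \<le> F" using compact_imp_bounded bounded_iff by metis
  then have F: "f x \<le> F" if "x \<in> K" for x using that by force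
  have pull: "\<exists>w'. pulled_back A T w w'"
    if w: "w \<in> closure C" "0 < s" "e - s *\<^sub>R w \<in> closure C" for w s
  proof -
    have "\<exists>u. u \<in> closure C \<and> A n u = w \<and> k n - s *\<^sub>R u \<in> closure C" for n
    proof -
      obtain B where B: "B \<in> cone_aut" "\<And>v. B (A n v) = v" "\<And>v. A n (B v) = v"
        using aut_inverse[OF A] by blast
      have "(e - s *\<^sub>R w) + t n *\<^sub>R c \<in> closure C"
        using cl_add[OF w(3) C_in_cl[OF scale_C[OF c t]]] .
      then have "B ((e - s *\<^sub>R w) + t n *\<^sub>R c) \<in> closure C" by (rule aut_cl[OF B(1)])
      also have "(e - s *\<^sub>R w) + t n *\<^sub>R c = A n (k n) - s *\<^sub>R w" by (simp add: Ak)
      also have "B \<dots> = k n - s *\<^sub>R B w" by (simp add: blinfun.diff_right blinfun.scaleR_right B)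
      finally show ?thesis using aut_cl[OF B(1) w(1)] B(3) by blast
    qed
    then obtain u where u: "\<And>n. u n \<in> closure C" "\<And>n. A n (u n) = w"
      "\<And>n. k n - s *\<^sub>R u n \<in> closure C" by metis
    have "norm (u n) \<le> M * (F / s)" for n
    proof -
      have "0 \<le> f (k n - s *\<^sub>R u n)" by (rule f_nonneg[OF u(3)])
      then have "s * f (u n) \<le> F"
        using F[of "k n"] k0 by (simp add: linear_diff[OF linear_f] linear_cmul[OF linear_f] k_def)
      then have "f (u n) \<le> F / s" using w(2) by (simp add: field_simps)
      then have "M * f (u n) \<le> M * (F / s)" using M(1) by (intro mult_left_mono) auto
      then show ?thesis using M(2)[OF u(1)[of n]] by linarith
    qed
    then have "bounded (range u)" by (auto simp: bounded_iff)
    then obtain l w' where l: "strict_mono (l :: nat \<Rightarrow> nat)" "(u \<circ> l) \<longlonglongrightarrow> w'"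
      using bounded_imp_convergent_subsequence by blast
    have w'cl: "w' \<in> closure C" using cl_limit[OF _ l(2)] u(1) by simp
    have "(\<lambda>n. A (l n) (u (l n))) \<longlonglongrightarrow> T w'"
      using blinfun.tendsto[OF LIMSEQ_subseq_LIMSEQ[OF AT l(1)] l(2)] by (simp add: o_def)
    then have "T w' = w" using u(2) by (simp add: LIMSEQ_const_iff)
    then show ?thesis using l u(2) w'cl unfolding pulled_back_def
      by (intro exI[of _ w'] conjI exI[of _ "u \<circ> l"] exI[of _ l]) auto
  qed
  show ?thesis
  proof
    show "A n \<in> cone_aut" for n by (rule A)
    show "A \<longlonglongrightarrow> T" by (rule AT)
    show "T ` C = open_face e"
    proof (intro subset_antisym subsetI)
      fix z assume "z \<in> T ` C"
      then obtain x where x: "x \<in> C" "z = T x" by blast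
      obtain s where s: "0 < s" "q - s *\<^sub>R x \<in> C" using sub_small_C[OF qC] by blast
      obtain t where t: "0 < t" "x - t *\<^sub>R q \<in> C" using sub_small_C[OF x(1)] by blast
      have "e - s *\<^sub>R z \<in> closure C" "z - t *\<^sub>R e \<in> closure C"
        using Tcl[OF C_in_cl[OF s(2)]] Tcl[OF C_in_cl[OF t(2)]]
        by (simp_all add: blinfun.diff_right blinfun.scaleR_right Tq x)
      then show "z \<in> open_face e"
        using s(1) t(1) Tcl[OF C_in_cl[OF x(1)]] x(2) unfolding open_face_def by blast
    next
      fix z assume "z \<in> open_face e"
      then obtain s t where z: "z \<in> closure C" "0 < s" "e - s *\<^sub>R z \<in> closure C" "0 < t"
        "z - t *\<^sub>R e \<in> closure C" by (auto simp: open_face_def)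
      have "e - s *\<^sub>R (z - t *\<^sub>R e) = (e - s *\<^sub>R z) + (s * t) *\<^sub>R e" by (simp add: algebra_simps)
      also have "\<dots> \<in> closure C" using z e by (intro cl_add cl_scale) auto
      finally obtain w' where w': "w' \<in> closure C" "T w' = z - t *\<^sub>R e"
        using pull z unfolding pulled_back_def by blast
      have "t *\<^sub>R q + w' \<in> C" using scale_C qC z w' add_C_cl by blast
      moreover have "T (t *\<^sub>R q + w') = z"
        by (simp add: blinfun.add_right blinfun.scaleR_right Tq w')
      ultimately show "z \<in> T ` C" by (metis image_eqI)
    qed
    show "\<exists>v\<in>closure C. v \<noteq> 0 \<and> T v = 0" if "e \<notin> C"
    proof -
      have "e - 1 *\<^sub>R e \<in> closure C" using zero_cl by simp
      then obtain e' u l where l: "strict_mono (l :: nat \<Rightarrow> nat)" and u: "\<And>n. A (l n) (u n) = e"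
        and ue: "u \<longlonglongrightarrow> e'" "e' \<in> closure C" "T e' = e"
        using pull[OF e, of 1] by (auto simp: pulled_back_def)
      have "u n \<notin> C" for n using u[of n] aut_C[OF A] that by metis
      then have "e' \<notin> C" using not_C_limit ue by blast
      then have "q - e' \<noteq> 0" using qC by auto
      moreover have "q - e' \<in> closure C"
      proof (rule cl_limit)
        show "(\<lambda>n. k (l n) - u n) \<longlonglongrightarrow> q - e'"
          using tendsto_diff[OF LIMSEQ_subseq_LIMSEQ[OF kq l] ue(1)] by (simp add: o_def)
        fix n
        have "A (l n) (k (l n) - u n) = t (l n) *\<^sub>R c"
          by (simp add: blinfun.diff_right Ak u)
        then show "k (l n) - u n \<in> closure C"
          using aut_C[OF A] scale_C[OF c t] C_in_cl by metis
      qed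
      moreover have "T (q - e') = 0" by (simp add: blinfun.diff_right Tq ue)
      ultimately show ?thesis by blast
    qed
  qed (use pull in blast)
qed

end

section \<open>Extreme rays and attracting fixed points\<close>

context cocompact_cone
begin

text \<open>The radial limit at \<open>x\<close> has rank one, \<open>T v = (g1 \<bullet> v) x\<close>, but its kernel may contain \<open>x\<close>. The
  preimages of \<open>x\<close> under the approximating automorphisms have a limit point \<open>w'\<close> with \<open>T w' = x\<close>, so one
  of these preimages is outside the kernel, and composing with the corresponding inverse \<open>B\<close> moves
  the kernel off \<open>x\<close>.\<close>

theorem attracting_fixpoint_near_extreme:
  assumes x: "extreme x" and W: "open W" "line x \<in> W"
  shows "\<exists>A\<in>cone_aut. \<exists>y\<in>W. attracting_fixpoint (pgl_class A) y"
proof -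
  have x0: "x \<noteq> 0" using extreme_nz[OF x] .
  obtain A T where A: "\<And>n. A n \<in> cone_aut" "A \<longlonglongrightarrow> T" and T: "blinfun_apply T ` C = open_face x"
    and pull: "\<And>w s. w \<in> closure C \<Longrightarrow> 0 < s \<Longrightarrow> x - s *\<^sub>R w \<in> closure C \<Longrightarrow> \<exists>w'. pulled_back A T w w'"
    using radial_limit[OF extreme_cl[OF x]] by metis
  have TC: "\<exists>r. T c = r *\<^sub>R x" if "c \<in> C" for c
  proof -
    have "T c \<in> open_face x" using T that by blast
    then show ?thesis unfolding open_face_def using extreme_below[OF x] by blast
  qed
  have T1: "\<exists>r. T v = r *\<^sub>R x" for v
  proof -
    obtain c where c: "c \<in> C" using C_nonempty by blast
    obtain t where t: "0 < t" "c - t *\<^sub>R v \<in> C" using sub_small_C[OF c] by blast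
    obtain r1 r2 where "T c = r1 *\<^sub>R x" "T (c - t *\<^sub>R v) = r2 *\<^sub>R x" using TC c t(2) by blast
    then have "t *\<^sub>R T v = (r1 - r2) *\<^sub>R x"
      by (simp add: blinfun.diff_right blinfun.scaleR_right scaleR_diff_left algebra_simps)
    then have "T v = ((r1 - r2) / t) *\<^sub>R x"
      using t(1) by (metis divide_inverse_commute less_irrefl scaleR_one scaleR_scaleR left_inverse)
    then show ?thesis by blast
  qed
  define g1 where "g1 = adjoint (blinfun_apply T) x /\<^sub>R (x \<bullet> x)"
  have Tg: "T v = (g1 \<bullet> v) *\<^sub>R x" for v
  proof -
    obtain r where r: "T v = r *\<^sub>R x" using T1 by blast
    have "g1 \<bullet> v = (T v \<bullet> x) / (x \<bullet> x)"
      using adjoint_works[OF linear_blinfun_apply, of v T x] by (simp add: g1_def inner_commute divide_inverse_commute)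
    then show ?thesis using r x0 by simp
  qed
  have "x - 1 *\<^sub>R x \<in> closure C" using zero_cl by simp
  then obtain w' u r where u: "\<And>n. A (r n) (u n) = x" "u \<longlonglongrightarrow> w'" "T w' = x"
    using pull[OF extreme_cl[OF x], of 1] by (auto simp: pulled_back_def)
  have "g1 \<bullet> w' = 1" using u(3) x0 by (metis Tg scaleR_cancel_right scaleR_one)
  then have "(\<lambda>n. g1 \<bullet> u n) \<longlonglongrightarrow> 1" using tendsto_inner[OF tendsto_const[of g1] u(2)] by simp
  then have "\<forall>\<^sub>F n in sequentially. 0 < g1 \<bullet> u n" by (rule order_tendstoD) simp
  then obtain s where s: "0 < g1 \<bullet> u s" by (auto simp: eventually_sequentially)
  obtain B where B: "B \<in> cone_aut" "\<And>v. B (A (r s) v) = v" using aut_inverse[OF A(1)] by metis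
  have Bx: "B x = u s" using B(2)[of "u s"] u(1) by simp
  define \<kappa> where "\<kappa> = g1 \<bullet> u s"
  define g where "g = adjoint (blinfun_apply B) g1 /\<^sub>R \<kappa>"
  have g: "g \<bullet> v = (g1 \<bullet> B v) / \<kappa>" for v
    using adjoint_works[OF linear_blinfun_apply, of v B g1] by (simp add: g_def inner_commute divide_inverse_commute)
  have "\<exists>n. \<exists>y\<in>W. attracting_fixpoint (pgl_class (A n o\<^sub>L B)) y"
  proof (rule attracting_fixpoint_near_rank_one[where P = "T o\<^sub>L B" and \<kappa> = \<kappa> and g = g and x = x])
    show "(\<lambda>n. A n o\<^sub>L B) \<longlonglongrightarrow> (T o\<^sub>L B)"
      by (rule bounded_bilinear.tendsto[OF bounded_bilinear_blinfun_compose A(2) tendsto_const])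
    show "bij (blinfun_apply (A n o\<^sub>L B))" for n
      using aut_compose[OF A(1) B(1)] by (simp add: cone_aut_def)
    show "(T o\<^sub>L B) v = (\<kappa> * (g \<bullet> v)) *\<^sub>R x" for v using s by (simp add: Tg g \<kappa>_def)
    show "g \<bullet> x = 1" using s by (simp add: g Bx \<kappa>_def)
    show "\<kappa> \<noteq> 0" using s by (simp add: \<kappa>_def)
  qed (use W in auto)
  then show ?thesis using aut_compose[OF A(1) B(1)] by blast
qed

end

section \<open>Density of the extreme rays\<close>

text \<open>A countable form of Zorn's lemma: a chain of sets of naturals is exhausted, up to any finite
  stage, by one of its members, so closure under sequential limits yields upper bounds of chains.\<close>

lemma maximal_set_of_naturals:
  fixes \<A> :: "nat set set"
  assumes ne: "\<A> \<noteq> {}"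
    and lim: "\<And>a. (\<And>i. a i \<in> \<A>) \<Longrightarrow> \<exists>b\<in>\<A>. \<forall>j. (\<forall>i\<ge>j. j \<in> a i) \<longrightarrow> j \<in> b"
  shows "\<exists>M\<in>\<A>. \<forall>X\<in>\<A>. M \<subseteq> X \<longrightarrow> X = M"
proof (rule subset_Zorn)
  fix \<C> assume ch: "subset.chain \<A> \<C>"
  show "\<exists>U\<in>\<A>. \<forall>X\<in>\<C>. X \<subseteq> U"
  proof (cases "\<C> = {}")
    case False
    have "\<exists>Y\<in>\<C>. \<Union>\<C> \<inter> {..i} \<subseteq> Y" for i
      using finite_subset_Union_chain[OF _ _ False ch, of "\<Union>\<C> \<inter> {..i}"] by (metis Int_lower1 finite_Int finite_atMost)
    then obtain a where a: "\<And>i. a i \<in> \<C>" "\<And>i. \<Union>\<C> \<inter> {..i} \<subseteq> a i" by metis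
    then have "a i \<in> \<A>" for i using ch by (auto simp: subset_chain_def)
    then obtain b where b: "b \<in> \<A>" "\<And>j. (\<forall>i\<ge>j. j \<in> a i) \<Longrightarrow> j \<in> b" using lim by meson
    have "\<Union>\<C> \<subseteq> b"
    proof
      fix j assume "j \<in> \<Union>\<C>"
      then have "j \<in> a i" if "j \<le> i" for i using subsetD[OF a(2)[of i], of j] that by simp
      then show "j \<in> b" using b(2) by blast
    qed
    then show ?thesis using b(1) by blast
  qed (use ne in auto)
qed

context pointed_cone
begin

text \<open>Strong extremality in linear terms: the interior of the segment from \<open>x\<close> to any other boundary
  ray runs through \<open>C\<close>.\<close>

definition visible :: "'a \<Rightarrow> bool"
  where "visible x \<longleftrightarrow> x \<in> closure C \<and> x \<noteq> 0 \<and> x \<notin> C \<and>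
    (\<forall>y\<in>closure C. y \<noteq> 0 \<longrightarrow> y \<notin> C \<longrightarrow> (\<forall>s. y \<noteq> s *\<^sub>R x) \<longrightarrow> x + y \<in> C)"

text \<open>If \<open>a + b = x\<close> with \<open>a\<close> not on the ray of \<open>x\<close>, then \<open>x + a \<in> C\<close>, and adding \<open>b\<close> gives \<open>2 x \<in> C\<close>.\<close>

lemma visible_extreme:
  assumes x: "visible x"
  shows "extreme x"
  unfolding extreme_def
proof (intro conjI ballI impI)
  fix a b assume ab: "a \<in> closure C" "b \<in> closure C" "a + b = x"
  show "\<exists>s. a = s *\<^sub>R x"
  proof (rule ccontr)
    assume no: "\<nexists>s. a = s *\<^sub>R x"
    have "a \<notin> C" using ab x add_C_cl[of a b] by (auto simp: visible_def)
    moreover have "a \<noteq> 0" using no by (metis scaleR_zero_left)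
    ultimately have "x + a \<in> C" using x ab no unfolding visible_def by blast
    then have "(x + a) + b \<in> C" using ab add_C_cl by blast
    also have "(x + a) + b = 2 *\<^sub>R x" using ab by (simp add: scaleR_2 add.assoc)
    finally have "(1/2) *\<^sub>R (2 *\<^sub>R x) \<in> C" using scale_C by (meson half_gt_zero_iff zero_less_one)
    then show False using x by (simp add: visible_def)
  qed
qed (use x in \<open>auto simp: visible_def\<close>)

text \<open>A region of the boundary without extreme rays leaves such a trace in the radial limits at its
  points; the ball of radius \<open>d\<close> around \<open>c\<close> is the gap.\<close>

definition gapped :: "('a \<Rightarrow>\<^sub>L 'a) \<Rightarrow> 'a \<Rightarrow> real \<Rightarrow> bool"
  where "gapped T c d \<longleftrightarrow> (\<forall>v\<in>C. blinfun_apply T v \<in> closure C) \<and> c \<in> blinfun_apply T ` C \<and> 0 < d \<and>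
    (\<forall>x. extreme x \<longrightarrow> blinfun_apply T x \<notin> ball c d)"

lemma gapped_cl: "gapped T c d \<Longrightarrow> v \<in> closure C \<Longrightarrow> blinfun_apply T v \<in> closure C"
  using cl_map unfolding gapped_def by blast

lemma gapped_center:
  assumes "gapped T c d"
  shows "\<And>x. extreme x \<Longrightarrow> blinfun_apply T x \<noteq> c"
  using assms by (auto simp: gapped_def)

lemma gapped_center_nonzero:
  assumes g: "gapped T c d" and x: "extreme x"
  shows "c \<noteq> 0"
proof
  assume c: "c = 0"
  define t where "t = d / (norm (T x) + 1)"
  have d: "0 < d" using g by (simp add: gapped_def)
  have p: "norm (T x) + 1 > 0" by (simp add: add_nonneg_pos)
  have t: "0 < t" using d p by (simp add: t_def)
  have "norm (T (t *\<^sub>R x)) = t * norm (T x)" using t by (simp add: blinfun.scaleR_right)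
  also have "\<dots> < d" using d p unfolding t_def by (simp add: field_simps)
  finally have "T (t *\<^sub>R x) \<in> ball c d" by (simp add: c)
  then show False using g extreme_scale[OF x t] unfolding gapped_def by blast
qed

lemma gapped_aut:
  assumes g: "gapped T c d" and A: "A \<in> cone_aut"
  shows "gapped (T o\<^sub>L A) c d"
proof -
  have "blinfun_apply (T o\<^sub>L A) ` C = T ` A ` C" by (simp add: image_image)
  then have "blinfun_apply (T o\<^sub>L A) ` C = T ` C" using A by (simp add: cone_aut_def)
  then show ?thesis using g A extreme_aut[OF _ A] aut_C[OF A] unfolding gapped_def by simp
qed

lemma gapped_limit:
  assumes g: "\<And>n. gapped (T n) c d" and T: "T \<longlonglongrightarrow> T'"
    and k: "k \<longlonglongrightarrow> q" "q \<in> C" "\<And>n. blinfun_apply (T n) (k n) = c"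
  shows "gapped T' c d"
  unfolding gapped_def
proof (intro conjI allI impI ballI)
  fix v assume "v \<in> C"
  then show "T' v \<in> closure C"
    using cl_limit[of "\<lambda>n. T n v"] g blinfun.tendsto[OF T tendsto_const] unfolding gapped_def by blast
next
  have "(\<lambda>n. T n (k n)) \<longlonglongrightarrow> T' q" by (rule blinfun.tendsto[OF T k(1)])
  then have "T' q = c" using k(3) by (simp add: LIMSEQ_const_iff)
  then show "c \<in> T' ` C" using k(2) by blast
next
  show "0 < d" using g unfolding gapped_def by blast
next
  fix x assume x: "extreme x"
  show "T' x \<notin> ball c d"
  proof
    assume "T' x \<in> ball c d"
    then have "\<forall>\<^sub>F n in sequentially. T n x \<in> ball c d"
      using blinfun.tendsto[OF T tendsto_const] topological_tendstoD open_ball by blast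
    then show False using g x unfolding gapped_def by (simp add: eventually_sequentially) blast
  qed
qed

text \<open>The automorphisms approximating \<open>S\<close> permute the extreme rays, so \<open>T\<close> composed with each of them
  misses the ball, which is open; hence the limit misses it, too.\<close>

lemma gapped_radial:
  assumes cl: "\<And>v. v \<in> closure C \<Longrightarrow> blinfun_apply T v \<in> closure C"
    and d: "0 < d" "\<And>x. extreme x \<Longrightarrow> blinfun_apply T x \<notin> ball c d"
    and A: "\<And>n. A n \<in> cone_aut" "A \<longlonglongrightarrow> S"
    and S: "blinfun_apply S ` C = open_face e" and e: "e \<in> closure C" "blinfun_apply T e = c"
  shows "gapped (T o\<^sub>L S) c d"
  unfolding gapped_def
proof (intro conjI allI impI ballI)
  fix v assume "v \<in> C"
  then have "S v \<in> closure C" using S open_face_cl by blast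
  then show "(T o\<^sub>L S) v \<in> closure C" using cl by simp
next
  obtain c' where "c' \<in> C" "S c' = e" using open_face_self[OF e(1)] S by (metis imageE)
  then show "c \<in> (T o\<^sub>L S) ` C" using e(2) by (metis blinfun_apply_blinfun_compose image_eqI)
next
  show "0 < d" by (rule d)
next
  fix x assume x: "extreme x"
  have lim: "(\<lambda>n. T (A n x)) \<longlonglongrightarrow> T (S x)"
    by (intro blinfun.tendsto[OF tendsto_const] blinfun.tendsto[OF A(2) tendsto_const])
  show "(T o\<^sub>L S) x \<notin> ball c d"
  proof
    assume "(T o\<^sub>L S) x \<in> ball c d"
    then have "\<forall>\<^sub>F n in sequentially. T (A n x) \<in> ball c d"
      using topological_tendstoD[OF lim open_ball] by simp
    then obtain n where "T (A n x) \<in> ball c d" by (auto simp: eventually_sequentially)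
    then show False using d(2)[OF extreme_aut[OF x A(1)]] by blast
  qed
qed

text \<open>The dual cone of \<open>T C\<close>. The image \<open>T C\<close> shrinks when the dual grows, and duals behave well
  under limits: a form that is nonnegative on the images along a sequence is nonnegative on the
  limit image.\<close>

definition dual :: "('a \<Rightarrow>\<^sub>L 'a) \<Rightarrow> 'a set"
  where "dual T = {l. \<forall>v\<in>C. 0 \<le> l \<bullet> blinfun_apply T v}"

lemma dual_cl:
  assumes "l \<in> dual T" "v \<in> closure C"
  shows "0 \<le> l \<bullet> blinfun_apply T v"
proof -
  obtain x where x: "\<And>n. x n \<in> C" "x \<longlonglongrightarrow> v" using assms(2) closure_sequential by blast
  have "(\<lambda>n. l \<bullet> T (x n)) \<longlonglongrightarrow> l \<bullet> T v" by (intro tendsto_intros x)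
  then show ?thesis using assms(1) x(1) unfolding dual_def by (intro LIMSEQ_le_const) auto
qed

lemma cone_separation:
  fixes S :: "'a set"
  assumes S: "convex S" "S \<noteq> {}" "\<And>x t. x \<in> S \<Longrightarrow> 0 < t \<Longrightarrow> t *\<^sub>R x \<in> S" and z: "z \<notin> S"
    and W: "subspace W" "z \<in> W" "S \<subseteq> W"
  obtains a where "a \<in> W" "a \<noteq> 0" "a \<bullet> z \<le> 0" "\<And>x. x \<in> S \<Longrightarrow> 0 \<le> a \<bullet> x"
proof -
  obtain a b where ab: "z + a \<in> affine hull (insert z S)" "a \<noteq> 0" "a \<bullet> z \<le> b"
    "\<And>x. x \<in> S \<Longrightarrow> b \<le> a \<bullet> x"
    using separating_hyperplane_set_point_inaff[OF S(1,2) z] by metis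
  have "affine hull (insert z S) \<subseteq> W"
    using W subspace_imp_affine by (intro hull_minimal) auto
  then have "z + a \<in> W" using ab(1) by blast
  then have aW: "a \<in> W" using subspace_diff[OF W(1) _ W(2), of "z + a"] by simp
  have *: "b \<le> t * (a \<bullet> x)" if "x \<in> S" "0 < t" for x t using ab(4) S(3)[OF that] by fastforce
  have "b \<le> 0"
  proof (rule ccontr)
    assume b: "\<not> b \<le> 0"
    obtain x where x: "x \<in> S" using S(2) by blast
    have "b \<le> a \<bullet> x" using *[OF x, of 1] by simp
    then have "b \<le> (b / 2 / (a \<bullet> x)) * (a \<bullet> x)" using b by (intro *[OF x]) auto
    then show False using b \<open>b \<le> a \<bullet> x\<close> by simp
  qed
  moreover have "0 \<le> a \<bullet> x" if x: "x \<in> S" for x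
  proof (rule ccontr)
    assume n: "\<not> 0 \<le> a \<bullet> x"
    then have "0 < (b - 1) / (a \<bullet> x)" using \<open>b \<le> 0\<close> by (simp add: divide_neg_neg)
    then have "b \<le> ((b - 1) / (a \<bullet> x)) * (a \<bullet> x)" by (rule *[OF x])
    then show False using n by simp
  qed
  moreover have "a \<bullet> z \<le> 0" using ab(3) \<open>b \<le> 0\<close> by linarith
  ultimately show ?thesis using that aW ab(2) by blast
qed

lemma image_C_cone:
  fixes T :: "'a \<Rightarrow>\<^sub>L 'a"
  shows "convex (blinfun_apply T ` C)" and "blinfun_apply T ` C \<noteq> {}"
    and "\<And>x t. x \<in> blinfun_apply T ` C \<Longrightarrow> 0 < t \<Longrightarrow> t *\<^sub>R x \<in> blinfun_apply T ` C"
proof -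
  show "convex (blinfun_apply T ` C)"
    by (rule convex_linear_image[OF linear_blinfun_apply convex_C])
  show "t *\<^sub>R x \<in> blinfun_apply T ` C" if x: "x \<in> blinfun_apply T ` C" "0 < t" for x t
  proof -
    obtain c where "c \<in> C" "x = T c" using x(1) by blast
    then have "t *\<^sub>R x = T (t *\<^sub>R c)" "t *\<^sub>R c \<in> C"
      using scale_C x(2) by (auto simp: blinfun.scaleR_right)
    then show ?thesis by blast
  qed
qed (use C_nonempty in auto)

lemma subspace_range_blinfun:
  fixes T :: "'a \<Rightarrow>\<^sub>L 'a"
  shows "subspace (range (blinfun_apply T))"
  by (rule linear_subspace_image[OF linear_blinfun_apply subspace_UNIV])

text \<open>A form \<open>a\<close> separates \<open>z\<close> from \<open>S C\<close> inside the common range, and is negative at a vector of \<open>T C\<close>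
  slightly beyond \<open>z\<close>. Adding a small multiple of the form \<open>f\<close>, which is positive on the closed cone,
  makes it strictly positive on \<open>S C\<close> away from \<open>0\<close>, so that it may be perturbed. An open set of
  such forms can be detected by a countable dense set.\<close>

lemma dual_separation:
  assumes S: "\<And>v. v \<in> C \<Longrightarrow> blinfun_apply S v \<in> closure C"
    and r: "range (blinfun_apply S) = range (blinfun_apply T)"
    and z: "z \<in> blinfun_apply T ` C" "z \<notin> blinfun_apply S ` C"
  obtains l \<delta> where "0 < \<delta>" "ball l \<delta> \<subseteq> dual S - dual T"
proof -
  let ?W = "range (blinfun_apply T)"
  have zW: "z \<in> ?W" using z(1) by auto
  have SW: "blinfun_apply S ` C \<subseteq> ?W" unfolding r[symmetric] by auto
  obtain a where a: "a \<in> ?W" "a \<noteq> 0" "a \<bullet> z \<le> 0" "\<And>x. x \<in> blinfun_apply S ` C \<Longrightarrow> 0 \<le> a \<bullet> x"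
    by (rule cone_separation[OF image_C_cone(1,2)[of S] image_C_cone(3) z(2) subspace_range_blinfun[of T] zW SW]) auto
  obtain p where p: "p \<in> C" "z = T p" using z by blast
  obtain w where w: "a = T w" using a by blast
  obtain t where t: "0 < t" "p - t *\<^sub>R w \<in> C" using sub_small_C[OF p(1)] by blast
  define z1 where "z1 = T (p - t *\<^sub>R w)"
  have "z1 = z - t *\<^sub>R a" by (simp add: z1_def p w blinfun.diff_right blinfun.scaleR_right)
  then have "a \<bullet> z1 = a \<bullet> z - t * (a \<bullet> a)" by (simp add: inner_diff_right)
  moreover have "0 < t * (a \<bullet> a)" using t a by simp
  ultimately have az1: "a \<bullet> z1 < 0" using a(3) by linarith
  define g where "g = adjoint f 1"
  have g: "g \<bullet> v = f v" for v
    using adjoint_works[OF linear_f, of v 1] by (simp add: g_def inner_commute)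
  obtain M where M: "0 < M" "\<And>v. v \<in> closure C \<Longrightarrow> norm v \<le> M * f v" using norm_bound by blast
  obtain D where D: "0 < D" "f z1 \<le> D" using that[of "\<bar>f z1\<bar> + 1"] by auto
  define \<tau> where "\<tau> = - (a \<bullet> z1) / 2 / D"
  have \<tau>: "0 < \<tau>" unfolding \<tau>_def using az1 D by (intro divide_pos_pos) auto
  have "\<tau> * f z1 \<le> \<tau> * D" using \<tau> D by (intro mult_left_mono) auto
  also have "\<dots> = - (a \<bullet> z1) / 2" using D by (simp add: \<tau>_def)
  finally have tf: "\<tau> * f z1 \<le> - (a \<bullet> z1) / 2" .
  define l where "l = a + \<tau> *\<^sub>R g"
  have lz1: "l \<bullet> z1 < 0" using tf az1 by (simp add: l_def inner_add_left g)
  obtain E where E: "0 < E" "norm z1 \<le> E" using that[of "norm z1 + 1"] by (auto simp: add_nonneg_pos)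
  define \<delta> where "\<delta> = min (\<tau> / M) (- (l \<bullet> z1) / E)"
  have \<delta>: "0 < \<delta>" unfolding \<delta>_def using \<tau> M(1) lz1 E by (simp add: divide_neg_pos)
  have "l' \<in> dual S - dual T" if l': "l' \<in> ball l \<delta>" for l'
  proof -
    have n: "norm (l' - l) < \<delta>" using l' by (simp add: dist_norm norm_minus_commute)
    have "0 \<le> l' \<bullet> S v" if v: "v \<in> C" for v
    proof -
      have "\<bar>(l' - l) \<bullet> S v\<bar> \<le> norm (l' - l) * norm (S v)" by (rule Cauchy_Schwarz_ineq2)
      also have "\<dots> \<le> (\<tau> / M) * (M * f (S v))"
        using n M(2)[OF S[OF v]] \<tau> M(1) by (intro mult_mono) (auto simp: \<delta>_def)
      also have "\<dots> = \<tau> * f (S v)" using M by simp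
      finally have "\<bar>(l' - l) \<bullet> S v\<bar> \<le> \<tau> * f (S v)" .
      moreover have "0 \<le> a \<bullet> S v" using a(4) v by blast
      moreover have "l' \<bullet> S v = (l' - l) \<bullet> S v + a \<bullet> S v + \<tau> * f (S v)"
        by (simp add: l_def inner_diff_left inner_add_left g)
      ultimately show ?thesis by linarith
    qed
    have "l' \<bullet> z1 < 0"
    proof -
      have "(l' - l) \<bullet> z1 \<le> norm (l' - l) * norm z1" by (rule norm_cauchy_schwarz)
      also have "\<dots> \<le> norm (l' - l) * E" using E by (intro mult_left_mono) auto
      also have "\<dots> < \<delta> * E" using n E by simp
      also have "\<dots> \<le> (- (l \<bullet> z1) / E) * E"
        using E by (intro mult_right_mono) (auto simp: \<delta>_def)
      also have "\<dots> = - (l \<bullet> z1)" using E by simp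
      finally show ?thesis by (simp add: inner_diff_left)
    qed
    then have "l' \<notin> dual T" using t(2) unfolding dual_def z1_def by (metis (no_types, lifting) mem_Collect_eq not_le)
    moreover have "l' \<in> dual S" using \<open>\<And>v. v \<in> C \<Longrightarrow> 0 \<le> l' \<bullet> S v\<close> by (simp add: dual_def)
    ultimately show ?thesis by blast
  qed
  then show ?thesis using that[OF \<delta>] by blast
qed


text \<open>Let \<open>L\<close> be the preimage of the line through \<open>T x\<close>. A hyperplane of \<open>L\<close> that supports \<open>C \<inter> L\<close> at \<open>x\<close>
  meets the closed cone only in the ray of \<open>x\<close>, as \<open>x\<close> is visible; it is the kernel of a form \<open>a\<close> that is
  positive on the rest of the slice, in particular on the part of the closed cone in the kernel of
  \<open>T\<close>. Hence \<open>a\<close> attains its minimum on the fibre over \<open>c\<close>, at some \<open>e\<close>. If \<open>y\<close> in the open face of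
  \<open>e\<close> had the same image as \<open>x\<close>, then \<open>e - s y + s x\<close> would be a better point of the fibre.\<close>

lemma open_face_missing:
  assumes g: "gapped T c d" and x: "visible x" and Tx: "blinfun_apply T x \<in> blinfun_apply T ` C"
  obtains e where "e \<in> closure C" "blinfun_apply T e = c"
    "blinfun_apply T x \<notin> blinfun_apply T ` open_face e"
proof -
  have xe: "extreme x" using visible_extreme[OF x] .
  have c0: "c \<noteq> 0" using gapped_center_nonzero[OF g xe] .
  have xcl: "x \<in> closure C" and x0: "x \<noteq> 0" and xC: "x \<notin> C" using x by (auto simp: visible_def)
  define z where "z = T x"
  define L where "L = {v. \<exists>s. T v = s *\<^sub>R z}"
  have L: "subspace L"
  proof (rule subspaceI)
    show "0 \<in> L" by (simp add: L_def exI[of _ 0])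
    show "u + v \<in> L" if "u \<in> L" "v \<in> L" for u v
      using that by (auto simp: L_def blinfun.add_right scaleR_add_left[symmetric])
    show "r *\<^sub>R v \<in> L" if "v \<in> L" for r v
      using that by (auto simp: L_def blinfun.scaleR_right)
  qed
  have xL: "x \<in> L" unfolding L_def z_def by (auto intro: exI[of _ 1])
  obtain p where p: "p \<in> C" "T p = z" using Tx unfolding z_def by (metis imageE)
  have pL: "p \<in> L" unfolding L_def using p(2) by (auto intro: exI[of _ 1])
  have z0: "z \<noteq> 0"
  proof
    assume z: "z = 0"
    obtain c' where c': "c' \<in> C" "T c' = c" using g unfolding gapped_def by (metis imageE)
    obtain t where t: "0 < t" "p - t *\<^sub>R c' \<in> C" using sub_small_C[OF p(1)] by blast
    have "T (p - t *\<^sub>R c') \<in> closure C" using g t(2) unfolding gapped_def by blast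
    then have "- (t *\<^sub>R c) \<in> closure C" by (simp add: blinfun.diff_right blinfun.scaleR_right p z c')
    moreover have "t *\<^sub>R c \<in> closure C" using gapped_cl[OF g C_in_cl[OF c'(1)]] c' t by (simp add: cl_scale)
    ultimately show False using pointed[of "t *\<^sub>R c"] c0 t by simp
  qed
  obtain a where a: "a \<in> L" "a \<noteq> 0" "a \<bullet> x \<le> 0" "\<And>v. v \<in> C \<inter> L \<Longrightarrow> 0 \<le> a \<bullet> v"
  proof (rule cone_separation[of "C \<inter> L" x L])
    show "convex (C \<inter> L)" using convex_C L by (simp add: convex_Int subspace_imp_convex)
    show "C \<inter> L \<noteq> {}" using p pL by blast
    show "t *\<^sub>R v \<in> C \<inter> L" if "v \<in> C \<inter> L" "0 < t" for v t
      using that scale_C subspace_scale[OF L] by blast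
  qed (use xC L xL in auto)
  have a_pos: "0 < a \<bullet> v" if v: "v \<in> C" "v \<in> L" for v
  proof -
    obtain t where t: "0 < t" "v - t *\<^sub>R a \<in> C" using sub_small_C[OF v(1)] by blast
    then have "0 \<le> a \<bullet> (v - t *\<^sub>R a)" using a(1,4) v(2) subspace_diff[OF L] subspace_scale[OF L] by blast
    moreover have "0 < t * (a \<bullet> a)" using t a by simp
    ultimately show ?thesis by (simp add: inner_diff_right)
  qed
  have a_cl: "0 \<le> a \<bullet> v" if v: "v \<in> closure C" "v \<in> L" for v
  proof (rule ccontr)
    assume n: "\<not> 0 \<le> a \<bullet> v"
    have ap: "0 < a \<bullet> p" using a_pos p pL by blast
    define t where "t = - (a \<bullet> v) / (a \<bullet> p)"
    have t: "0 < t" using n ap by (simp add: t_def divide_neg_pos)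
    have "t *\<^sub>R p + v \<in> C" using add_C_cl[OF scale_C[OF p(1) t] v(1)] .
    then have "0 < a \<bullet> (t *\<^sub>R p + v)"
      using a_pos subspace_add[OF L subspace_scale[OF L pL] v(2)] by blast
    moreover have "a \<bullet> (t *\<^sub>R p + v) = t * (a \<bullet> p) + a \<bullet> v" by (simp add: inner_add_right)
    moreover have "t * (a \<bullet> p) = - (a \<bullet> v)" using ap by (simp add: t_def)
    ultimately show False by linarith
  qed
  have ax: "a \<bullet> x = 0" using antisym[OF a(3) a_cl[OF xcl xL]] .
  have a_zero: "\<exists>s. v = s *\<^sub>R x" if v: "v \<in> closure C" "v \<in> L" "a \<bullet> v \<le> 0" for v
  proof (rule ccontr)
    assume n: "\<nexists>s. v = s *\<^sub>R x"
    then have "v \<noteq> 0" by (metis scaleR_zero_left)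
    moreover have "v \<notin> C" using a_pos[OF _ v(2)] v(3) by (meson not_le)
    ultimately have "x + v \<in> C" using x v(1) n unfolding visible_def by blast
    then have "0 < a \<bullet> (x + v)" using a_pos subspace_add[OF L xL v(2)] by blast
    then show False using ax v(3) by (simp add: inner_add_right)
  qed
  define S where "S = {v \<in> closure C. T v = c}"
  obtain c' where c': "c' \<in> C" "T c' = c" using g unfolding gapped_def by (metis imageE)
  have "closed S"
  proof -
    have "closed {v. T v = c}" by (intro closed_Collect_eq continuous_intros)
    then show ?thesis unfolding S_def by (simp add: Collect_conj_eq closed_Int)
  qed
  define S' where "S' = S \<inter> {v. a \<bullet> v \<le> a \<bullet> c'}"
  have "closed S'" unfolding S'_def using \<open>closed S\<close> by (simp add: closed_halfspace_le closed_Int)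
  moreover have "bounded S'"
  proof (rule ccontr)
    assume "\<not> bounded S'"
    then have "\<exists>v\<in>S'. real (Suc n) < norm v" for n by (meson bounded_iff not_le)
    then obtain v where v: "\<And>n. v n \<in> S'" "\<And>n. real (Suc n) < norm (v n)" by metis
    \<comment> \<open>A limit \<open>l\<close> of the directions of an unbounded sequence is in the kernel of \<open>T\<close>, where \<open>a\<close> is
      positive.\<close>
    define w where "w n = (1 / norm (v n)) *\<^sub>R v n" for n
    have vn: "0 < norm (v n)" for n using v(2)[of n] by linarith
    have "w n \<in> sphere 0 1" for n using vn[of n] by (simp add: w_def)
    then obtain l r where lr: "l \<in> sphere 0 1" "strict_mono (r :: nat \<Rightarrow> nat)" "(w \<circ> r) \<longlonglongrightarrow> l"
      using compact_sphere[of "0::'a" 1] unfolding compact_def by meson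
    have "w n \<in> closure C" for n
      unfolding w_def using v(1)[of n] by (intro cl_scale) (auto simp: S'_def S_def)
    then have lcl: "l \<in> closure C" using cl_limit[OF _ lr(3)] by simp
    have inv0: "(\<lambda>n. 1 / norm (v n)) \<longlonglongrightarrow> 0"
    proof (rule tendsto_sandwich[of "\<lambda>_. 0" _ _ "\<lambda>n. 1 / real (Suc n)"])
      show "\<forall>\<^sub>F n in sequentially. 1 / norm (v n) \<le> 1 / real (Suc n)"
        using v(2) by (intro always_eventually allI frac_le) (auto simp: less_imp_le)
      show "(\<lambda>n. 1 / real (Suc n)) \<longlonglongrightarrow> 0" by (intro LIMSEQ_Suc lim_1_over_n)
    qed auto
    have "T (w n) = (1 / norm (v n)) *\<^sub>R c" for n
      using v(1)[of n] by (simp add: w_def blinfun.scaleR_right S'_def S_def)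
    then have "(\<lambda>n. T (w n)) \<longlonglongrightarrow> 0" using tendsto_scaleR[OF inv0 tendsto_const[of c]] by simp
    from LIMSEQ_subseq_LIMSEQ[OF this lr(2)] have "(\<lambda>n. T (w (r n))) \<longlonglongrightarrow> 0" by (simp add: o_def)
    moreover have "(\<lambda>n. T (w (r n))) \<longlonglongrightarrow> T l"
      using blinfun.tendsto[OF tendsto_const lr(3)] by (simp add: o_def)
    ultimately have Tl: "T l = 0" using LIMSEQ_unique by blast
    have "a \<bullet> w n \<le> (1 / norm (v n)) * (a \<bullet> c')" for n
    proof -
      have "(1 / norm (v n)) * (a \<bullet> v n) \<le> (1 / norm (v n)) * (a \<bullet> c')"
        using v(1)[of n] by (intro mult_left_mono) (auto simp: S'_def)
      then show ?thesis by (simp add: w_def)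
    qed
    then have "a \<bullet> (w \<circ> r) n \<le> (1 / norm (v (r n))) * (a \<bullet> c')" for n by simp
    moreover have "(\<lambda>n. (1 / norm (v (r n))) * (a \<bullet> c')) \<longlonglongrightarrow> 0 * (a \<bullet> c')"
      using LIMSEQ_subseq_LIMSEQ[OF inv0 lr(2)] by (intro tendsto_mult tendsto_const) (simp add: o_def)
    moreover have "(\<lambda>n. a \<bullet> (w \<circ> r) n) \<longlonglongrightarrow> a \<bullet> l" by (intro tendsto_intros lr)
    ultimately have "a \<bullet> l \<le> 0 * (a \<bullet> c')" by (intro LIMSEQ_le) auto
    moreover have "l \<in> L" unfolding L_def using Tl by (auto intro: exI[of _ 0])
    ultimately obtain s where s: "l = s *\<^sub>R x" using a_zero[OF lcl] by auto
    then have "s *\<^sub>R z = 0" using Tl by (simp add: blinfun.scaleR_right z_def)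
    then have "l = 0" using s z0 by simp
    then show False using lr(1) by simp
  qed
  ultimately have "compact S'" by (simp add: compact_eq_bounded_closed)
  moreover have c'S: "c' \<in> S'" using c' C_in_cl by (simp add: S'_def S_def)
  moreover have "continuous_on S' (\<lambda>v. a \<bullet> v)" by (intro continuous_intros)
  ultimately obtain e where e: "e \<in> S'" "\<And>v. v \<in> S' \<Longrightarrow> a \<bullet> e \<le> a \<bullet> v"
    using continuous_attains_inf[of S' "\<lambda>v. a \<bullet> v"] by blast
  have e_min: "a \<bullet> e \<le> a \<bullet> v" if "v \<in> S" for v
  proof (cases "a \<bullet> v \<le> a \<bullet> c'")
    case True
    then show ?thesis using that by (intro e(2)) (simp add: S'_def)
  next
    case False
    then show ?thesis using e(2)[OF c'S] by linarith
  qed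
  have ecl: "e \<in> closure C" and Te: "T e = c" using e(1) by (auto simp: S'_def S_def)
  have "z \<notin> T ` open_face e"
  proof
    assume "z \<in> T ` open_face e"
    then obtain y where y: "y \<in> open_face e" "T y = z" by (metis imageE)
    obtain s t where st: "0 < s" "e - s *\<^sub>R y \<in> closure C" "0 < t" "y - t *\<^sub>R e \<in> closure C"
      and ycl: "y \<in> closure C"
      using y(1) by (auto simp: open_face_def)
    have yL: "y \<in> L" unfolding L_def using y(2) by (auto intro: exI[of _ 1])
    have "0 < a \<bullet> y"
    proof (rule ccontr)
      assume "\<not> 0 < a \<bullet> y"
      then obtain r where r: "y = r *\<^sub>R x" using a_zero[OF ycl yL] by auto
      then have "z = r *\<^sub>R z" using y(2) by (simp add: blinfun.scaleR_right z_def)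
      then have "r = 1" using z0 by (metis scaleR_cancel_right scaleR_one)
      then have "x - t *\<^sub>R e \<in> closure C" using st(4) r by simp
      then obtain q where q: "0 \<le> q" "e = q *\<^sub>R x" using extreme_below[OF xe ecl _ st(3)] by blast
      moreover have "q \<noteq> 0" using q Te c0 by auto
      ultimately have "extreme e" using extreme_scale[OF xe, of q] by simp
      then show False using gapped_center[OF g] Te by blast
    qed
    \<comment> \<open>Trading \<open>s y\<close> for \<open>s x\<close> keeps the image and lowers \<open>a\<close>, as \<open>a\<close> vanishes at \<open>x\<close> and not at \<open>y\<close>.\<close>
    define v where "v = (e - s *\<^sub>R y) + s *\<^sub>R x"
    have "v \<in> closure C" unfolding v_def using st xcl by (intro cl_add cl_scale) auto
    moreover have "T v = c" by (simp add: v_def blinfun.add_right blinfun.diff_right blinfun.scaleR_right Te y(2) z_def)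
    ultimately have "a \<bullet> e \<le> a \<bullet> v" by (intro e_min) (simp add: S_def)
    also have "\<dots> = a \<bullet> e - s * (a \<bullet> y)" by (simp add: v_def inner_add_right inner_diff_right ax)
    finally show False using \<open>0 < a \<bullet> y\<close> st(1) by (simp add: mult_le_0_iff)
  qed
  then show ?thesis using that ecl Te unfolding z_def by blast
qed

text \<open>The fibre contains a full line through an interior point, and a pointed cone contains no line.\<close>

lemma boundary_of_fibre:
  assumes g: "gapped T c d" and w: "w \<noteq> 0" "blinfun_apply T w = 0"
  obtains e where "e \<in> closure C" "e \<notin> C" "blinfun_apply T e = c"
proof -
  obtain w' where w': "w' \<notin> closure C" "T w' = 0"
  proof (cases "w \<in> closure C")
    case True
    then have "- w \<notin> closure C" using pointed w(1) by blast
    then show ?thesis using that[of "- w"] w(2) by (simp add: blinfun.minus_right)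
  qed (use that w in blast)
  obtain q where q: "q \<in> C" "T q = c" using g unfolding gapped_def by (metis imageE)
  have "\<exists>t>0. q + t *\<^sub>R w' \<notin> closure C"
  proof (rule ccontr)
    assume n: "\<not> (\<exists>t>0. q + t *\<^sub>R w' \<notin> closure C)"
    have "(1 / real (Suc n)) *\<^sub>R q + w' \<in> closure C" for n
    proof -
      have "q + real (Suc n) *\<^sub>R w' \<in> closure C" using n by (meson of_nat_0_less_iff zero_less_Suc)
      then have "(1 / real (Suc n)) *\<^sub>R (q + real (Suc n) *\<^sub>R w') \<in> closure C" by (rule cl_scale) simp
      moreover have "(1 / real (Suc n)) *\<^sub>R (real (Suc n) *\<^sub>R w') = w'" by (simp del: of_nat_Suc)
      ultimately show ?thesis by (metis scaleR_add_right)
    qed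
    moreover have "(\<lambda>n. (1 / real (Suc n)) *\<^sub>R q + w') \<longlonglongrightarrow> 0 *\<^sub>R q + w'"
      by (intro tendsto_intros LIMSEQ_Suc lim_1_over_n)
    ultimately have "0 *\<^sub>R q + w' \<in> closure C" by (rule cl_limit)
    then show False using w'(1) by simp
  qed
  then obtain t where t: "0 < t" "q + t *\<^sub>R w' \<notin> closure C" by blast
  let ?S = "closed_segment q (q + t *\<^sub>R w')"
  have "?S \<inter> frontier C \<noteq> {}"
  proof (rule connected_Int_frontier)
    show "connected ?S" by simp
    show "?S \<inter> C \<noteq> {}" using q by auto
    show "?S - C \<noteq> {}" using t C_in_cl by auto
  qed
  then obtain e where e: "e \<in> ?S" "e \<in> frontier C" by blast
  obtain u where "e = (1 - u) *\<^sub>R q + u *\<^sub>R (q + t *\<^sub>R w')" using e(1) by (auto simp: in_segment)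
  then have "e = q + (u * t) *\<^sub>R w'" by (simp add: algebra_simps)
  then have "T e = c" by (simp add: blinfun.add_right blinfun.scaleR_right q w')
  moreover have "e \<in> closure C" "e \<notin> C" using e(2) open_C by (auto simp: frontier_def interior_open)
  ultimately show ?thesis using that by blast
qed

end

context cocompact_cone
begin

text \<open>First, \<open>S x \<noteq> 0\<close>. As \<open>e\<close> is not extreme, its face has a nonzero vector \<open>g\<close> outside the open face:
  subtract from a summand \<open>a\<close> of \<open>e\<close> the largest possible multiple of \<open>e\<close>. Its pullback \<open>g'\<close> is a
  boundary vector with \<open>S g' = g\<close>. If \<open>S x\<close> were \<open>0\<close>, then \<open>x + g' \<in> C\<close> by visibility, and its image \<open>g\<close>
  would be in the open face. Now take \<open>v\<close> in the kernel of \<open>S\<close>: it is a boundary vector not on the ray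
  of \<open>x\<close>, so \<open>x + v\<close> is a vector of \<open>C\<close> with the same image as \<open>x\<close>.\<close>

lemma visible_in_open_face:
  assumes x: "visible x" and e: "e \<in> closure C" "e \<noteq> 0" "e \<notin> C" "\<not> extreme e"
    and A: "\<And>n. A n \<in> cone_aut" and S: "blinfun_apply S ` C = open_face e"
    and pull: "\<And>w s. w \<in> closure C \<Longrightarrow> 0 < s \<Longrightarrow> e - s *\<^sub>R w \<in> closure C \<Longrightarrow> \<exists>w'. pulled_back A S w w'"
    and ker: "\<exists>v\<in>closure C. v \<noteq> 0 \<and> blinfun_apply S v = 0"
  shows "blinfun_apply S x \<in> blinfun_apply S ` C"
proof -
  have e_neg: "- (t *\<^sub>R e) \<notin> closure C" if "0 < t" for t
    using pointed[of "t *\<^sub>R e"] cl_scale[OF e(1), of t] that e(2) by auto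
  obtain a b where ab: "a \<in> closure C" "b \<in> closure C" "a + b = e" "\<nexists>s. a = s *\<^sub>R e"
    using e(1,2,4) unfolding extreme_def by blast
  \<comment> \<open>Subtracting the largest possible multiple of \<open>e\<close> from \<open>a\<close> leads out of the open face.\<close>
  define I where "I = {t. 0 \<le> t \<and> a - t *\<^sub>R e \<in> closure C}"
  have "closed I"
  proof -
    have "I = {0..} \<inter> (\<lambda>t. a - t *\<^sub>R e) -` closure C" by (auto simp: I_def)
    moreover have "closed ((\<lambda>t. a - t *\<^sub>R e) -` closure C)"
      by (intro closed_vimage closed_closure continuous_intros)
    ultimately show ?thesis by (simp add: closed_Int)
  qed
  moreover have "bounded I"
  proof -
    have fe: "0 < f e" using f_pos e by blast
    have "norm t \<le> f a / f e" if t: "t \<in> I" for t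
    proof -
      have "0 \<le> f (a - t *\<^sub>R e)" using t f_nonneg by (simp add: I_def)
      then have "t * f e \<le> f a" by (simp add: linear_diff[OF linear_f] linear_cmul[OF linear_f])
      then show ?thesis using fe t by (simp add: I_def pos_le_divide_eq)
    qed
    then show ?thesis unfolding bounded_iff by blast
  qed
  ultimately have "compact I" by (simp add: compact_eq_bounded_closed)
  moreover have "I \<noteq> {}" using ab(1) by (auto simp: I_def intro!: exI[of _ 0])
  ultimately obtain t where t: "t \<in> I" "\<And>s. s \<in> I \<Longrightarrow> s \<le> t"
    using compact_attains_sup[of I] by blast
  define g where "g = a - t *\<^sub>R e"
  have gcl: "g \<in> closure C" using t(1) by (simp add: g_def I_def)
  have g0: "g \<noteq> 0" using ab(4) by (auto simp: g_def)
  have g_sub: "g - s *\<^sub>R e \<notin> closure C" if s: "0 < s" for s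
  proof
    assume "g - s *\<^sub>R e \<in> closure C"
    then have "t + s \<in> I" using t(1) s by (simp add: I_def g_def algebra_simps)
    then show False using t(2)[of "t + s"] s by simp
  qed
  have gC: "g \<notin> C"
  proof
    assume "g \<in> C"
    then obtain s where "0 < s" "g - s *\<^sub>R e \<in> C" using sub_small_C by blast
    then show False using g_sub C_in_cl by blast
  qed
  have "e - 1 *\<^sub>R g = b + t *\<^sub>R e" using ab(3) by (simp add: g_def algebra_simps)
  also have "\<dots> \<in> closure C" using ab(2) cl_scale[OF e(1), of t] t(1) by (simp add: cl_add I_def)
  finally obtain g' u r where g': "\<And>n. blinfun_apply (A (r n)) (u n) = g" "u \<longlonglongrightarrow> g'"
    "g' \<in> closure C" "S g' = g"
    using pull[OF gcl, of 1] by (auto simp: pulled_back_def)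
  have "u n \<notin> C" for n using g'(1)[of n] aut_C[OF A] gC by metis
  then have g'C: "g' \<notin> C" using not_C_limit g'(2) by blast
  have g'0: "g' \<noteq> 0" using g'(4) g0 by auto
  have Sx: "S x \<noteq> 0"
  proof
    assume S0: "S x = 0"
    have "g' \<noteq> s *\<^sub>R x" for s using S0 g'(4) g0 by (auto simp: blinfun.scaleR_right)
    then have "x + g' \<in> C" using x g'(3) g'0 g'C unfolding visible_def by blast
    then have "S (x + g') \<in> open_face e" using S by blast
    then have "g \<in> open_face e" by (simp add: blinfun.add_right S0 g'(4))
    then show False using g_sub unfolding open_face_def by blast
  qed
  obtain v where v: "v \<in> closure C" "v \<noteq> 0" "S v = 0" using ker by blast
  have "v \<notin> C"
  proof
    assume "v \<in> C"
    then have "0 \<in> open_face e" using S v(3) by force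
    then show False using e_neg unfolding open_face_def by auto
  qed
  moreover have "v \<noteq> s *\<^sub>R x" for s
  proof
    assume s: "v = s *\<^sub>R x"
    then have "s *\<^sub>R S x = 0" using v(3) by (simp add: blinfun.scaleR_right)
    then have "v = 0" using Sx s by simp
    then show False using v(2) by simp
  qed
  ultimately have "x + v \<in> C" using x v(1,2) unfolding visible_def by blast
  then have "S (x + v) \<in> S ` C" by blast
  then show ?thesis by (simp add: blinfun.add_right v(3))
qed

lemma gapped_refine:
  assumes g: "gapped T c d" and x: "extreme x" and e: "e \<in> closure C" "blinfun_apply T e = c"
  obtains S where "gapped (T o\<^sub>L S) c d" "blinfun_apply S ` C = open_face e"
    "\<And>y. e \<notin> C \<Longrightarrow> visible y \<Longrightarrow> blinfun_apply S y \<in> blinfun_apply S ` C"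
proof -
  obtain A S where A: "\<And>n. A n \<in> cone_aut" "A \<longlonglongrightarrow> S" and S: "blinfun_apply S ` C = open_face e"
    and pull: "\<And>w s. w \<in> closure C \<Longrightarrow> 0 < s \<Longrightarrow> e - s *\<^sub>R w \<in> closure C \<Longrightarrow> \<exists>w'. pulled_back A S w w'"
    and ker: "e \<notin> C \<Longrightarrow> \<exists>v\<in>closure C. v \<noteq> 0 \<and> blinfun_apply S v = 0"
    using radial_limit[OF e(1)] by blast
  have e0: "e \<noteq> 0" using gapped_center_nonzero[OF g x] e(2) by auto
  have ne: "\<not> extreme e" using gapped_center[OF g] e(2) by blast
  show ?thesis
  proof
    show "gapped (T o\<^sub>L S) c d"
      by (rule gapped_radial[OF gapped_cl[OF g] _ _ A S e]) (use g in \<open>auto simp: gapped_def\<close>)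
    show "S y \<in> S ` C" if "e \<notin> C" "visible y" for y
      by (rule visible_in_open_face[OF that(2) e(1) e0 that(1) ne A(1) S pull ker[OF that(1)]])
  qed (rule S)
qed

text \<open>Otherwise there are gapped maps with nontrivial kernel. Least rank makes the range of gapped
  maps stable under the limits and compositions that are used, so all images in question are open
  in the same space \<open>W\<close>. Minimality of the image is expressed by maximality of the set \<open>J T\<close> of those
  members of a dense sequence of forms that are nonnegative on \<open>T C\<close>. Limits exist because
  composing with automorphisms changes neither the image nor the gap and allows \<open>c\<close> to be attained at a
  point of \<open>K\<close>. A maximal map is then composed with two radial limits: the first puts the image of the
  visible vector into the image of \<open>C\<close>, the second removes it.\<close>

theorem extreme_near_boundary_point:
  assumes x: "visible x" and e0: "e0 \<in> closure C" "e0 \<notin> C" and d0: "0 < d0"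
  shows "\<exists>y. extreme y \<and> dist e0 y < d0"
proof (rule ccontr)
  assume "\<not> (\<exists>y. extreme y \<and> dist e0 y < d0)"
  then have none: "y \<notin> ball e0 d0" if "extreme y" for y using that by auto
  have xe: "extreme x" by (rule visible_extreme[OF x])
  define P where "P m \<longleftrightarrow> (\<exists>T c d. gapped T c d \<and> dim (range (blinfun_apply T)) = m)" for m
  have kernel: "dim (range (blinfun_apply T)) < DIM('a) \<longleftrightarrow> (\<exists>w. w \<noteq> 0 \<and> blinfun_apply T w = 0)"
    for T :: "'a \<Rightarrow>\<^sub>L 'a"
  proof -
    have "dim (range (blinfun_apply T)) < DIM('a) \<longleftrightarrow> dim (range (blinfun_apply T)) \<noteq> DIM('a)"
      using dim_subset_UNIV[of "range (blinfun_apply T)"] by linarith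
    also have "\<dots> \<longleftrightarrow> \<not> surj (blinfun_apply T)"
      using subspace_range_blinfun[of T] by (metis dim_eq_full dim_UNIV span_eq_iff)
    also have "\<dots> \<longleftrightarrow> \<not> inj (blinfun_apply T)"
      using linear_blinfun_apply[of T] linear_surjective_imp_injective linear_injective_imp_surjective
      by blast
    also have "\<dots> \<longleftrightarrow> (\<exists>w. w \<noteq> 0 \<and> blinfun_apply T w = 0)"
      using linear_injective_0[OF linear_blinfun_apply[of T]] by blast
    finally show ?thesis .
  qed
  obtain A S where A: "\<And>n. A n \<in> cone_aut" "A \<longlonglongrightarrow> S" and S: "blinfun_apply S ` C = open_face e0"
    and ker: "\<exists>v\<in>closure C. v \<noteq> 0 \<and> blinfun_apply S v = 0"
    using radial_limit[OF e0(1)] e0(2) by metis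
  have "gapped (id_blinfun o\<^sub>L S) e0 d0"
    by (rule gapped_radial[OF _ d0 _ A S e0(1)]) (use none in auto)
  then have PS: "P (dim (range (blinfun_apply (id_blinfun o\<^sub>L S))))" unfolding P_def by blast
  define m where "m = (LEAST m. P m)"
  have "m \<le> dim (range (blinfun_apply (id_blinfun o\<^sub>L S)))" unfolding m_def using PS by (rule Least_le)
  also have "\<dots> < DIM('a)" using kernel[of "id_blinfun o\<^sub>L S"] ker by auto
  finally have m: "m < DIM('a)" .
  have "P m" unfolding m_def using PS by (rule LeastI)
  then obtain T0 c d where T0: "gapped T0 c d" "dim (range (blinfun_apply T0)) = m" unfolding P_def by blast
  define W where "W = range (blinfun_apply T0)"
  define F where "F = {T. gapped T c d \<and> range (blinfun_apply T) \<subseteq> W}"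
  \<comment> \<open>The rank cannot drop below \<open>m\<close>, so the gap keeps limits of maps in \<open>F\<close> from degenerating.\<close>
  have FW: "range (blinfun_apply T) = W" if "T \<in> F" for T
  proof (rule subspace_dim_equal)
    have "P (dim (range (blinfun_apply T)))" using that unfolding P_def F_def by blast
    then have "m \<le> dim (range (blinfun_apply T))" unfolding m_def by (rule Least_le)
    then show "dim W \<le> dim (range (blinfun_apply T))" using T0(2) by (simp add: W_def)
  qed (use that in \<open>auto simp: W_def F_def subspace_range_blinfun\<close>)
  obtain D :: "'a set" where D: "countable D" "\<And>X. open X \<Longrightarrow> X \<noteq> {} \<Longrightarrow> \<exists>d\<in>D. d \<in> X"
    using countable_dense_exists by metis
  define l where "l = from_nat_into D"
  have dense: "\<exists>j. l j \<in> X" if X: "open X" "X \<noteq> {}" for X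
    using D(2)[OF X] from_nat_into_surj[OF D(1)] unfolding l_def by metis
  define J where "J T = {j. l j \<in> dual T}" for T
  have "\<exists>M\<in>J ` F. \<forall>X\<in>J ` F. M \<subseteq> X \<longrightarrow> X = M"
  proof (rule maximal_set_of_naturals)
    show "J ` F \<noteq> {}" using T0 by (auto simp: F_def W_def)
    fix a :: "nat \<Rightarrow> nat set" assume "\<And>i. a i \<in> J ` F"
    then have "\<exists>T. T \<in> F \<and> a i = J T" for i by blast
    then obtain T where T: "\<And>i. T i \<in> F" "\<And>i. a i = J (T i)" by metis
    have gT: "gapped (T i) c d" for i using T(1) by (simp add: F_def)
    have "\<exists>A k. A \<in> cone_aut \<and> k \<in> K \<and> T i (A k) = c" for i
    proof -
      obtain y where "y \<in> C" "T i y = c" using gT[of i] unfolding gapped_def by (metis imageE)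
      then show ?thesis using cocompact by metis
    qed
    then obtain A k where A: "\<And>i. A i \<in> cone_aut" and k: "\<And>i. k i \<in> K" and Ak: "\<And>i. T i (A i (k i)) = c"
      by metis
    \<comment> \<open>After composition with \<open>A i\<close> the value \<open>c\<close> is attained in \<open>K\<close>.\<close>
    define U where "U i = T i o\<^sub>L A i" for i
    have gU: "gapped (U i) c d" for i unfolding U_def by (rule gapped_aut[OF gT A])
    have Uk: "U i (k i) = c" for i by (simp add: U_def Ak)
    have UC: "U i v \<in> closure C" if "v \<in> C" for i v using gU that unfolding gapped_def by blast
    have "f (U i (k i)) \<le> f c" for i by (simp add: Uk)
    from convergent_subsequence[of U k, OF UC k this]
    obtain r U' q where r: "strict_mono r" and U': "(U \<circ> r) \<longlonglongrightarrow> U'" and q: "(k \<circ> r) \<longlonglongrightarrow> q" "q \<in> K"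
      by metis
    have lim: "(\<lambda>n. U (r n) v) \<longlonglongrightarrow> U' v" for v
      using blinfun.tendsto[OF U' tendsto_const[of v]] by (simp add: o_def)
    have "gapped U' c d"
      by (rule gapped_limit[OF _ U' q(1)]) (use gU q(2) K_C Uk in auto)
    moreover have "range (blinfun_apply U') \<subseteq> W"
    proof clarify
      fix v
      have "U (r n) v \<in> W" for n using T(1)[of "r n"] by (auto simp: F_def U_def)
      moreover have "closed W" unfolding W_def by (rule closed_subspace[OF subspace_range_blinfun])
      ultimately show "U' v \<in> W" using closed_sequentially[OF _ _ lim[of v]] by blast
    qed
    ultimately have "U' \<in> F" by (simp add: F_def)
    moreover have "j \<in> J U'" if j: "\<forall>i\<ge>j. j \<in> a i" for j
    proof -
      have "0 \<le> l j \<bullet> U' v" if v: "v \<in> C" for v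
      proof (rule LIMSEQ_le_const)
        show "(\<lambda>n. l j \<bullet> U (r n) v) \<longlonglongrightarrow> l j \<bullet> U' v" by (intro tendsto_intros lim)
        have "0 \<le> l j \<bullet> U (r n) v" if n: "j \<le> n" for n
        proof -
          have "j \<le> r n" using n seq_suble[OF r, of n] by linarith
          then have "l j \<in> dual (T (r n))" using j T(2) by (simp add: J_def)
          moreover have "A (r n) v \<in> C" using aut_C[OF A] v by blast
          ultimately show ?thesis by (simp add: dual_def U_def)
        qed
        then show "\<exists>N. \<forall>n\<ge>N. 0 \<le> l j \<bullet> U (r n) v" by blast
      qed
      then show ?thesis by (simp add: J_def dual_def)
    qed
    ultimately show "\<exists>b\<in>J ` F. \<forall>j. (\<forall>i\<ge>j. j \<in> a i) \<longrightarrow> j \<in> b" by blast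
  qed
  then obtain T1 where T1: "T1 \<in> F" and max: "\<And>T. T \<in> F \<Longrightarrow> J T1 \<subseteq> J T \<Longrightarrow> J T = J T1" by blast
  have compose: "T o\<^sub>L R \<in> F \<and> dual T \<subseteq> dual (T o\<^sub>L R)"
    if "T \<in> F" "gapped (T o\<^sub>L R) c d" "blinfun_apply R ` C = open_face e" for T R e
  proof
    show "T o\<^sub>L R \<in> F" using that by (auto simp: F_def)
    have "R v \<in> closure C" if "v \<in> C" for v using \<open>R ` C = open_face e\<close> that open_face_cl by blast
    then show "dual T \<subseteq> dual (T o\<^sub>L R)" using dual_cl by (auto simp: dual_def)
  qed
  have "\<exists>w. w \<noteq> 0 \<and> T1 w = 0" using kernel[of T1] FW[OF T1] T0(2) m by (simp add: W_def)
  moreover have g1: "gapped T1 c d" using T1 by (simp add: F_def)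
  ultimately obtain e1 where e1: "e1 \<in> closure C" "e1 \<notin> C" "T1 e1 = c"
    using boundary_of_fibre by metis
  obtain S1 where S1: "gapped (T1 o\<^sub>L S1) c d" "S1 ` C = open_face e1" "S1 x \<in> S1 ` C"
    using gapped_refine[OF g1 xe e1(1,3)] e1(2) x by metis
  define T2 where "T2 = T1 o\<^sub>L S1"
  have T2: "T2 \<in> F" "dual T1 \<subseteq> dual T2" using compose[OF T1 S1(1,2)] by (auto simp: T2_def)
  have J2: "J T2 = J T1" by (rule max[OF T2(1)]) (use T2(2) in \<open>auto simp: J_def\<close>)
  have g2: "gapped T2 c d" using T2 by (simp add: F_def)
  have T2x: "T2 x \<in> T2 ` C" using S1(3) by (auto simp: T2_def image_iff)
  obtain e2 where e2: "e2 \<in> closure C" "T2 e2 = c" "T2 x \<notin> T2 ` open_face e2"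
    using open_face_missing[OF g2 x T2x] by blast
  obtain S2 where S2: "gapped (T2 o\<^sub>L S2) c d" "S2 ` C = open_face e2"
    using gapped_refine[OF g2 xe e2(1,2)] by metis
  define T3 where "T3 = T2 o\<^sub>L S2"
  have T3: "T3 \<in> F" "dual T2 \<subseteq> dual T3" using compose[OF T2(1) S2] by (auto simp: T3_def)
  have J3: "J T3 = J T1" by (rule max[OF T3(1)]) (use T3(2) T2(2) in \<open>auto simp: J_def\<close>)
  have "T3 ` C = T2 ` open_face e2" by (simp add: T3_def S2(2)[symmetric] image_image)
  then have "T2 x \<notin> T3 ` C" using e2(3) by simp
  moreover have "T3 v \<in> closure C" if "v \<in> C" for v using T3(1) that by (auto simp: F_def gapped_def)
  ultimately obtain u \<delta> where u: "0 < \<delta>" "ball u \<delta> \<subseteq> dual T3 - dual T2"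
    using dual_separation[of T3 T2 "T2 x"] FW[OF T2(1)] FW[OF T3(1)] T2x by metis
  then obtain j where "l j \<in> ball u \<delta>" using dense[of "ball u \<delta>"] by auto
  then have "j \<in> J T3" "j \<notin> J T2" using u(2) by (auto simp: J_def)
  then show False using J2 J3 by simp
qed

end

section \<open>The cone over a convex domain\<close>

locale convex_domain_chart =
  fixes \<Omega> :: "'a::euclidean_space proj_space set" and f :: "'a \<Rightarrow> real"
  assumes lin: "linear f" and open_\<Omega>: "open \<Omega>" and \<Omega>_nonempty: "\<Omega> \<noteq> {}"
    and \<Omega>_chart: "\<Omega> \<subseteq> affine_chart f"
    and convex_chart: "convex (chart_image f \<Omega>)" and bounded_chart: "bounded (chart_image f \<Omega>)"
begin

definition C :: "'a set"
  where "C = {v. 0 < f v \<and> line v \<in> \<Omega>}"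

lemma f_nonzero: "f v \<noteq> 0 \<Longrightarrow> v \<noteq> 0"
  using linear_0[OF lin] by auto

lemma line_uminus: "v \<noteq> 0 \<Longrightarrow> line (- v) = line v"
  using line_scaleR[of v "-1"] by simp

lemma line_in_\<Omega>: "v \<noteq> 0 \<Longrightarrow> line v \<in> \<Omega> \<longleftrightarrow> v \<in> C \<or> - v \<in> C"
  using \<Omega>_chart mem_affine_chart_iff[OF lin, of v] line_uminus[of v] linear_neg[OF lin, of v]
  by (auto simp: C_def)

lemma continuous_f: "continuous_on S f"
  using lin linear_continuous_on linear_conv_bounded_linear by blast

lemma open_C': "open C"
proof -
  have "C = {v. v \<noteq> 0 \<and> line v \<in> \<Omega>} \<inter> {v. 0 < f v}" using linear_0[OF lin] by (auto simp: C_def)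
  moreover have "open {v. 0 < f v}" by (intro open_Collect_less continuous_intros continuous_f)
  ultimately show ?thesis using open_line_preimage[OF open_\<Omega>] by (simp add: open_Int)
qed

lemma chart_of_C:
  assumes "c \<in> C"
  shows "(1 / f c) *\<^sub>R c \<in> chart_image f \<Omega>"
  using assms f_nonzero[of c] by (simp add: C_def chart_image_def linear_cmul[OF lin] line_scaleR)

lemma C_of_chart:
  assumes "v \<in> chart_image f \<Omega>" "0 < t"
  shows "t *\<^sub>R v \<in> C"
  using assms f_nonzero[of v] by (simp add: C_def chart_image_def linear_cmul[OF lin] line_scaleR)

lemma norm_C:
  obtains B where "0 < B" "\<And>v. v \<in> closure C \<Longrightarrow> norm v \<le> B * f v"
proof -
  obtain B where B: "0 < B" "\<And>v. v \<in> chart_image f \<Omega> \<Longrightarrow> norm v \<le> B"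
    using bounded_chart by (auto simp: bounded_pos)
  have "norm c \<le> B * f c" if c: "c \<in> C" for c
  proof -
    have "0 < f c" using c by (simp add: C_def)
    then show ?thesis using B(2)[OF chart_of_C[OF c]] by (simp add: field_simps)
  qed
  moreover have "closed {v. norm v \<le> B * f v}"
    by (intro closed_Collect_le continuous_intros continuous_f)
  ultimately have "closure C \<subseteq> {v. norm v \<le> B * f v}" by (intro closure_minimal) auto
  then show ?thesis using that[OF B(1)] by blast
qed

sublocale pointed_cone C f
proof
  show "open C" by (rule open_C')
  show "c + d \<in> C" if cd: "c \<in> C" "d \<in> C" for c d
  proof -
    have p: "0 < f c" "0 < f d" using cd by (auto simp: C_def)
    then have p': "0 < f c + f d" by simp
    have "(f c / (f c + f d)) *\<^sub>R ((1 / f c) *\<^sub>R c) + (f d / (f c + f d)) *\<^sub>R ((1 / f d) *\<^sub>R d)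
        \<in> chart_image f \<Omega>"
      using p p' by (intro convexD[OF convex_chart] chart_of_C cd) (auto simp: add_divide_distrib[symmetric])
    from C_of_chart[OF this p'] show ?thesis using p p' by (simp add: scaleR_add_right)
  qed
  show "t *\<^sub>R c \<in> C" if "c \<in> C" "0 < t" for c t
    using that f_nonzero[of c] by (simp add: C_def linear_cmul[OF lin] line_scaleR)
  show "C \<noteq> {}"
  proof -
    obtain x where "x \<in> \<Omega>" using \<Omega>_nonempty by blast
    moreover obtain v where "v \<noteq> 0" "x = line v" by (rule line_exhaust)
    ultimately show ?thesis using line_in_\<Omega> by blast
  qed
  show "0 < f v" if v: "v \<in> closure C" "v \<noteq> 0" for v
  proof -
    obtain B where "0 < B" "\<And>v. v \<in> closure C \<Longrightarrow> norm v \<le> B * f v" using norm_C by blast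
    then have "0 < B" "0 < B * f v" using v by (auto intro: less_le_trans[of 0 "norm v"])
    then show ?thesis by (simp add: zero_less_mult_iff)
  qed
qed (simp_all add: linear_add[OF lin] linear_cmul[OF lin])

lemma line_in_closure: "v \<noteq> 0 \<Longrightarrow> line v \<in> closure \<Omega> \<longleftrightarrow> v \<in> closure C \<or> - v \<in> closure C"
proof
  assume v: "v \<noteq> 0" and "v \<in> closure C \<or> - v \<in> closure C"
  then obtain w where w: "w \<in> closure C" "w \<noteq> 0" "line w = line v" using line_uminus[OF v] by force
  show "line v \<in> closure \<Omega>"
  proof (rule ccontr)
    assume "line v \<notin> closure \<Omega>"
    then have "w \<in> {u. u \<noteq> 0 \<and> line u \<in> - closure \<Omega>}" using w by simp
    moreover have "open {u::'a. u \<noteq> 0 \<and> line u \<in> - closure \<Omega>}" by (rule open_line_preimage) auto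
    ultimately obtain u where "u \<in> C" "line u \<in> - closure \<Omega>"
      using w(1) open_Int_closure_eq_empty[of "{u. u \<noteq> 0 \<and> line u \<in> - closure \<Omega>}" C] by blast
    then show False using closure_subset by (auto simp: C_def)
  qed
next
  assume v: "v \<noteq> 0" and cl: "line v \<in> closure \<Omega>"
  show "v \<in> closure C \<or> - v \<in> closure C"
  proof (rule ccontr)
    assume n: "\<not> (v \<in> closure C \<or> - v \<in> closure C)"
    define S where "S = - (closure C \<union> uminus ` closure C)"
    have mem: "u \<in> S \<longleftrightarrow> u \<notin> closure C \<and> - u \<notin> closure C" for u
      unfolding S_def by (metis Compl_iff Un_iff add.inverse_inverse image_iff)
    have S: "open S" unfolding S_def by (intro open_Compl closed_Un closed_closure closed_negations)
    have S0: "0 \<notin> S" using zero_cl by (simp add: mem)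
    have Ssc: "t *\<^sub>R u \<in> S" if u: "u \<in> S" and t: "t \<noteq> 0" for u t
    proof (rule ccontr)
      assume "t *\<^sub>R u \<notin> S"
      then have "t *\<^sub>R u \<in> closure C \<or> - (t *\<^sub>R u) \<in> closure C" by (simp add: mem)
      then have "(1 / \<bar>t\<bar>) *\<^sub>R (t *\<^sub>R u) \<in> closure C \<or> (1 / \<bar>t\<bar>) *\<^sub>R (- (t *\<^sub>R u)) \<in> closure C"
        using cl_scale by (meson divide_nonneg_nonneg abs_ge_zero zero_le_one)
      then have "u \<in> closure C \<or> - u \<in> closure C" using t by (cases "0 < t") auto
      then show False using u mem by blast
    qed
    have "v \<in> S" using n mem by blast
    then have "line v \<in> line ` S" by blast
    moreover have "line ` S \<inter> \<Omega> = {}"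
    proof (rule ccontr)
      assume "line ` S \<inter> \<Omega> \<noteq> {}"
      then obtain u where u: "u \<in> S" "line u \<in> \<Omega>" by blast
      then have "u \<noteq> 0" using S0 by blast
      then show False using u line_in_\<Omega> C_in_cl mem by blast
    qed
    ultimately show False
      using cl open_Int_closure_eq_empty[OF open_line_image(1)[OF S S0 Ssc], of \<Omega>] by blast
  qed
qed

lemma boundary_rep:
  assumes "x \<in> closure \<Omega> - \<Omega>"
  obtains e where "e \<in> closure C" "e \<notin> C" "e \<noteq> 0" "x = line e"
proof -
  obtain v where v: "v \<noteq> 0" "x = line v" by (rule line_exhaust)
  then have "v \<in> closure C \<or> - v \<in> closure C" "v \<notin> C" "- v \<notin> C"
    using assms line_in_closure line_in_\<Omega> by blast+
  then show ?thesis using that[of v] that[of "- v"] v line_uminus[OF v(1)] by auto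
qed

text \<open>A lift maps \<open>C\<close> into \<open>C \<union> - C\<close>, and since \<open>C\<close> is convex the sign is constant; it is normalized to be
  positive.\<close>

lemma Aut_lift:
  assumes "h \<in> Aut \<Omega>"
  obtains A where "A \<in> cone_aut" "pgl_act h = pgl_act (pgl_class A)"
proof -
  obtain A0 where A0: "bij (blinfun_apply A0)" "h = pgl_class A0" by (rule pgl_class_exhaust)
  have act: "pgl_act h (line v) = line (A0 v)" if "v \<noteq> 0" for v using pgl_act_line[OF A0(1) that] A0(2) by simp
  have A0nz: "A0 v \<noteq> 0" if "v \<noteq> 0" for v using A0(1) that by (metis bij_is_inj blinfun.zero_right injD)
  have C0: "c \<noteq> 0" if "c \<in> C" for c using that zero_not_C by blast
  have h\<Omega>: "pgl_act h ` \<Omega> = \<Omega>" using assms by (simp add: Aut_def)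
  have A0C: "A0 c \<in> C \<or> - A0 c \<in> C" if c: "c \<in> C" for c
  proof -
    have "line c \<in> \<Omega>" using c by (simp add: C_def)
    then have "line (A0 c) \<in> \<Omega>" using h\<Omega> act[OF C0[OF c]] by (metis image_eqI)
    then show ?thesis using line_in_\<Omega>[OF A0nz[OF C0[OF c]]] by blast
  qed
  have fA0: "linear (\<lambda>v. f (A0 v))" using linear_compose[OF linear_blinfun_apply lin] by (simp add: o_def)
  have nz: "f (A0 c) \<noteq> 0" if "c \<in> C" for c
    using A0C[OF that] linear_neg[OF lin, of "A0 c"] by (auto simp: C_def)
  have sign: "0 < f (A0 c) * f (A0 d)" if cd: "c \<in> C" "d \<in> C" for c d
  proof (rule ccontr)
    assume "\<not> 0 < f (A0 c) * f (A0 d)"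
    then have neg: "f (A0 c) * f (A0 d) < 0" using nz[OF cd(1)] nz[OF cd(2)] by (simp add: not_less less_le)
    \<comment> \<open>If the signs at \<open>c\<close> and \<open>d\<close> differ, the form \<open>f \<circ> A0\<close> vanishes at this vector of \<open>C\<close>.\<close>
    define z where "z = \<bar>f (A0 d)\<bar> *\<^sub>R c + \<bar>f (A0 c)\<bar> *\<^sub>R d"
    have "z \<in> C" unfolding z_def using cd nz by (intro add_C scale_C) auto
    moreover have "f (A0 z) = \<bar>f (A0 d)\<bar> * f (A0 c) + \<bar>f (A0 c)\<bar> * f (A0 d)"
      using linear_add[OF fA0] linear_cmul[OF fA0] by (simp add: z_def)
    moreover have "\<bar>f (A0 d)\<bar> * f (A0 c) + \<bar>f (A0 c)\<bar> * f (A0 d) = 0"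
      using neg by (auto simp: mult_less_0_iff)
    ultimately show False using nz by simp
  qed
  obtain c0 where c0: "c0 \<in> C" using C_nonempty by blast
  define A where "A = sgn (f (A0 c0)) *\<^sub>R A0"
  have sg: "sgn (f (A0 c0)) = 1 \<or> sgn (f (A0 c0)) = - 1" using nz[OF c0] by (auto simp: sgn_if)
  have Aeq: "(\<forall>v. A v = A0 v) \<or> (\<forall>v. A v = - A0 v)"
    using sg unfolding A_def by (auto simp: blinfun.scaleR_left)
  have lineA: "line (A v) = line (A0 v)" if "v \<noteq> 0" for v using Aeq line_uminus[OF A0nz[OF that]] by auto
  have AC: "A c \<in> C" if c: "c \<in> C" for c
  proof -
    have "0 < f (A c)"
      using sign[OF c0 c] unfolding A_def
      by (auto simp: blinfun.scaleR_left linear_cmul[OF lin] sgn_if zero_less_mult_iff)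
    then show ?thesis using A0C[OF c] Aeq linear_neg[OF lin, of "A0 c"] by (fastforce simp: C_def)
  qed
  have "bij (blinfun_apply A)"
  proof -
    have "bij (uminus :: 'a \<Rightarrow> 'a)" by (rule o_bij[of uminus]) auto
    then have "bij (uminus \<circ> blinfun_apply A0)" using A0(1) by (rule bij_comp[rotated])
    moreover have "blinfun_apply A = blinfun_apply A0 \<or> blinfun_apply A = uminus \<circ> blinfun_apply A0"
      using Aeq by (auto simp: fun_eq_iff)
    ultimately show ?thesis using A0(1) by metis
  qed
  moreover have "A ` C = C"
  proof (intro subset_antisym subsetI)
    fix c assume c: "c \<in> C"
    then have "line c \<in> pgl_act h ` \<Omega>" using h\<Omega> by (simp add: C_def)
    then obtain x where x: "x \<in> \<Omega>" "line c = pgl_act h x" by blast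
    obtain v where v: "v \<noteq> 0" "x = line v" by (rule line_exhaust)
    then have "v \<in> C \<or> - v \<in> C" using x(1) line_in_\<Omega> by blast
    then obtain w where w: "w \<in> C" "x = line w" using v line_uminus by metis
    have "line (A w) = line c" using x(2) w act C0 lineA by metis
    then obtain k where k: "k \<noteq> 0" "c = k *\<^sub>R A w"
      using line_eq_iff C0[OF AC[OF w(1)]] C0[OF c] by metis
    have "0 < f c" "0 < f (A w)" using c AC[OF w(1)] by (auto simp: C_def)
    then have "0 < k" using k(2) by (simp add: linear_cmul[OF lin] zero_less_mult_iff)
    then have "k *\<^sub>R w \<in> C" "A (k *\<^sub>R w) = c" using scale_C[OF w(1)] k(2) by (auto simp: blinfun.scaleR_right)
    then show "c \<in> A ` C" by blast
  qed (use AC in blast)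
  ultimately have A: "A \<in> cone_aut" by (simp add: cone_aut_def)
  have "pgl_act h x = pgl_act (pgl_class A) x" for x
  proof -
    obtain v where v: "v \<noteq> 0" "x = line v" by (rule line_exhaust)
    then show ?thesis using act lineA pgl_act_line[of A v] A by (simp add: cone_aut_def)
  qed
  then show ?thesis using that[OF A] by blast
qed

lemma cone_aut_Aut:
  assumes A: "A \<in> cone_aut"
  shows "pgl_class A \<in> Aut \<Omega>"
proof -
  have bij: "bij (blinfun_apply A)" using A by (simp add: cone_aut_def)
  have \<Omega>C: "\<Omega> = line ` C"
  proof (intro subset_antisym subsetI)
    fix x assume x: "x \<in> \<Omega>"
    obtain v where v: "v \<noteq> 0" "x = line v" by (rule line_exhaust)
    then have "v \<in> C \<or> - v \<in> C" using x line_in_\<Omega> by blast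
    then show "x \<in> line ` C" using v line_uminus by (metis image_eqI)
  qed (auto simp: C_def)
  have "pgl_act (pgl_class A) (line c) = line (A c)" if "c \<in> C" for c
    using pgl_act_line[OF bij] that zero_not_C by metis
  then have "pgl_act (pgl_class A) ` line ` C = line ` A ` C" by (simp add: image_image)
  also have "A ` C = C" using A by (simp add: cone_aut_def)
  finally show ?thesis by (simp add: Aut_def \<Omega>C[symmetric])
qed

text \<open>The set \<open>\<Omega>\<close> is the increasing union of the open sets of points at distance more than \<open>1 / (j + 1)\<close>
  from the boundary, measured in the chart, so \<open>K0\<close> lies in one of them; its closure in the chart is
  a compact set in \<open>C\<close>.\<close>

lemma compact_lift:
  assumes K0: "compact K0" "K0 \<subseteq> \<Omega>"
  obtains K where "compact K" "K \<subseteq> C" "K0 \<subseteq> line ` K"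
proof -
  define \<phi> where "\<phi> v = infdist ((1 / f v) *\<^sub>R v) (- C)" for v
  have ne: "- C \<noteq> {}" and closed: "closed (- C)" using zero_not_C open_C by (auto simp: closed_def)
  have \<phi>_scale: "\<phi> (t *\<^sub>R v) = \<phi> v" if "t \<noteq> 0" for t v
    using that by (simp add: \<phi>_def linear_cmul[OF lin])
  define S where "S j = {v. f v \<noteq> 0} \<inter> \<phi> -` {1 / real (Suc j) <..}" for j
  have S: "open (S j)" for j
    unfolding S_def
  proof (rule continuous_open_preimage)
    show "continuous_on {v. f v \<noteq> 0} \<phi>"
      unfolding \<phi>_def by (intro continuous_intros continuous_f) auto
    show "open {v. f v \<noteq> 0}" by (intro open_Collect_neq continuous_intros continuous_f)
  qed simp
  have S0: "0 \<notin> S j" for j using linear_0[OF lin] by (simp add: S_def)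
  have Ssc: "t *\<^sub>R v \<in> S j" if "v \<in> S j" "t \<noteq> 0" for t v j
    using that by (simp add: S_def \<phi>_scale linear_cmul[OF lin])
  have mono: "S i \<subseteq> S j" if "i \<le> j" for i j
  proof -
    have "1 / real (Suc j) \<le> 1 / real (Suc i)" using that by (simp add: frac_le)
    then show ?thesis by (auto simp: S_def)
  qed
  have "K0 \<subseteq> (\<Union>j. line ` S j)"
  proof
    fix x assume "x \<in> K0"
    then have "x \<in> \<Omega>" using K0 by blast
    obtain v where v: "v \<noteq> 0" "x = line v" by (rule line_exhaust)
    then have "v \<in> C \<or> - v \<in> C" using \<open>x \<in> \<Omega>\<close> line_in_\<Omega> by blast
    then obtain w where w: "w \<in> C" "x = line w" using v line_uminus by metis
    have fw: "0 < f w" using w by (simp add: C_def)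
    have "(1 / f w) *\<^sub>R w \<in> C" using scale_C[OF w(1)] fw by simp
    then have "0 < \<phi> w" unfolding \<phi>_def
      using in_closed_iff_infdist_zero[OF closed ne] infdist_nonneg by (metis ComplD less_le)
    then obtain j where "1 / real (Suc j) < \<phi> w" using nat_approx_posE by blast
    then have "w \<in> S j" using fw by (simp add: S_def)
    then show "x \<in> (\<Union>j. line ` S j)" using w by blast
  qed
  moreover have "open (line ` S j)" for j by (rule open_line_image(1)[OF S S0 Ssc])
  ultimately obtain F where F: "finite F" "K0 \<subseteq> (\<Union>j\<in>F. line ` S j)"
    using compactE_image[OF K0(1), of UNIV "\<lambda>j. line ` S j"] by auto
  define J where "J = Max (insert 0 F)"
  have K0S: "K0 \<subseteq> line ` S J"
  proof
    fix x assume "x \<in> K0"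
    then obtain j where j: "j \<in> F" "x \<in> line ` S j" using F by blast
    then have "j \<le> J" using F(1) by (simp add: J_def)
    then show "x \<in> line ` S J" using j mono by blast
  qed
  define K where "K = {v. f v = 1} \<inter> {v. 1 / real (Suc J) \<le> infdist v (- C)} \<inter> closure C"
  have "closed K"
    unfolding K_def
    by (intro closed_Int closed_closure closed_Collect_eq closed_Collect_le continuous_intros continuous_f)
  moreover have "bounded K"
  proof -
    obtain B where B: "\<And>v. v \<in> closure C \<Longrightarrow> norm v \<le> B * f v" using norm_C by blast
    show ?thesis unfolding bounded_iff using B by (intro exI[of _ B]) (force simp: K_def)
  qed
  ultimately have "compact K" by (simp add: compact_eq_bounded_closed)
  moreover have "K \<subseteq> C"
  proof
    fix v assume v: "v \<in> K"
    have "0 < 1 / real (Suc J)" by simp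
    then have "infdist v (- C) \<noteq> 0" using v unfolding K_def by force
    then show "v \<in> C" using infdist_zero by (metis ComplI)
  qed
  moreover have "K0 \<subseteq> line ` K"
  proof
    fix x assume x: "x \<in> K0"
    then obtain v where v: "v \<in> S J" "x = line v" using K0S by blast
    have fv: "f v \<noteq> 0" using v by (simp add: S_def)
    define w where "w = (1 / f v) *\<^sub>R v"
    have fw: "f w = 1" using fv by (simp add: w_def linear_cmul[OF lin])
    have lw: "line w = x" using v(2) f_nonzero[OF fv] fv by (simp add: w_def line_scaleR)
    have "w \<in> C" using fw lw x K0(2) by (auto simp: C_def)
    moreover have "1 / real (Suc J) \<le> infdist w (- C)" using v(1) by (simp add: S_def \<phi>_def w_def)
    ultimately have "w \<in> K" using fw C_in_cl by (simp add: K_def)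
    then show "x \<in> line ` K" using lw by blast
  qed
  ultimately show ?thesis using that by blast
qed

text \<open>For \<open>\<xi>\<close>, \<open>y\<close> in the closed cone, the segment from \<open>\<real>\<xi>\<close> to \<open>\<real>y\<close> in the closure of \<open>\<Omega>\<close> is the image of the
  vector segment. If it meets \<open>C\<close> in \<open>u\<close>, then \<open>2 (\<xi> + y)\<close> is the sum of \<open>u\<close> and a vector of the closed cone.\<close>

lemma strongly_extremal_visible:
  assumes pc: "properly_convex \<Omega>" and x: "strongly_extremal \<Omega> x"
  obtains \<xi> where "visible \<xi>"
proof -
  obtain \<xi> where xi: "\<xi> \<in> closure C" "\<xi> \<notin> C" "\<xi> \<noteq> 0" "x = line \<xi>"
    using x boundary_rep unfolding strongly_extremal_def by blast
  have "\<xi> + y \<in> C" if y: "y \<in> closure C" "y \<noteq> 0" "y \<notin> C" "\<forall>s. y \<noteq> s *\<^sub>R \<xi>" for y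
  proof -
    have "- y \<notin> C" using pointed[OF y(1)] y(2) C_in_cl by blast
    then have ly: "line y \<in> closure \<Omega> - \<Omega>" using y line_in_closure line_in_\<Omega> by blast
    have "line \<xi> \<noteq> line y"
    proof
      assume "line \<xi> = line y"
      then obtain c where "y = c *\<^sub>R \<xi>" using line_eq_iff[OF xi(3) y(2)] by auto
      then show False using y(4) by simp
    qed
    then have "line y \<in> (closure \<Omega> - \<Omega>) - {x}" using ly xi(4) by simp
    then have meet: "proj_segment \<Omega> x (line y) \<inter> \<Omega> \<noteq> {}"
      using x by (simp add: strongly_extremal_def)
    let ?S = "line ` closed_segment \<xi> y"
    have seg: "u \<in> closure C \<and> 0 < f u" if u: "u \<in> closed_segment \<xi> y" for u
    proof -
      obtain t where t: "0 \<le> t" "t \<le> 1" "u = (1 - t) *\<^sub>R \<xi> + t *\<^sub>R y" using u by (auto simp: in_segment)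
      have "u \<in> closure C" unfolding t(3) using t xi y by (intro cl_add cl_scale) auto
      moreover have "0 < (1 - t) * f \<xi> + t * f y"
        using f_pos[OF xi(1,3)] f_pos[OF y(1,2)] t(1,2)
        by (cases "t = 0") (auto intro: add_nonneg_pos)
      ultimately show ?thesis by (simp add: t(3) linear_add[OF lin] linear_cmul[OF lin])
    qed
    have "0 \<notin> closed_segment \<xi> y" using seg linear_0[OF lin] by force
    then have "is_proj_segment x (line y) ?S" unfolding is_proj_segment_def using xi(4) by blast
    moreover have "?S \<subseteq> closure \<Omega>" using seg line_in_closure f_nonzero by (metis image_subsetI less_irrefl)
    ultimately have "proj_segment \<Omega> x (line y) = ?S"
      unfolding proj_segment_def
      using proj_segment_unique[OF pc, of x "line y"] x ly unfolding strongly_extremal_def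
      by (intro the1_equality) auto
    then obtain u where u: "u \<in> closed_segment \<xi> y" "line u \<in> \<Omega>" using meet by auto
    have uC: "u \<in> C" using seg[OF u(1)] u(2) by (simp add: C_def)
    obtain t where t: "0 \<le> t" "t \<le> 1" "u = (1 - t) *\<^sub>R \<xi> + t *\<^sub>R y" using u(1) by (auto simp: in_segment)
    have "2 *\<^sub>R (\<xi> + y) = u + ((1 + t) *\<^sub>R \<xi> + (2 - t) *\<^sub>R y)" by (simp add: t(3) algebra_simps scaleR_2)
    also have "\<dots> \<in> C" using t xi y by (intro add_C_cl uC cl_add cl_scale) auto
    finally have "2 *\<^sub>R (\<xi> + y) \<in> C" .
    then have "(1/2) *\<^sub>R (2 *\<^sub>R (\<xi> + y)) \<in> C" by (rule scale_C) simp
    then show ?thesis by simp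
  qed
  then have "visible \<xi>" using xi unfolding visible_def by blast
  then show ?thesis by (rule that)
qed

end

section \<open>The proximal limit set\<close>

theorem theorem1p3:
  fixes \<Omega> :: "'a::euclidean_space proj_space set"
  assumes "DIM('a) \<ge> 2"
    and "rank_one_divisible \<Omega>"
  shows "prox_limit_set \<Omega> = closure \<Omega> - \<Omega>"
proof -
  obtain \<Gamma> x where \<Omega>: "\<Omega> \<noteq> {}" "open \<Omega>" and pc: "properly_convex \<Omega>"
    and \<Gamma>: "\<Gamma> \<subseteq> Aut \<Omega>" "acts_cocompactly \<Gamma> \<Omega>" and x: "strongly_extremal \<Omega> x"
    using assms(2) unfolding rank_one_divisible_def divisible_def by blast
  obtain f where f: "linear f" "\<Omega> \<subseteq> affine_chart f" "convex (chart_image f \<Omega>)" "bounded (chart_image f \<Omega>)"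
    using pc unfolding properly_convex_def by blast
  interpret convex_domain_chart \<Omega> f by (rule convex_domain_chart.intro) (use f \<Omega> in auto)
  obtain K0 where K0: "compact K0" "K0 \<subseteq> \<Omega>" "\<Omega> = (\<Union>g\<in>\<Gamma>. pgl_act g ` K0)"
    using \<Gamma>(2) unfolding acts_cocompactly_def by blast
  obtain K where K: "compact K" "K \<subseteq> C" "K0 \<subseteq> line ` K" using compact_lift[OF K0(1,2)] by blast
  have nzC: "c \<noteq> 0" if "c \<in> C" for c using that zero_not_C by blast
  interpret cocompact_cone C f K
  proof
    show "\<exists>A\<in>cone_aut. \<exists>k\<in>K. c = blinfun_apply A k" if c: "c \<in> C" for c
    proof -
      have "line c \<in> \<Omega>" using c by (simp add: C_def)
      then obtain h k where h: "h \<in> \<Gamma>" "k \<in> K" "line c = pgl_act h (line k)" using K0(3) K(3) by blast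
      obtain A where A: "A \<in> cone_aut" "pgl_act h = pgl_act (pgl_class A)" using Aut_lift h(1) \<Gamma>(1) by blast
      have kC: "k \<in> C" using h(2) K(2) by blast
      have AkC: "A k \<in> C" using aut_C[OF A(1)] kC by blast
      have "line c = line (A k)"
        using h(3) A(2) pgl_act_line[of A k] A(1) nzC[OF kC] by (simp add: cone_aut_def)
      then obtain t where t: "t \<noteq> 0" "c = t *\<^sub>R A k" using line_eq_iff[OF nzC[OF AkC] nzC[OF c]] by auto
      have "0 < f c" "0 < f (A k)" using c AkC by (auto simp: C_def)
      then have "0 < t" using t(2) by (simp add: linear_cmul[OF lin] zero_less_mult_iff)
      moreover have "c = (t *\<^sub>R A) k" using t(2) by (simp add: blinfun.scaleR_left)
      ultimately show ?thesis using aut_scale[OF A(1)] h(2) by blast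
    qed
  qed (use K in auto)
  obtain \<xi> where xi: "visible \<xi>" using strongly_extremal_visible[OF pc x] by blast
  define L where "L = {y. \<exists>g \<in> Aut \<Omega>. proximal g \<and> attracting_fixpoint g y}"
  have "closure L \<subseteq> closure \<Omega> - \<Omega>"
  proof (rule closure_minimal)
    show "closed (closure \<Omega> - \<Omega>)" using \<Omega>(2) by (simp add: closed_Diff)
    show "L \<subseteq> closure \<Omega> - \<Omega>"
    proof
      fix y assume "y \<in> L"
      then obtain g where g: "g \<in> Aut \<Omega>" "attracting_fixpoint g y" unfolding L_def by blast
      obtain A where A: "A \<in> cone_aut" "pgl_act g = pgl_act (pgl_class A)" using Aut_lift[OF g(1)] by blast
      have att: "attracting_fixpoint (pgl_class A) y" using g(2) A(2) unfolding attracting_fixpoint_def by simp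
      obtain e where e: "e \<noteq> 0" "y = line e" by (rule line_exhaust)
      have "y \<in> closure \<Omega>"
        using attracting_fixpoint_closure[OF A(1) e(1)] att e line_in_closure by blast
      moreover have "e \<notin> C" "- e \<notin> C"
        using attracting_fixpoint_not_interior[OF A(1) _ assms(1)] att e line_uminus[OF e(1)] by metis+
      ultimately show "y \<in> closure \<Omega> - \<Omega>" using e line_in_\<Omega> by blast
    qed
  qed
  moreover have "y \<in> closure L" if y: "y \<in> closure \<Omega> - \<Omega>" for y
  proof (rule ccontr)
    assume n: "y \<notin> closure L"
    obtain e where e: "e \<in> closure C" "e \<notin> C" "e \<noteq> 0" "y = line e" using boundary_rep[OF y] by blast
    have op: "open (- closure L)" by (rule open_Compl[OF closed_closure])
    obtain d where d: "0 < d" "ball e d \<subseteq> {v. v \<noteq> 0 \<and> line v \<in> - closure L}"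
      using open_line_preimage[OF op] e(3,4) n
      by (metis (mono_tags, lifting) ComplI mem_Collect_eq open_contains_ball)
    obtain v where v: "extreme v" "dist e v < d"
      using extreme_near_boundary_point[OF xi e(1,2) d(1)] by blast
    have "v \<in> ball e d" using v(2) by simp
    then have "line v \<in> - closure L" using d(2) by blast
    then obtain A z where A: "A \<in> cone_aut" "z \<in> - closure L" "attracting_fixpoint (pgl_class A) z"
      using attracting_fixpoint_near_extreme[OF v(1) op] by blast
    then have "z \<in> L" using cone_aut_Aut[OF A(1)] unfolding L_def proximal_def by blast
    then show False using A(2) closure_subset by blast
  qed
  ultimately show ?thesis unfolding prox_limit_set_def L_def by blast
qed

end
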